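(* Let $m\ge 3$ be an integer. For every sequence of integers $(a_k)_{k=1}^{\infty}$ there exists an orientation-reversing homeomorphism $f\colon\mathbb{R}^m\to\mathbb{R}^m$ such that $f(0)=0$, the point $0$ is an isolated fixed point of $f^n$ for every $n\ge 1$, and $$\mathrm{ind}(f^n,0)=\sum_{k=1}^{\infty}a_k\,\mathrm{reg}_k(n)\qquad\text{for all } n\ge 1.$$
   Context: For a continuous self-map $F$ of $\mathbb{R}^m$ and an isolated fixed point $p$ of $F$, $\mathrm{ind}(F,p)\in\mathbb{Z}$ denotes the classical local fixed point index of $F$ at $p$. $f^n$ denotes the $n$-th iterate of $f$. Saying that $0$ is an isolated fixed point of $f^n$ for every $n\ge1$ means that for each $n$ there is a neighborhood of $0$, possibly depending on $n$, in which $0$ is the only fixed point of $f^n$. For an integer $k\ge 1$, $\mathrm{reg}_k(n)=k$ if $k\mid n$ and $\mathrm{reg}_k(n)=0$ otherwise; so for each $n$ the sum is finite. *)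

theory Defs
  imports "HOL-Analysis.Analysis" "HOL-Homology.Homology"
begin

text \<open>
  Throughout, \<open>\<real>\<^sup>m\<close> is \<^term>\<open>Euclidean_space m\<close>: the sequences \<open>x :: nat \<Rightarrow> real\<close> with
  \<open>x i = 0\<close> for \<open>i \<ge> m\<close>. Its origin is \<^term>\<open>(\<lambda>_. 0) :: nat \<Rightarrow> real\<close>, its Euclidean
  norm is \<^term>\<open>\<lambda>x. L2_set x {..<m}\<close>, and its unit sphere is \<^term>\<open>nsphere (m - 1)\<close>
  (for \<open>m \<ge> 1\<close>). Values of a self-map outside the carrier are irrelevant.
\<close>

definition direction :: "nat \<Rightarrow> (nat \<Rightarrow> real) \<Rightarrow> nat \<Rightarrow> real" where
  "direction m v = (\<lambda>i. v i / L2_set v {..<m})"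

text \<open>
  The degree of \<open>u \<mapsto> g (p + r u) / \<parallel>g (p + r u)\<parallel>\<close> on the unit sphere; meaningful when \<open>g\<close> has
  no zero on the sphere of radius \<open>r\<close> about \<open>p\<close>.
\<close>

definition sphere_degree ::
    "nat \<Rightarrow> ((nat \<Rightarrow> real) \<Rightarrow> nat \<Rightarrow> real) \<Rightarrow> (nat \<Rightarrow> real) \<Rightarrow> real \<Rightarrow> int" where
  "sphere_degree m g p r =
     Brouwer_degree2 (m - 1) (\<lambda>u. direction m (g (\<lambda>i. p i + r * u i)))"

text \<open>
  The local degree of \<open>g\<close> at an isolated zero \<open>p\<close>: the common value of the degrees on all
  sufficiently small spheres about \<open>p\<close> (it exists by \<open>local_degree_eq\<close> below).
\<close>

definition local_degree ::
    "nat \<Rightarrow> ((nat \<Rightarrow> real) \<Rightarrow> nat \<Rightarrow> real) \<Rightarrow> (nat \<Rightarrow> real) \<Rightarrow> int" where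
  "local_degree m g p = (THE d. \<forall>\<^sub>F r in at_right 0. sphere_degree m g p r = d)"

definition isolated_fixed_point ::
    "nat \<Rightarrow> ((nat \<Rightarrow> real) \<Rightarrow> nat \<Rightarrow> real) \<Rightarrow> (nat \<Rightarrow> real) \<Rightarrow> bool" where
  "isolated_fixed_point m F p \<longleftrightarrow>
     F p = p \<and> (\<exists>U. openin (Euclidean_space m) U \<and> p \<in> U \<and> (\<forall>x\<in>U. F x = x \<longrightarrow> x = p))"

text \<open>
  The sign convention is that of \<open>id - F\<close>, so that a constant map has index \<open>1\<close>.
\<close>

definition fixed_point_index ::
    "nat \<Rightarrow> ((nat \<Rightarrow> real) \<Rightarrow> nat \<Rightarrow> real) \<Rightarrow> (nat \<Rightarrow> real) \<Rightarrow> int" where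
  "fixed_point_index m F p = local_degree m (\<lambda>x i. x i - F x i) p"

text \<open>
  A homeomorphism of \<open>\<real>\<^sup>m\<close> has local degree \<open>1\<close> at every point or \<open>-1\<close> at every point.
\<close>

definition orientation_reversing ::
    "nat \<Rightarrow> ((nat \<Rightarrow> real) \<Rightarrow> nat \<Rightarrow> real) \<Rightarrow> bool" where
  "orientation_reversing m f \<longleftrightarrow>
     homeomorphic_map (Euclidean_space m) (Euclidean_space m) f \<and>
     (\<forall>p \<in> topspace (Euclidean_space m). local_degree m (\<lambda>x i. f x i - f p i) p = - 1)"

definition reg :: "nat \<Rightarrow> nat \<Rightarrow> int" where
  "reg k n = (if k dvd n then int k else 0)"


text \<open>Well-definedness of the local degree and of the sum over all \<open>k\<close>.\<close>

lemma small_spheres_subset: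
  assumes U: "openin (Euclidean_space m) U" and p: "p \<in> U" and m: "m \<ge> 1"
  obtains e where "e > 0"
    "\<And>r u. \<bar>r\<bar> < e \<Longrightarrow> u \<in> topspace (nsphere (m - 1)) \<Longrightarrow> (\<lambda>i. p i + r * u i) \<in> U"
proof -
  obtain T where T: "openin (powertop_real UNIV) T" and UT: "U = T \<inter> {x. \<forall>i\<ge>m. x i = 0}"
    using U unfolding Euclidean_space_def openin_subtopology by auto
  have pT: "p \<in> T" using p UT by auto
  obtain X where X: "p \<in> (\<Pi>\<^sub>E i\<in>UNIV. X i)" "\<And>i. open (X i)"
      "finite {i. X i \<noteq> UNIV}" "(\<Pi>\<^sub>E i\<in>UNIV. X i) \<subseteq> T"
    using product_topology_open_contains_basis[OF T pT] by auto
  have "\<exists>d>0. \<forall>y. \<bar>y - p i\<bar> < d \<longrightarrow> y \<in> X i" for i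
  proof -
    have "p i \<in> X i" using X(1) by (auto simp: PiE_iff)
    then show ?thesis
      using X(2)[of i] unfolding open_dist dist_real_def by auto
  qed
  then obtain d where d: "\<And>i. d i > 0" "\<And>i y. \<bar>y - p i\<bar> < d i \<Longrightarrow> y \<in> X i" by metis
  define e where "e = Min (insert 1 (d ` {i. X i \<noteq> UNIV}))"
  have e0: "e > 0" unfolding e_def using X(3) d(1) by (subst Min_gr_iff) auto
  have ed: "e \<le> d i" if "X i \<noteq> UNIV" for i
    unfolding e_def using X(3) that by (intro Min_le) auto
  show ?thesis
  proof (rule that[OF e0])
    fix r u assume r: "\<bar>r\<bar> < e" and u: "u \<in> topspace (nsphere (m - 1))"
    have us: "(\<Sum>i\<le>m-1. u i ^ 2) = 1" and u0: "\<And>i. i \<ge> m \<Longrightarrow> u i = 0"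
      using u m by (auto simp: nsphere)
    have u1: "\<bar>u i\<bar> \<le> 1" for i
    proof (cases "i < m")
      case True
      have "u i ^ 2 \<le> (\<Sum>i\<le>m-1. u i ^ 2)"
        using True by (intro member_le_sum) auto
      then show ?thesis using us by (simp add: abs_square_le_1)
    qed (simp add: u0)
    have "p i + r * u i \<in> X i" for i
    proof (cases "X i = UNIV")
      case False
      have "\<bar>r * u i\<bar> \<le> \<bar>r\<bar>" using u1[of i] by (simp add: abs_mult mult_left_le)
      then show ?thesis using ed[OF False] r by (intro d(2)) simp
    qed simp
    then have "(\<lambda>i. p i + r * u i) \<in> T" using X(4) by (auto simp: PiE_iff)
    moreover have "p i = 0" if "i \<ge> m" for i using p UT that by auto
    ultimately show "(\<lambda>i. p i + r * u i) \<in> U" using u0 by (auto simp: UT)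
  qed
qed

lemma L2_set_eq_0_Euclidean:
  assumes "v \<in> topspace (Euclidean_space m)"
  shows "L2_set v {..<m} = 0 \<longleftrightarrow> v = (\<lambda>_. 0)"
proof -
  have "L2_set v {..<m} = 0 \<longleftrightarrow> (\<forall>i<m. v i = 0)" by (auto simp: L2_set_eq_0_iff)
  then show ?thesis using assms by (auto simp: topspace_Euclidean_space fun_eq_iff) (meson leI)
qed

lemma continuous_map_direction:
  assumes g: "continuous_map X (Euclidean_space m) g" and m: "m \<ge> 1"
    and nz: "\<And>x. x \<in> topspace X \<Longrightarrow> g x \<noteq> (\<lambda>_. 0)"
  shows "continuous_map X (nsphere (m - 1)) (\<lambda>x. direction m (g x))"
proof -
  have gi: "continuous_map X euclideanreal (\<lambda>x. g x i)" for i
    using g unfolding Euclidean_space_def continuous_map_in_subtopology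
      continuous_map_componentwise_UNIV by auto
  have gt: "g x \<in> topspace (Euclidean_space m)" if "x \<in> topspace X" for x
    using g that by (auto simp: continuous_map_def)
  have L0: "L2_set (g x) {..<m} \<noteq> 0" if "x \<in> topspace X" for x
    using L2_set_eq_0_Euclidean[OF gt] nz that by auto
  have Lc: "continuous_map X euclideanreal (\<lambda>x. L2_set (g x) {..<m})"
  proof -
    have "continuous_map X euclideanreal (\<lambda>x. \<Sum>i<m. (g x i)\<^sup>2)"
      by (intro continuous_intros gi) auto
    then have "continuous_map X euclideanreal (sqrt \<circ> (\<lambda>x. \<Sum>i<m. (g x i)\<^sup>2))"
      by (rule continuous_map_compose) (simp add: continuous_on_real_sqrt)
    then show ?thesis by (simp add: L2_set_def o_def)
  qed
  have c: "continuous_map X euclideanreal (\<lambda>x. direction m (g x) i)" for i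
    unfolding direction_def by (intro continuous_map_real_divide gi Lc L0)
  have m1: "{..m - 1} = {..<m}" using m by auto
  have s: "(\<Sum>i\<le>m-1. direction m (g x) i ^ 2) = 1" if "x \<in> topspace X" for x
  proof -
    have "(\<Sum>i\<le>m-1. direction m (g x) i ^ 2) = (\<Sum>i<m. g x i ^ 2) / (L2_set (g x) {..<m})^2"
      unfolding m1 direction_def by (simp add: power_divide sum_divide_distrib)
    also have "(\<Sum>i<m. g x i ^ 2) = (L2_set (g x) {..<m})^2"
      unfolding L2_set_def by (simp add: sum_nonneg)
    finally show ?thesis using L0[OF that] by simp
  qed
  have z: "direction m (g x) i = 0" if "x \<in> topspace X" "i > m - 1" for x i
    using gt[OF that(1)] that(2) by (auto simp: direction_def topspace_Euclidean_space)
  show ?thesis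
    unfolding nsphere continuous_map_in_subtopology continuous_map_componentwise_UNIV
    using c s z by auto
qed

lemma local_degree_eq:
  assumes g: "continuous_map (Euclidean_space m) (Euclidean_space m) g" and m: "m \<ge> 1"
    and U: "openin (Euclidean_space m) U" "p \<in> U"
    and nz: "\<And>x. x \<in> U \<Longrightarrow> x \<noteq> p \<Longrightarrow> g x \<noteq> (\<lambda>_. 0)"
  shows "\<forall>\<^sub>F r in at_right 0. sphere_degree m g p r = local_degree m g p"
proof -
  obtain e where e: "e > 0"
    "\<And>r u. \<bar>r\<bar> < e \<Longrightarrow> u \<in> topspace (nsphere (m - 1)) \<Longrightarrow> (\<lambda>i. p i + r * u i) \<in> U"
    using small_spheres_subset[OF U m] by metis
  have pt: "p \<in> topspace (Euclidean_space m)" using U openin_subset by blast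
  have eq: "sphere_degree m g p r = sphere_degree m g p s"
    if rs: "0 < r" "r < e" "0 < s" "s < e" for r s
  proof -
    let ?X = "prod_topology (top_of_set {0..1::real}) (nsphere (m - 1))"
    let ?\<rho> = "\<lambda>t. (1 - t) * r + t * s"
    let ?q = "\<lambda>z i. p i + ?\<rho> (fst z) * snd z i"
    have rho: "0 < ?\<rho> t" "?\<rho> t < e" if "t \<in> {0..1}" for t
    proof -
      have "?\<rho> t \<ge> (1 - t) * min r s + t * min r s"
        using that by (intro add_mono mult_left_mono) auto
      then show "0 < ?\<rho> t" using rs by (simp add: algebra_simps min_def split: if_splits)
      have "?\<rho> t \<le> (1 - t) * max r s + t * max r s"
        using that by (intro add_mono mult_left_mono) auto
      then show "?\<rho> t < e" using rs by (simp add: algebra_simps max_def split: if_splits)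
    qed
    have cs: "continuous_map ?X euclideanreal (\<lambda>z. snd z i)" for i
      using continuous_map_compose[OF continuous_map_snd continuous_map_nsphere_projection]
      by (simp add: o_def)
    have cf: "continuous_map ?X euclideanreal fst"
      using continuous_map_fst continuous_map_into_fulltopology by blast
    have cqi: "continuous_map ?X euclideanreal (\<lambda>z. ?q z i)" for i
      by (intro continuous_intros cs cf)
    have qU: "?q z \<in> U" if "z \<in> topspace ?X" for z
      using that rho[of "fst z"] by (intro e(2)) auto
    moreover have "U \<subseteq> topspace (Euclidean_space m)" using U openin_subset by blast
    ultimately have "?q \<in> topspace ?X \<rightarrow> {x. \<forall>i\<ge>m. x i = 0}"
      unfolding topspace_Euclidean_space by blast
    with cqi have cq: "continuous_map ?X (Euclidean_space m) ?q"
      unfolding Euclidean_space_def continuous_map_in_subtopology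
        continuous_map_componentwise_UNIV by blast
    have qp: "?q z \<noteq> p" if z: "z \<in> topspace ?X" for z
    proof
      assume "?q z = p"
      then have "?\<rho> (fst z) * snd z i = 0" for i by (metis add_cancel_right_right)
      then have "snd z i = 0" for i using rho(1)[of "fst z"] z by auto
      then show False using z by (auto simp: nsphere)
    qed
    have c: "continuous_map ?X (nsphere (m - 1)) (\<lambda>z. direction m (g (?q z)))"
      using continuous_map_compose[OF cq g] qU qp nz
      by (intro continuous_map_direction m) (auto simp: o_def)
    define H where "H = (\<lambda>z. direction m (g (?q z)))"
    have "H (0, u) = direction m (g (\<lambda>i. p i + r * u i))"
      and "H (1, u) = direction m (g (\<lambda>i. p i + s * u i))" for u
      by (simp_all add: H_def)
    moreover have "continuous_map ?X (nsphere (m - 1)) H" using c by (simp only: H_def)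
    ultimately show ?thesis
      unfolding sphere_degree_def
      by (intro Brouwer_degree2_homotopic) (unfold homotopic_with_def, blast)
  qed
  define d where "d = sphere_degree m g p (e / 2)"
  have ev: "\<forall>\<^sub>F r in at_right 0. sphere_degree m g p r = d"
    unfolding eventually_at_right_field d_def
  proof (intro exI conjI allI impI)
    show "0 < e" by (rule e(1))
    show "sphere_degree m g p r = sphere_degree m g p (e / 2)" if "0 < r" "r < e" for r
      using that e(1) by (intro eq) auto
  qed
  have "local_degree m g p = d"
    unfolding local_degree_def
  proof (rule the_equality, rule ev)
    fix d' assume "\<forall>\<^sub>F r in at_right 0. sphere_degree m g p r = d'"
    with ev have "\<forall>\<^sub>F r in at_right (0::real). d' = d" by eventually_elim auto
    then show "d' = d" by (simp add: eventually_const_iff)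
  qed
  then show ?thesis using ev by simp
qed

lemma fixed_point_index_eq:
  assumes F: "continuous_map (Euclidean_space m) (Euclidean_space m) F" and m: "m \<ge> 1"
    and p: "isolated_fixed_point m F p"
  shows "\<forall>\<^sub>F r in at_right 0. sphere_degree m (\<lambda>x i. x i - F x i) p r = fixed_point_index m F p"
proof -
  obtain U where U: "openin (Euclidean_space m) U" "p \<in> U" "\<And>x. x \<in> U \<Longrightarrow> F x = x \<Longrightarrow> x = p"
    using p unfolding isolated_fixed_point_def by auto
  show ?thesis
    unfolding fixed_point_index_def
  proof (rule local_degree_eq[OF _ m U(1,2)])
    show "continuous_map (Euclidean_space m) (Euclidean_space m) (\<lambda>x i. x i - F x i)"
      by (intro continuous_map_Euclidean_space_diff F continuous_map_id[unfolded id_def])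
    show "(\<lambda>i. x i - F x i) \<noteq> (\<lambda>_. 0)" if "x \<in> U" "x \<noteq> p" for x
    proof
      assume "(\<lambda>i. x i - F x i) = (\<lambda>_. 0)"
      then have "F x = x" by (auto simp: fun_eq_iff)
      then show False using U(3) that by blast
    qed
  qed
qed

lemma fixed_point_index_const:
  assumes m: "m \<ge> 1"
  shows "fixed_point_index m (\<lambda>_. p) p = 1"
proof -
  have *: "sphere_degree m (\<lambda>x i. x i - p i) p r = 1" if r: "r > 0" for r
  proof -
    have "direction m (\<lambda>i. r * u i) = u" if "u \<in> topspace (nsphere (m - 1))" for u
    proof -
      have "{..m - 1} = {..<m}" using m by auto
      then have "(\<Sum>i<m. u i ^ 2) = 1" using that by (auto simp: nsphere)
      then have "L2_set (\<lambda>i. r * u i) {..<m} = r"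
        using r by (simp add: L2_set_def power_mult_distrib flip: sum_distrib_left)
      then show ?thesis using r by (auto simp: direction_def)
    qed
    then have "sphere_degree m (\<lambda>x i. x i - p i) p r = Brouwer_degree2 (m - 1) id"
      unfolding sphere_degree_def by (intro Brouwer_degree2_eq) simp
    then show ?thesis by simp
  qed
  have ev: "\<forall>\<^sub>F r in at_right 0. sphere_degree m (\<lambda>x i. x i - p i) p r = 1"
    unfolding eventually_at_right_field using * by (intro exI[of _ 1]) auto
  show ?thesis
    unfolding fixed_point_index_def local_degree_def
  proof (rule the_equality, rule ev)
    fix d assume "\<forall>\<^sub>F r in at_right 0. sphere_degree m (\<lambda>x i. x i - p i) p r = d"
    with ev have "\<forall>\<^sub>F r in at_right (0::real). d = 1" by eventually_elim auto
    then show "d = 1" by (simp add: eventually_const_iff)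
  qed
qed

lemma infsum_reg:
  assumes "n \<ge> 1"
  shows "(\<Sum>\<^sub>\<infinity>k\<in>{1..}. a k * reg k n) = (\<Sum>k | k dvd n. a k * int k)"
proof -
  have "(\<Sum>\<^sub>\<infinity>k\<in>{1..}. a k * reg k n) = (\<Sum>\<^sub>\<infinity>k\<in>{k. k dvd n}. a k * reg k n)"
  proof (rule infsum_cong_neutral)
    show "a k * reg k n = 0" if "k \<in> {k. k dvd n} - {1..}" for k
      using that assms by (auto simp: not_le)
  qed (auto simp: reg_def)
  also have "\<dots> = (\<Sum>k | k dvd n. a k * reg k n)"
    using assms by (intro infsum_finite) auto
  finally show ?thesis by (simp add: reg_def)
qed

end

theory Submission
  imports Defs
begin

text \<open>
  Write \<open>x = v 0\<close>, \<open>q = v 1\<close>, \<open>t = q / x\<close>. For suitable \<open>w \<ge> 0\<close> and \<open>\<phi>\<close> on the line, the map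
  \<open>G (x, q) = w t (x, x \<phi> t)\<close> for \<open>x > 0\<close>, \<open>G = 0\<close> for \<open>x \<le> 0\<close>, is continuous and homogeneous, but far from injective.
  It is nevertheless the planar part of the leading term at 0 of a homeomorphism in dimension \<open>m \<ge> 3\<close>: the third coordinate is
  used to store \<open>w t q\<close> while the second one is overwritten by \<open>w t x \<phi> t\<close>, and terms
  of order 2 restore injectivity. This overwriting is a swap of two coordinates, which
  makes the homeomorphism reverse the orientation. By homogeneity the higher order terms do not affect the indices
  at 0, so these are the indices of the iterates of \<open>G\<close>, for which only the fixed rays on which \<open>G\<^sup>n\<close> is
  expanding matter: \<open>ind(G\<^sup>n, 0)\<close> is 1 plus the number of those at which \<open>\<phi>\<^sup>n\<close> is expanding
  minus the number of those at which it is contracting. The weight \<open>w\<close>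
  can vanish, so \<open>\<phi>\<close> is free to have any prescribed number of orbits of each period of either kind, without the
  further periodic orbits that continuity of an unweighted map would force.
\<close>

section \<open>Additivity of the Brouwer degree\<close>

text \<open>The sum over rays is never assembled from local degrees. It comes from a single
  inclusion-exclusion identity for four fields that agree in pairs on two open sets; this cuts a
  crossing into its two halves and separates several crossings. The dynamical obstacle is that an
  arbitrary sequence may need infinitely many orbits in a bounded part of the line of slopes. They
  accumulate, and continuity makes the weight tend to 0 there, while the weights along each orbit
  must still multiply to more than 1. So a window is followed by doublings of weight 4: an orbit of
  period k has k - 1 of them to regain what its window loses, and the losses may grow because each
  period occurs finitely often. The doubling leaves one expanding fixed ray, at slope 0, so the
  index without further orbits is 2 for all iterates, and \<open>a 1\<close> is corrected by 2. An
  orbit of period k adds k or -k to the index of every iterate of order divisible by k; the sign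
  does not depend on the iterate, because the return maps have slope 0 or 2, whose powers stay on
  one side of 1.\<close>

lemma mult_homologous_rel_set:
  "homologous_rel_set p X S a \<otimes>\<^bsub>relative_homology_group (int p) X S\<^esub> homologous_rel_set p X S b
     = homologous_rel_set p X S (a + b)" (is "?l = ?r")
proof -
  have "x \<in> ?l" if "homologous_rel p X S (a + b) x" for x
  proof -
    have "homologous_rel p X S b (x - a)"
      using that by (simp add: homologous_rel_def algebra_simps)
    then have "a + (x - a) \<in> ?l"
      unfolding mult_relative_homology_group by (intro UN_I) auto
    then show ?thesis by simp
  qed
  moreover have "?l \<subseteq> ?r"
    by (auto simp: mult_relative_homology_group intro: homologous_rel_add)
  ultimately show ?thesis by blast
qed

lemma simplex_map_cong:
  assumes "f \<in> standard_simplex p \<rightarrow> U" "\<And>x. x \<in> U \<Longrightarrow> g x = h x"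
  shows "simplex_map p g f = simplex_map p h f"
  using assms by (auto simp: simplex_map_def fun_eq_iff restrict_def Pi_iff)

text \<open>The fundamental class has a representative all of whose simplices lie in \<open>U\<close> or in \<open>W\<close>; on
  such a chain the two sums of chain maps coincide.\<close>

lemma Brouwer_degree2_additive:
  assumes p: "p \<noteq> 0"
    and U: "openin (nsphere p) U" and W: "openin (nsphere p) W"
    and UW: "topspace (nsphere p) \<subseteq> U \<union> W"
    and c1: "continuous_map (nsphere p) (nsphere p) f1"
    and c2: "continuous_map (nsphere p) (nsphere p) f2"
    and c3: "continuous_map (nsphere p) (nsphere p) f3"
    and c4: "continuous_map (nsphere p) (nsphere p) f4"
    and eqU: "\<And>x. x \<in> U \<Longrightarrow> f1 x = f3 x" "\<And>x. x \<in> U \<Longrightarrow> f2 x = f4 x"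
    and eqW: "\<And>x. x \<in> W \<Longrightarrow> f1 x = f2 x" "\<And>x. x \<in> W \<Longrightarrow> f3 x = f4 x"
  shows "Brouwer_degree2 p f1 + Brouwer_degree2 p f4 = Brouwer_degree2 p f2 + Brouwer_degree2 p f3"
proof -
  let ?S = "nsphere p"
  let ?G = "homology_group (int p) ?S"
  let ?h = "hom_induced (int p) ?S {} ?S {}"
  have red: "reduced_homology_group (int p) ?S = ?G"
    using p by (simp add: un_reduced_homology_group)
  interpret group ?G by simp
  obtain x where x: "x \<in> carrier ?G" and xeq: "subgroup_generated ?G {x} = ?G"
    using cyclic_reduced_homology_group_nsphere[of p p] red by (auto simp: cyclic_group_def)
  \<comment> \<open>Order 0 stands for infinite order; it makes the exponents of the generator
    comparable at the end.\<close>
  have ord: "ord x = 0"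
    using reduced_homology_group_nsphere(1)[of p]
    by (simp add: x xeq iso_finite red flip: infinite_cyclic_subgroup_order)
  obtain c where c: "singular_relcycle p ?S {} c" and xc: "x = homologous_rel_set p ?S {} c"
    using x by (auto simp: carrier_relative_homology_group)
  obtain c' where c': "singular_relcycle p ?S {} c'" "homologous_rel p ?S {} c c'"
    and small: "\<And>f. f \<in> Poly_Mapping.keys c' \<Longrightarrow> \<exists>V \<in> {U, W}. f \<in> standard_simplex p \<rightarrow> V"
    using small_homologous_rel_relcycle_exists[of "{U, W}" ?S p "{}" c] U W UW c by auto
  have xc': "x = homologous_rel_set p ?S {} c'"
    using c'(2) xc homologous_rel_set_eq by blast
  have h: "?h f x = homologous_rel_set p ?S {} (chain_map p f c')" if "continuous_map ?S ?S f" for f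
    unfolding xc' using that c'(1) by (intro hom_induced_chain_map) auto
  have "Poly_Mapping.keys c' \<subseteq> {f. f \<in> standard_simplex p \<rightarrow> U \<or> f \<in> standard_simplex p \<rightarrow> W}"
    using small by blast
  then have "chain_map p f1 c' + chain_map p f4 c' = chain_map p f2 c' + chain_map p f3 c'"
  proof (induction rule: frag_induction)
    case (one f)
    then consider "f \<in> standard_simplex p \<rightarrow> U" | "f \<in> standard_simplex p \<rightarrow> W" by blast
    then show ?case
    proof cases
      case 1
      then show ?thesis
        using simplex_map_cong[OF 1 eqU(1)] simplex_map_cong[OF 1 eqU(2)] by simp
    next
      case 2
      then show ?thesis
        using simplex_map_cong[OF 2 eqW(1)] simplex_map_cong[OF 2 eqW(2)] by simp
    qed
  next
    case (diff a b)
    then show ?case by (simp add: chain_map_diff) (simp add: algebra_simps)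
  qed simp
  then have "?h f1 x \<otimes>\<^bsub>?G\<^esub> ?h f4 x = ?h f2 x \<otimes>\<^bsub>?G\<^esub> ?h f3 x"
    by (simp add: h c1 c2 c3 c4 mult_homologous_rel_set)
  moreover have "?h f x = x [^]\<^bsub>?G\<^esub> Brouwer_degree2 p f" for f
    using Brouwer_degree2[of x p f] x red by simp
  ultimately have "x [^]\<^bsub>?G\<^esub> (Brouwer_degree2 p f1 + Brouwer_degree2 p f4)
      = x [^]\<^bsub>?G\<^esub> (Brouwer_degree2 p f2 + Brouwer_degree2 p f3)"
    by (simp add: int_pow_mult x)
  then show ?thesis
    using ord x int_pow_eq by auto
qed

section \<open>Degrees of nowhere zero fields on the sphere\<close>

definition sphere_pts :: "nat \<Rightarrow> (nat \<Rightarrow> real) set" where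
  "sphere_pts m = topspace (nsphere (m - 1))"

definition field_degree :: "nat \<Rightarrow> ((nat \<Rightarrow> real) \<Rightarrow> nat \<Rightarrow> real) \<Rightarrow> int" where
  "field_degree m V = Brouwer_degree2 (m - 1) (\<lambda>u. direction m (V u))"

definition sphere_field :: "nat \<Rightarrow> ((nat \<Rightarrow> real) \<Rightarrow> nat \<Rightarrow> real) \<Rightarrow> bool" where
  "sphere_field m V \<longleftrightarrow> continuous_on (sphere_pts m) V \<and>
     (\<forall>u\<in>sphere_pts m. V u \<in> topspace (Euclidean_space m) \<and> V u \<noteq> (\<lambda>_. 0))"

text \<open>The product topology is the topology of the type \<open>nat \<Rightarrow> real\<close>,
  so continuity between these spaces turns into \<open>continuous_on\<close>.\<close>

lemma Euclidean_space_eq: "Euclidean_space m = top_of_set (topspace (Euclidean_space m))"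
  by (simp add: Euclidean_space_def euclidean_product_topology)

lemma nsphere_eq: "nsphere (m - 1) = top_of_set (sphere_pts m)"
  by (simp add: sphere_pts_def nsphere euclidean_product_topology)

lemma sphere_pts_iff:
  assumes "m \<ge> 1"
  shows "u \<in> sphere_pts m \<longleftrightarrow> (\<Sum>i<m. (u i)\<^sup>2) = 1 \<and> (\<forall>i\<ge>m. u i = 0)"
proof -
  have "{..m - 1} = {..<m}" using assms by auto
  then show ?thesis using assms by (auto simp: sphere_pts_def nsphere)
qed

text \<open>A closed subset of the infinite cube over [-1, 1], which is compact by Tychonoff's
  theorem.\<close>

lemma compact_sphere_pts:
  assumes "m \<ge> 1"
  shows "compact (sphere_pts m)"
proof -
  have "closed {u::nat \<Rightarrow> real. (\<Sum>i<m. (u i)\<^sup>2) = 1 \<and> (\<forall>i\<ge>m. u i = 0)}"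
    by (intro closed_Collect_conj closed_Collect_all closed_Collect_imp closed_Collect_eq
        continuous_intros continuous_on_product_coordinates) auto
  moreover have "compact (PiE UNIV (\<lambda>_::nat. {-1..1::real}))"
    using compactin_PiE[of "\<lambda>_. euclideanreal" UNIV "\<lambda>_. {-1..1}"]
    by (simp add: euclidean_product_topology)
  moreover have "sphere_pts m \<subseteq> PiE UNIV (\<lambda>_. {-1..1})"
  proof
    fix u assume u: "u \<in> sphere_pts m"
    have "\<bar>u i\<bar> \<le> 1" for i
    proof (cases "i < m")
      case True
      have "(u i)\<^sup>2 \<le> (\<Sum>i<m. (u i)\<^sup>2)" using True by (intro member_le_sum) auto
      then show ?thesis using u assms by (simp add: sphere_pts_iff abs_square_le_1)
    qed (use u assms in \<open>simp add: sphere_pts_iff\<close>)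
    then show "u \<in> PiE UNIV (\<lambda>_. {-1..1})" by (simp add: PiE_iff abs_le_iff minus_le_iff)
  qed
  moreover have "sphere_pts m = {u. (\<Sum>i<m. (u i)\<^sup>2) = 1 \<and> (\<forall>i\<ge>m. u i = 0)}"
    using sphere_pts_iff[OF assms] by blast
  ultimately show ?thesis
    by (metis compact_Int_closed inf.absorb_iff2)
qed

lemma sphere_field_continuous_map:
  assumes "sphere_field m V" "m \<ge> 1"
  shows "continuous_map (nsphere (m - 1)) (nsphere (m - 1)) (\<lambda>u. direction m (V u))"
proof (rule continuous_map_direction[OF _ assms(2)])
  show "continuous_map (nsphere (m - 1)) (Euclidean_space m) V"
    using assms(1) unfolding sphere_field_def nsphere_eq
    by (subst Euclidean_space_eq) auto
qed (use assms in \<open>auto simp: sphere_field_def sphere_pts_def\<close>)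

lemma field_degree_homotopy:
  assumes m: "m \<ge> 1"
    and H: "continuous_on ({0..1} \<times> sphere_pts m) (\<lambda>z. H (fst z) (snd z))"
    and E: "\<And>s u. s \<in> {0..1} \<Longrightarrow> u \<in> sphere_pts m \<Longrightarrow> H s u \<in> topspace (Euclidean_space m)"
    and nz: "\<And>s u. s \<in> {0..1::real} \<Longrightarrow> u \<in> sphere_pts m \<Longrightarrow> H s u \<noteq> (\<lambda>_. 0)"
  shows "field_degree m (H 0) = field_degree m (H 1)"
proof -
  let ?X = "prod_topology (top_of_set {0..1::real}) (nsphere (m - 1))"
  have X: "?X = top_of_set ({0..1} \<times> sphere_pts m)"
    unfolding nsphere_eq by (rule prod_topology_subtopology_eu)
  have "continuous_map ?X (Euclidean_space m) (\<lambda>z. H (fst z) (snd z))"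
    unfolding X by (subst Euclidean_space_eq) (use H E in auto)
  then have "continuous_map ?X (nsphere (m - 1)) (\<lambda>z. direction m (H (fst z) (snd z)))"
    by (rule continuous_map_direction[OF _ m]) (use nz in \<open>force simp: sphere_pts_def\<close>)
  then have "homotopic_with (\<lambda>x. True) (nsphere (m - 1)) (nsphere (m - 1))
       (\<lambda>u. direction m (H 0 u)) (\<lambda>u. direction m (H 1 u))"
    unfolding homotopic_with_def
    by (intro exI[of _ "\<lambda>z. direction m (H (fst z) (snd z))"]) auto
  then show ?thesis
    unfolding field_degree_def by (rule Brouwer_degree2_homotopic)
qed

lemma field_degree_additive:
  assumes m: "m \<ge> 2"
    and U: "openin (nsphere (m - 1)) U" and W: "openin (nsphere (m - 1)) W"
    and UW: "sphere_pts m \<subseteq> U \<union> W"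
    and V: "sphere_field m V1" "sphere_field m V2" "sphere_field m V3" "sphere_field m V4"
    and "\<And>x. x \<in> U \<Longrightarrow> V1 x = V3 x" "\<And>x. x \<in> U \<Longrightarrow> V2 x = V4 x"
    and "\<And>x. x \<in> W \<Longrightarrow> V1 x = V2 x" "\<And>x. x \<in> W \<Longrightarrow> V3 x = V4 x"
  shows "field_degree m V1 + field_degree m V4 = field_degree m V2 + field_degree m V3"
  unfolding field_degree_def using assms
  by (intro Brouwer_degree2_additive[OF _ U W UW[unfolded sphere_pts_def]] sphere_field_continuous_map)
    auto

lemma L2_set_sphere_pts:
  assumes "m \<ge> 1" "u \<in> sphere_pts m"
  shows "L2_set u {..<m} = 1"
  using assms by (simp add: L2_set_def sphere_pts_iff)

lemma field_degree_id: "m \<ge> 1 \<Longrightarrow> field_degree m (\<lambda>u. u) = 1"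
proof -
  assume m: "m \<ge> 1"
  have "Brouwer_degree2 (m - 1) (\<lambda>u. direction m u) = Brouwer_degree2 (m - 1) id"
    by (rule Brouwer_degree2_eq, unfold sphere_pts_def[symmetric])
      (simp add: direction_def L2_set_sphere_pts[OF m])
  then show ?thesis by (simp add: field_degree_def)
qed

text \<open>Normalising turns the missed ray into a point of the sphere outside the image, and a
  self-map of the sphere that is not onto has degree 0.\<close>

lemma field_degree_missed_direction:
  assumes m: "m \<ge> 1" and V: "sphere_field m V"
    and w: "w \<in> topspace (Euclidean_space m)" "w \<noteq> (\<lambda>_. 0)"
    and miss: "\<And>u y. u \<in> sphere_pts m \<Longrightarrow> y > 0 \<Longrightarrow> V u \<noteq> (\<lambda>i. y * w i)"
  shows "field_degree m V = 0"
  unfolding field_degree_def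
proof (rule Brouwer_degree2_nonsurjective[OF sphere_field_continuous_map[OF V m]])
  have L: "L2_set v {..<m} > 0" if "v \<in> topspace (Euclidean_space m)" "v \<noteq> (\<lambda>_. 0)" for v
    using L2_set_eq_0_Euclidean[OF that(1)] that(2) L2_set_nonneg[of v "{..<m}"] by linarith
  have "continuous_map euclideanreal (nsphere (m - 1)) (\<lambda>_. direction m w)"
    by (rule continuous_map_direction[OF _ m]) (use w in auto)
  then have "direction m w \<in> sphere_pts m"
    by (auto simp: continuous_map_def sphere_pts_def)
  moreover have "direction m w \<noteq> direction m (V u)" if u: "u \<in> sphere_pts m" for u
  proof
    assume eq: "direction m w = direction m (V u)"
    have Vu: "L2_set (V u) {..<m} > 0"
      using V u L by (auto simp: sphere_field_def)
    have "w i / L2_set w {..<m} = V u i / L2_set (V u) {..<m}" for i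
      using fun_cong[OF eq, of i] by (simp add: direction_def)
    then have "V u = (\<lambda>i. (L2_set (V u) {..<m} / L2_set w {..<m}) * w i)"
      using Vu L[OF w] by (auto simp: fun_eq_iff field_simps)
    moreover have "L2_set (V u) {..<m} / L2_set w {..<m} > 0"
      using Vu L[OF w] by simp
    ultimately show False using miss[OF u] by blast
  qed
  ultimately show "(\<lambda>u. direction m (V u)) ` topspace (nsphere (m - 1)) \<noteq> topspace (nsphere (m - 1))"
    unfolding sphere_pts_def[symmetric] by blast
qed

lemma field_degree_reflection:
  "m \<ge> 1 \<Longrightarrow> field_degree m (\<lambda>u i. if i = 0 then - u i else u i) = - 1"
proof -
  assume m: "m \<ge> 1"
  have "Brouwer_degree2 (m - 1) (\<lambda>u. direction m (\<lambda>i. if i = 0 then - u i else u i))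
      = Brouwer_degree2 (m - 1) (\<lambda>u i. if i = 0 then - u i else u i)"
  proof (rule Brouwer_degree2_eq, unfold sphere_pts_def[symmetric])
    fix u assume u: "u \<in> sphere_pts m"
    have "L2_set (\<lambda>i. if i = 0 then - u i else u i) {..<m} = L2_set u {..<m}"
      unfolding L2_set_def by (intro arg_cong[where f = sqrt] sum.cong) auto
    then show "direction m (\<lambda>i. if i = 0 then - u i else u i) = (\<lambda>i. if i = 0 then - u i else u i)"
      using L2_set_sphere_pts[OF m u] by (simp add: direction_def)
  qed
  then show ?thesis by (simp add: field_degree_def Brouwer_degree2_reflection)
qed

section \<open>Fields that are homogeneous in a plane\<close>

text \<open>The positively homogeneous extension of a function of the slope \<open>v 1 / v 0\<close>
  from the line \<open>v 0 = 1\<close> to the plane, 0 on the other half plane. At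
  \<open>v 0 = 0\<close> the factor in front absorbs the division by 0.\<close>

definition cone_ext :: "(real \<Rightarrow> real) \<Rightarrow> (nat \<Rightarrow> real) \<Rightarrow> real" where
  "cone_ext g v = max 0 (v 0) * g (v 1 / v 0)"

lemma continuous_on_coord: "continuous_on A (\<lambda>v. v i)" for A :: "(nat \<Rightarrow> real) set"
  by (rule continuous_on_subset[OF continuous_on_product_coordinates]) simp

lemma continuous_on_snd_coord: "continuous_on A (\<lambda>z. snd z i)" for A :: "('a::topological_space \<times> (nat \<Rightarrow> real)) set"
  by (rule continuous_on_compose2[OF continuous_on_coord[of UNIV i] continuous_on_snd]) auto

text \<open>Only the points with \<open>v 0 = 0\<close> are critical: the slope has no limit there,
  but \<open>G\<close> is bounded and the factor in front tends to 0. The parameter in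
  \<open>X\<close> serves homotopies.\<close>

lemma continuous_on_cone_ext_family:
  fixes G :: "'a::topological_space \<Rightarrow> real \<Rightarrow> real"
  assumes G: "continuous_on (X \<times> UNIV) (\<lambda>z. G (fst z) (snd z))"
    and K: "\<And>s t. s \<in> X \<Longrightarrow> \<bar>G s t\<bar> \<le> K"
  shows "continuous_on (X \<times> A) (\<lambda>z. cone_ext (G (fst z)) (snd z))"
proof -
  have "((\<lambda>z. cone_ext (G (fst z)) (snd z)) \<longlongrightarrow> cone_ext (G s) v) (at (s, v) within X \<times> A)"
    if sv: "s \<in> X" "v \<in> A" for s v
  proof -
    let ?F = "at (s, v) within X \<times> A"
    have crd: "((\<lambda>z. snd z i) \<longlongrightarrow> v i) ?F" for i
      using continuous_on_snd_coord[of "X \<times> A" i] sv by (auto simp: continuous_on_def)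
    have inX: "\<forall>\<^sub>F z in ?F. z \<in> X \<times> A"
      by (simp add: eventually_at_filter)
    show ?thesis
    proof (cases "v 0 = 0")
      case True
      have "((\<lambda>z. max 0 (snd z 0) * G (fst z) (snd z 1 / snd z 0)) \<longlongrightarrow> 0) ?F"
      proof (rule tendsto_0_le[where K = K])
        show "((\<lambda>z. snd z 0) \<longlongrightarrow> 0) ?F" using crd[of 0] True by simp
        show "\<forall>\<^sub>F z in ?F. norm (max 0 (snd z 0) * G (fst z) (snd z 1 / snd z 0)) \<le> norm (snd z 0) * K"
          using inX
        proof eventually_elim
          case (elim z)
          have "\<bar>max 0 (snd z 0)\<bar> * \<bar>G (fst z) (snd z 1 / snd z 0)\<bar> \<le> \<bar>snd z 0\<bar> * K"
            using K[of "fst z"] elim by (intro mult_mono) auto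
          then show ?case by (simp add: abs_mult)
        qed
      qed
      then show ?thesis using True by (simp add: cone_ext_def)
    next
      case False
      have "((\<lambda>z. (fst z, snd z 1 / snd z 0)) \<longlongrightarrow> (s, v 1 / v 0)) ?F"
        by (intro tendsto_Pair tendsto_divide crd False) (auto intro: tendsto_fst tendsto_ident_at simp: tendsto_fst[where a = "(s, v)", simplified])
      then have "((\<lambda>z. (\<lambda>z. G (fst z) (snd z)) (fst z, snd z 1 / snd z 0)) \<longlongrightarrow> (\<lambda>z. G (fst z) (snd z)) (s, v 1 / v 0)) ?F"
        by (rule continuous_on_tendsto_compose[OF G]) (use sv inX in \<open>auto elim: eventually_mono\<close>)
      then show ?thesis
        unfolding cone_ext_def by (intro tendsto_mult tendsto_max crd) auto
    qed
  qed
  then show ?thesis by (auto simp: continuous_on_def)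
qed

text \<open>Bounded support makes the homogeneous extension vanish in a cone around the axis
  \<open>v 0 = 0\<close>, where rays of steep positive slope meet those of steep negative
  slope.\<close>

definition compact_supp :: "(real \<Rightarrow> real) \<Rightarrow> bool" where
  "compact_supp g \<longleftrightarrow> continuous_on UNIV g \<and> (\<exists>M. \<forall>t. M < \<bar>t\<bar> \<longrightarrow> g t = 0)"

lemma continuous_on_cone_ext:
  assumes "compact_supp g"
  shows "continuous_on A (cone_ext g)"
proof -
  obtain M where M: "\<And>t. M < \<bar>t\<bar> \<Longrightarrow> g t = 0" and g: "continuous_on UNIV g"
    using assms by (auto simp: compact_supp_def)
  have "compact (g ` {-M..M})"
    by (intro compact_continuous_image continuous_on_subset[OF g]) auto
  then obtain K where K: "\<And>t. t \<in> {-M..M} \<Longrightarrow> \<bar>g t\<bar> \<le> K"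
    by (force simp: bounded_iff dest!: compact_imp_bounded)
  have "\<bar>g t\<bar> \<le> max 0 K" for t
    using M[of t] K[of t] by (cases "t \<in> {-M..M}") auto
  then have "continuous_on ({0::real} \<times> A) (\<lambda>z. cone_ext ((\<lambda>_. g) (fst z)) (snd z))"
    by (intro continuous_on_cone_ext_family continuous_on_compose2[OF g] continuous_intros) auto
  then show ?thesis
    by (intro continuous_on_compose2[of "{0} \<times> A" "\<lambda>z. cone_ext g (snd z)" A "\<lambda>v. (0, v)", simplified] continuous_intros) auto
qed

text \<open>The field id - F of the map F = (P, Q, 0, ..., 0); for homogeneous P and Q its degree on
  the sphere is the index of F at 0.\<close>

definition plane_field :: "((nat \<Rightarrow> real) \<Rightarrow> real) \<Rightarrow> ((nat \<Rightarrow> real) \<Rightarrow> real) \<Rightarrow> (nat \<Rightarrow> real) \<Rightarrow> nat \<Rightarrow> real"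
  where "plane_field P Q v = (\<lambda>i. if i = 0 then v 0 - P v else if i = 1 then v 1 - Q v else v i)"

lemma plane_field_homotopy:
  assumes m: "m \<ge> 2"
    and P: "continuous_on ({0..1} \<times> sphere_pts m) (\<lambda>z. P (fst z) (snd z))"
    and Q: "continuous_on ({0..1} \<times> sphere_pts m) (\<lambda>z. Q (fst z) (snd z))"
    and nz: "\<And>s v. s \<in> {0..1::real} \<Longrightarrow> v \<in> sphere_pts m \<Longrightarrow> plane_field (P s) (Q s) v \<noteq> (\<lambda>_. 0)"
  shows "field_degree m (plane_field (P 0) (Q 0)) = field_degree m (plane_field (P 1) (Q 1))"
proof (rule field_degree_homotopy[where H = "\<lambda>s. plane_field (P s) (Q s)"])
  show "continuous_on ({0..1} \<times> sphere_pts m) (\<lambda>z. plane_field (P (fst z)) (Q (fst z)) (snd z))"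
  proof (rule continuous_on_coordinatewise_then_product)
    show "continuous_on ({0..1} \<times> sphere_pts m) (\<lambda>z. plane_field (P (fst z)) (Q (fst z)) (snd z) i)" for i
      unfolding plane_field_def
      by (cases "i = 0"; cases "i = 1"; simp; intro continuous_intros P Q continuous_on_snd_coord)
  qed
qed (use m nz in \<open>auto simp: plane_field_def topspace_Euclidean_space sphere_pts_iff\<close>)

text \<open>A zero is a fixed point of the homogeneous map. It cannot lie in
  \<open>v 0 \<le> 0\<close>, which is mapped to 0, so dividing by \<open>v 0\<close> shows the
  slope of a ray of fixed points.\<close>

lemma plane_field_cone_ext_eq_0:
  assumes "v \<in> sphere_pts m" "m \<ge> 1" "plane_field (cone_ext b) (cone_ext c) v = (\<lambda>_. 0)"
  obtains t where "b t = 1" "c t = t"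
proof -
  have 0: "v 0 = cone_ext b v" and 1: "v 1 = cone_ext c v" 
    using fun_cong[OF assms(3), of 0] fun_cong[OF assms(3), of 1]
    by (auto simp: plane_field_def)
  have i: "v i = 0" if "i \<ge> 2" for i
    using fun_cong[OF assms(3), of i] that by (simp add: plane_field_def)
  have "v 0 > 0"
  proof (rule ccontr)
    assume "\<not> v 0 > 0"
    then have "cone_ext b v = 0" "cone_ext c v = 0" by (auto simp: cone_ext_def max_def)
    with 0 1 have "v 0 = 0" "v 1 = 0" by metis+
    then have "v i = 0" for i using i[of i] by (cases "i = 0 \<or> i = 1") auto
    then show False using assms(1,2) by (simp add: sphere_pts_iff)
  qed
  then have "cone_ext b v = v 0 * b (v 1 / v 0)" "cone_ext c v = v 0 * c (v 1 / v 0)"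
    by (auto simp: cone_ext_def)
  with 0 1 have "v 0 * b (v 1 / v 0) = v 0" "v 0 * c (v 1 / v 0) = v 1" by metis+
  with \<open>v 0 > 0\<close> have "b (v 1 / v 0) = 1" "c (v 1 / v 0) = v 1 / v 0"
    by (simp_all add: eq_divide_eq mult.commute)
  then show thesis by (rule that)
qed

section \<open>The degree as an invariant of a pair of functions of the slope\<close>

definition plane_degree :: "nat \<Rightarrow> (real \<Rightarrow> real) \<Rightarrow> (real \<Rightarrow> real) \<Rightarrow> int" where
  "plane_degree m b c = field_degree m (plane_field (cone_ext b) (cone_ext c))"

text \<open>On the ray of slope t, \<open>b t\<close> is the radial factor and
  \<open>c t / b t\<close> the slope of the image ray. Keeping the product \<open>c\<close> allows
  the image slope to jump where \<open>b\<close> vanishes. The last condition excludes rays of fixed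
  points.\<close>

definition regular_pair :: "(real \<Rightarrow> real) \<Rightarrow> (real \<Rightarrow> real) \<Rightarrow> bool" where
  "regular_pair b c \<longleftrightarrow> compact_supp b \<and> compact_supp c \<and> (\<forall>t. b t = 1 \<longrightarrow> c t \<noteq> t)"

lemma plane_degree_homotopy:
  assumes m: "m \<ge> 2"
    and B: "continuous_on ({0..1} \<times> UNIV) (\<lambda>z. B (fst z) (snd z))"
    and C: "continuous_on ({0..1} \<times> UNIV) (\<lambda>z. C (fst z) (snd z))"
    and M: "\<And>s t. s \<in> {0..1} \<Longrightarrow> M < \<bar>t\<bar> \<Longrightarrow> B s t = 0 \<and> C s t = 0"
    and nz: "\<And>s t. s \<in> {0..1::real} \<Longrightarrow> B s t = 1 \<Longrightarrow> C s t \<noteq> t"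
  shows "plane_degree m (B 0) (C 0) = plane_degree m (B 1) (C 1)"
proof -
  have bdd: "\<exists>K. \<forall>s\<in>{0..1}. \<forall>t. \<bar>G s t\<bar> \<le> K"
    if G: "continuous_on ({0..1} \<times> UNIV) (\<lambda>z. G (fst z) (snd z))"
      and M: "\<And>s t. s \<in> {0..1} \<Longrightarrow> M < \<bar>t\<bar> \<Longrightarrow> G s t = 0" for G :: "real \<Rightarrow> real \<Rightarrow> real"
  proof -
    have "compact ((\<lambda>z. G (fst z) (snd z)) ` ({0..1} \<times> {-M..M}))"
      by (intro compact_continuous_image continuous_on_subset[OF G] compact_Times) auto
    then obtain K where K: "\<And>s t. s \<in> {0..1} \<Longrightarrow> t \<in> {-M..M} \<Longrightarrow> \<bar>G s t\<bar> \<le> K"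
      by (force simp: bounded_iff dest!: compact_imp_bounded)
    have "\<bar>G s t\<bar> \<le> max 0 K" if "s \<in> {0..1}" for s t
      using M[of s t] K[of s t] that by (cases "t \<in> {-M..M}") auto
    then show ?thesis by blast
  qed
  obtain K1 K2 where "\<And>s t. s \<in> {0..1} \<Longrightarrow> \<bar>B s t\<bar> \<le> K1" "\<And>s t. s \<in> {0..1} \<Longrightarrow> \<bar>C s t\<bar> \<le> K2"
    using bdd[OF B] bdd[OF C] M by metis
  then show ?thesis
    unfolding plane_degree_def using nz m
    by (intro plane_field_homotopy[where P = "\<lambda>s. cone_ext (B s)" and Q = "\<lambda>s. cone_ext (C s)"]
        continuous_on_cone_ext_family B C) (auto elim!: plane_field_cone_ext_eq_0)
qed

lemma compact_supp_mult:
  assumes "compact_supp g" "continuous_on UNIV h"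
  shows "compact_supp (\<lambda>t. h t * g t)"
proof -
  obtain M where "\<And>t. M < \<bar>t\<bar> \<Longrightarrow> g t = 0" and g: "continuous_on UNIV g"
    using assms(1) unfolding compact_supp_def by blast
  then have "\<forall>t. M < \<bar>t\<bar> \<longrightarrow> h t * g t = 0" by simp
  moreover have "continuous_on UNIV (\<lambda>t. h t * g t)"
    using g assms(2) by (rule continuous_on_mult[rotated])
  ultimately show ?thesis unfolding compact_supp_def by blast
qed

lemma compact_supp_add:
  assumes "compact_supp g" "compact_supp h"
  shows "compact_supp (\<lambda>t. g t + h t)"
proof -
  obtain M N where "\<And>t. M < \<bar>t\<bar> \<Longrightarrow> g t = 0" "\<And>t. N < \<bar>t\<bar> \<Longrightarrow> h t = 0"
    using assms unfolding compact_supp_def by blast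
  then have "\<forall>t. max M N < \<bar>t\<bar> \<longrightarrow> g t + h t = 0" by simp
  then show ?thesis
    using assms unfolding compact_supp_def by (blast intro: continuous_on_add)
qed

lemma regular_pairD:
  assumes "regular_pair b c"
  shows "compact_supp b" "compact_supp c" "continuous_on UNIV b" "continuous_on UNIV c"
    "\<And>t. b t = 1 \<Longrightarrow> c t \<noteq> t"
  using assms by (auto simp: regular_pair_def compact_supp_def)

lemma regular_pair_supportE:
  assumes "regular_pair b c"
  obtains M where "M > 0" "\<And>t. M < \<bar>t\<bar> \<Longrightarrow> b t = 0" "\<And>t. M < \<bar>t\<bar> \<Longrightarrow> c t = 0"
proof -
  obtain M N where "\<And>t. M < \<bar>t\<bar> \<Longrightarrow> b t = 0" "\<And>t. N < \<bar>t\<bar> \<Longrightarrow> c t = 0"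
    using assms unfolding regular_pair_def compact_supp_def by blast
  then show thesis using that[of "max 1 (max M N)"] by auto
qed

lemma continuous_on_fst_id: "continuous_on A (\<lambda>z. fst z)"
  and continuous_on_comp_snd: "continuous_on UNIV b \<Longrightarrow> continuous_on (A :: (real \<times> real) set) (\<lambda>z. b (snd z))"
  by (rule continuous_on_fst[OF continuous_on_id])
    (rule continuous_on_compose2[of UNIV b], auto intro: continuous_on_snd continuous_on_id)

text \<open>Shrink the pair to 0. A zero at the parameter s would give
  \<open>b t = 1 / s \<ge> 1\<close> and \<open>c t = b t * t\<close>, a ray mapped to itself
  without being contracted: excluded by \<open>no\<close> for s < 1 and by regularity for s =
  1.\<close>

lemma plane_degree_no_crossing:
  assumes m: "m \<ge> 2" and bc: "regular_pair b c"
    and no: "\<And>t. b t > 1 \<Longrightarrow> c t \<noteq> b t * t"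
  shows "plane_degree m b c = 1"
proof -
  obtain M where M: "\<And>t. M < \<bar>t\<bar> \<Longrightarrow> b t = 0" "\<And>t. M < \<bar>t\<bar> \<Longrightarrow> c t = 0"
    using bc by (rule regular_pair_supportE) blast
  have "plane_degree m (\<lambda>t. 0 * b t) (\<lambda>t. 0 * c t) = plane_degree m (\<lambda>t. 1 * b t) (\<lambda>t. 1 * c t)"
  proof (rule plane_degree_homotopy[OF m, where B = "\<lambda>s t. s * b t" and C = "\<lambda>s t. s * c t" and M = M])
    fix s t :: real
    assume s: "s \<in> {0..1}" and st: "s * b t = 1"
    have b1: "b t \<ge> 1"
    proof (rule ccontr)
      assume "\<not> b t \<ge> 1"
      moreover have "s * b t \<le> max 0 (b t)"
        using s mult_left_le_one_le[of "b t" s] mult_nonneg_nonpos[of s "b t"]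
        by (cases "0 \<le> b t") auto
      ultimately show False using st by simp
    qed
    show "s * c t \<noteq> t"
    proof
      assume ct: "s * c t = t"
      have s0: "s \<noteq> 0" using st by auto
      have "b t * t = b t * s * c t" using ct by (simp add: mult.assoc)
      also have "\<dots> = c t" using st by (simp add: mult.commute)
      finally have "c t = b t * t" by simp
      with no[of t] b1 have "b t = 1" by fastforce
      with \<open>c t = b t * t\<close> regular_pairD(5)[OF bc] show False by simp
    qed
  qed (use M in \<open>auto intro!: continuous_on_mult continuous_on_fst_id continuous_on_comp_snd regular_pairD[OF bc]\<close>)
  moreover have "plane_degree m (\<lambda>t. 0) (\<lambda>t. 0) = 1"
  proof -
    have "plane_field (cone_ext (\<lambda>t. 0)) (cone_ext (\<lambda>t. 0)) = (\<lambda>v. v)"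
      by (auto simp: plane_field_def cone_ext_def fun_eq_iff)
    then show ?thesis using m by (simp add: plane_degree_def field_degree_id)
  qed
  ultimately show ?thesis by simp
qed

text \<open>The fields \<open>plane_field (cone_ext b) (cone_ext c)\<close> for different pairs only agree on cones that meet
  in \<open>v 0 = v 1 = 0\<close>. Multiplying by this cutoff makes them agree in a neighbourhood of that set.\<close>

definition axis_cutoff :: "(nat \<Rightarrow> real) \<Rightarrow> real" where
  "axis_cutoff v = max 0 (min 1 (2 * (\<bar>v 0\<bar> + \<bar>v 1\<bar>) - 1))"

definition cut_field :: "(real \<Rightarrow> real) \<Rightarrow> (real \<Rightarrow> real) \<Rightarrow> (nat \<Rightarrow> real) \<Rightarrow> nat \<Rightarrow> real" where
  "cut_field b c = plane_field (\<lambda>v. axis_cutoff v * cone_ext b v) (\<lambda>v. axis_cutoff v * cone_ext c v)"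

lemma continuous_on_axis_cutoff: "continuous_on A axis_cutoff"
  unfolding axis_cutoff_def by (intro continuous_intros continuous_on_coord)

text \<open>On the unit circle of the plane the 1-norm is at least the 2-norm, so the cutoff is
  saturated there. Zeros of the fields can only lie on this circle, hence the cutoff does not
  disturb them.\<close>

lemma axis_cutoff_eq_1:
  assumes v: "v \<in> sphere_pts m" and m: "m \<ge> 2" and 0: "\<And>i. i \<ge> 2 \<Longrightarrow> v i = 0"
  shows "axis_cutoff v = 1"
proof -
  have "(\<Sum>i<m. (v i)\<^sup>2) = (\<Sum>i\<in>{0,1}. (v i)\<^sup>2)"
  proof (rule sum.mono_neutral_right)
    show "\<forall>i\<in>{..<m} - {0, 1}. (v i)\<^sup>2 = 0"
    proof
      fix i assume "i \<in> {..<m} - {0, 1}"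
      then have "i \<ge> 2" by auto
      then show "(v i)\<^sup>2 = 0" using 0 by simp
    qed
  qed (use m in auto)
  then have 1: "(v 0)\<^sup>2 + (v 1)\<^sup>2 = 1"
    using v m by (simp add: sphere_pts_iff)
  have "(v 0)\<^sup>2 + (v 1)\<^sup>2 \<le> (\<bar>v 0\<bar> + \<bar>v 1\<bar>)\<^sup>2"
    by (simp add: power2_sum)
  then have "1\<^sup>2 \<le> (\<bar>v 0\<bar> + \<bar>v 1\<bar>)\<^sup>2" using 1 by simp
  then have "1 \<le> \<bar>v 0\<bar> + \<bar>v 1\<bar>"
    by (rule power2_le_imp_le) auto
  then show ?thesis by (simp add: axis_cutoff_def)
qed

text \<open>The coordinates from 2 on are left alone by the field, so a zero lies in the plane,
  where the factor \<open>k\<close> is 1 and regularity applies.\<close>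

lemma plane_field_scaled_nonzero:
  assumes m: "m \<ge> 2" and bc: "regular_pair b c" and v: "v \<in> sphere_pts m"
    and k: "(\<And>i. i \<ge> 2 \<Longrightarrow> v i = 0) \<Longrightarrow> k v = 1"
  shows "plane_field (\<lambda>v. k v * cone_ext b v) (\<lambda>v. k v * cone_ext c v) v \<noteq> (\<lambda>_. 0)"
proof
  assume eq: "plane_field (\<lambda>v. k v * cone_ext b v) (\<lambda>v. k v * cone_ext c v) v = (\<lambda>_. 0)"
  have "v i = 0" if "i \<ge> 2" for i
    using fun_cong[OF eq, of i] that by (simp add: plane_field_def)
  then have "k v = 1" by (rule k)
  then have 0: "plane_field (cone_ext b) (cone_ext c) v = (\<lambda>_. 0)"
    using eq unfolding plane_field_def by (simp only: mult_1_left)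
  have "1 \<le> m" using m by simp
  obtain t where "b t = 1" "c t = t"
    by (rule plane_field_cone_ext_eq_0[OF v \<open>1 \<le> m\<close> 0])
  then show False using regular_pairD(5)[OF bc] by blast
qed

lemma sphere_field_cut_field:
  assumes m: "m \<ge> 2" and bc: "regular_pair b c"
  shows "sphere_field m (cut_field b c)"
  unfolding sphere_field_def
proof (intro conjI ballI)
  show "continuous_on (sphere_pts m) (cut_field b c)"
  proof (rule continuous_on_coordinatewise_then_product)
    show "continuous_on (sphere_pts m) (\<lambda>v. cut_field b c v i)" for i
      unfolding plane_field_def cut_field_def
      by (cases "i = 0"; cases "i = 1"; simp;
          intro continuous_intros continuous_on_axis_cutoff continuous_on_cone_ext continuous_on_coord regular_pairD[OF bc])
  qed
  show "cut_field b c v \<in> topspace (Euclidean_space m)" if "v \<in> sphere_pts m" for v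
    using that m by (auto simp: cut_field_def plane_field_def topspace_Euclidean_space sphere_pts_iff)
  show "cut_field b c v \<noteq> (\<lambda>_. 0)" if "v \<in> sphere_pts m" for v
    unfolding cut_field_def
    by (rule plane_field_scaled_nonzero[OF m bc that]) (rule axis_cutoff_eq_1[OF that m])
qed

lemma plane_degree_cut_field:
  assumes m: "m \<ge> 2" and bc: "regular_pair b c"
  shows "plane_degree m b c = field_degree m (cut_field b c)"
proof -
  let ?k = "\<lambda>s v. (1 - s) + s * axis_cutoff v"
  have "continuous_on A (\<lambda>z. axis_cutoff (snd z))" and
    "continuous_on A (\<lambda>z. cone_ext b (snd z))" and "continuous_on A (\<lambda>z. cone_ext c (snd z))"
    for A :: "(real \<times> (nat \<Rightarrow> real)) set"
    by (intro continuous_on_compose2[OF continuous_on_axis_cutoff[of UNIV]]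
        continuous_on_compose2[OF continuous_on_cone_ext[of _ UNIV]] continuous_intros
        regular_pairD[OF bc]; simp)+
  then have "field_degree m (plane_field (\<lambda>v. ?k 0 v * cone_ext b v) (\<lambda>v. ?k 0 v * cone_ext c v))
    = field_degree m (plane_field (\<lambda>v. ?k 1 v * cone_ext b v) (\<lambda>v. ?k 1 v * cone_ext c v))"
    by (intro plane_field_homotopy[OF m, where P = "\<lambda>s v. ?k s v * cone_ext b v" and Q = "\<lambda>s v. ?k s v * cone_ext c v"]
        continuous_intros plane_field_scaled_nonzero[OF m bc])
      (simp_all add: axis_cutoff_eq_1[OF _ m])
  then show ?thesis by (simp add: plane_degree_def cut_field_def)
qed

section \<open>Additivity over sectors of the plane\<close>

lemma open_sector: "open U \<Longrightarrow> open {v::nat \<Rightarrow> real. 0 < v 0 \<and> v 1 / v 0 \<in> U}"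
proof -
  assume U: "open U"
  have "open {v::nat \<Rightarrow> real. 0 < v 0}"
    by (intro open_Collect_less continuous_intros continuous_on_coord)
  moreover have "continuous_on {v::nat \<Rightarrow> real. 0 < v 0} (\<lambda>v. v 1 / v 0)"
    by (intro continuous_intros continuous_on_coord) auto
  ultimately have "open ({v::nat \<Rightarrow> real. 0 < v 0} \<inter> (\<lambda>v. v 1 / v 0) -` U)"
    using U by (intro continuous_open_preimage)
  then show ?thesis by (simp add: Collect_conj_eq vimage_def)
qed

lemma plane_degree_additive:
  assumes m: "m \<ge> 2"
    and reg: "regular_pair b1 c1" "regular_pair b2 c2" "regular_pair b3 c3" "regular_pair b4 c4"
    and U: "open U" and W: "open W" and UW: "U \<union> W = UNIV"
    and eqU: "\<And>t. t \<in> U \<Longrightarrow> b1 t = b3 t \<and> c1 t = c3 t \<and> b2 t = b4 t \<and> c2 t = c4 t"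
    and eqW: "\<And>t. t \<in> W \<Longrightarrow> b1 t = b2 t \<and> c1 t = c2 t \<and> b3 t = b4 t \<and> c3 t = c4 t"
  shows "plane_degree m b1 c1 + plane_degree m b4 c4 = plane_degree m b2 c2 + plane_degree m b3 c3"
proof -
  obtain M1 M2 M3 M4 where M: "M1 > 0"
    "\<And>t. M1 < \<bar>t\<bar> \<Longrightarrow> b1 t = 0 \<and> c1 t = 0" "\<And>t. M2 < \<bar>t\<bar> \<Longrightarrow> b2 t = 0 \<and> c2 t = 0"
    "\<And>t. M3 < \<bar>t\<bar> \<Longrightarrow> b3 t = 0 \<and> c3 t = 0" "\<And>t. M4 < \<bar>t\<bar> \<Longrightarrow> b4 t = 0 \<and> c4 t = 0"
    using reg[THEN regular_pair_supportE] by metis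
  define M where "M = Max {M1, M2, M3, M4}"
  \<comment> \<open>On \<open>Z\<close> all four cut fields are the identity. It is an open
    neighbourhood of everything with \<open>v 0 \<le> 0\<close>, and it overlaps the sectors, so the
    sectors over \<open>U\<close> and \<open>W\<close>, each enlarged by \<open>Z\<close>, form an
    open cover of the sphere.\<close>
  define Z :: "(nat \<Rightarrow> real) set" where
    "Z = {v. v 0 < 0} \<union> {v. \<bar>v 0\<bar> + \<bar>v 1\<bar> < 1 / 2} \<union> {v. M * \<bar>v 0\<bar> < \<bar>v 1\<bar>}"
  have Mgt: "M1 \<le> M" "M2 \<le> M" "M3 \<le> M" "M4 \<le> M" by (auto simp: M_def)
  have Z: "open Z"
    unfolding Z_def by (intro open_Un open_Collect_less continuous_intros continuous_on_coord)
  have cutZ: "axis_cutoff v * cone_ext g v = 0" if "v \<in> Z" and g: "\<And>t. M < \<bar>t\<bar> \<Longrightarrow> g t = 0" for v g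
  proof -
    consider "v 0 \<le> 0" | "v 0 > 0" "\<bar>v 0\<bar> + \<bar>v 1\<bar> < 1 / 2" | "v 0 > 0" "M * \<bar>v 0\<bar> < \<bar>v 1\<bar>"
      using \<open>v \<in> Z\<close> by (force simp: Z_def)
    then show ?thesis
    proof cases
      case 3
      then have "M < \<bar>v 1 / v 0\<bar>" by (simp add: field_simps)
      then show ?thesis by (simp add: cone_ext_def g)
    qed (auto simp: axis_cutoff_def cone_ext_def)
  qed
  let ?S = "\<lambda>U. sphere_pts m \<inter> ({v. 0 < v 0 \<and> v 1 / v 0 \<in> U} \<union> Z)"
  have op: "openin (nsphere (m - 1)) (?S A)" if "open A" for A
    unfolding nsphere_eq using open_sector[OF that] Z by (intro openin_open_Int open_Un)
  have cover: "sphere_pts m \<subseteq> ?S U \<union> ?S W"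
  proof
    fix v assume v: "v \<in> sphere_pts m"
    have "v 1 / v 0 \<in> U \<or> v 1 / v 0 \<in> W" using UW by blast
    moreover have "v \<in> Z" if "\<not> v 0 > 0"
      using that by (cases "v 0 < 0"; cases "v 1 = 0") (auto simp: Z_def)
    ultimately show "v \<in> ?S U \<union> ?S W" using v by auto
  qed
  have eq: "cut_field b c v = cut_field b' c' v"
    if "v \<in> ?S A" and "\<And>t. t \<in> A \<Longrightarrow> b t = b' t \<and> c t = c' t"
      and "\<And>t. M < \<bar>t\<bar> \<Longrightarrow> b t = 0 \<and> c t = 0" "\<And>t. M < \<bar>t\<bar> \<Longrightarrow> b' t = 0 \<and> c' t = 0"
    for v A b c b' c'
  proof (cases "v \<in> Z")
    case True
    have "axis_cutoff v * cone_ext b v = 0" "axis_cutoff v * cone_ext b' v = 0"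
      "axis_cutoff v * cone_ext c v = 0" "axis_cutoff v * cone_ext c' v = 0"
      by (rule cutZ[OF True]; use that(3,4) in blast)+
    then show ?thesis unfolding cut_field_def plane_field_def by (simp only:)
  next
    case False
    then show ?thesis using that by (auto simp: cut_field_def plane_field_def cone_ext_def)
  qed
  have big: "b1 t = 0 \<and> c1 t = 0" "b2 t = 0 \<and> c2 t = 0" "b3 t = 0 \<and> c3 t = 0" "b4 t = 0 \<and> c4 t = 0"
    if "M < \<bar>t\<bar>" for t
    by (fact M(2)[OF le_less_trans[OF Mgt(1) that]] M(3)[OF le_less_trans[OF Mgt(2) that]]
        M(4)[OF le_less_trans[OF Mgt(3) that]] M(5)[OF le_less_trans[OF Mgt(4) that]])+
  show ?thesis
    unfolding reg[THEN plane_degree_cut_field[OF m]]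
  proof (rule field_degree_additive[OF m op[OF U] op[OF W] cover])
    show "cut_field b1 c1 v = cut_field b3 c3 v" if "v \<in> ?S U" for v
      by (rule eq[OF that]) (use eqU big in auto)
    show "cut_field b2 c2 v = cut_field b4 c4 v" if "v \<in> ?S U" for v
      by (rule eq[OF that]) (use eqU big in auto)
    show "cut_field b1 c1 v = cut_field b2 c2 v" if "v \<in> ?S W" for v
      by (rule eq[OF that]) (use eqW big in auto)
    show "cut_field b3 c3 v = cut_field b4 c4 v" if "v \<in> ?S W" for v
      by (rule eq[OF that]) (use eqW big in auto)
  qed (use reg m in \<open>auto intro: sphere_field_cut_field\<close>)
qed

text \<open>The direction (1, p) of the fixed ray is missed: if the field points there on the ray of
  slope t, then \<open>b t < 1\<close> and \<open>t \<noteq> p\<close>, and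
  \<open>c t - b t * t\<close> equals \<open>(1 - b t) * (t - p)\<close>, which moves t away from
  p.\<close>

lemma plane_degree_contracting:
  assumes m: "m \<ge> 2" and bc: "regular_pair b c" and p: "b p > 1"
    and sgn: "\<And>t. t \<noteq> p \<Longrightarrow> (t - p) * (c t - b t * t) \<le> 0"
    and c: "c p = b p * p"
  shows "plane_degree m b c = 0"
  unfolding plane_degree_cut_field[OF m bc]
proof (rule field_degree_missed_direction[where w = "\<lambda>i. if i = 0 then 1 else if i = 1 then p else 0"])
  show "sphere_field m (cut_field b c)" by (rule sphere_field_cut_field[OF m bc])
  fix v y assume v: "v \<in> sphere_pts m" and y: "(y::real) > 0"
  show "cut_field b c v \<noteq> (\<lambda>i. y * (if i = 0 then 1 else if i = 1 then p else 0))"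
  proof
    assume eq: "cut_field b c v = (\<lambda>i. y * (if i = 0 then 1 else if i = 1 then p else 0))"
    have 2: "v i = 0" if "i \<ge> 2" for i
      using fun_cong[OF eq, of i] that by (simp add: cut_field_def plane_field_def)
    have k: "axis_cutoff v = 1" by (rule axis_cutoff_eq_1[OF v m 2])
    have 0: "v 0 - cone_ext b v = y" and 1: "v 1 - cone_ext c v = y * p"
      using fun_cong[OF eq, of 0] fun_cong[OF eq, of 1] k by (simp_all add: cut_field_def plane_field_def)
    have v0: "v 0 > 0"
    proof (rule ccontr)
      assume "\<not> v 0 > 0"
      then have "cone_ext b v = 0" by (auto simp: cone_ext_def max_def)
      with 0 y \<open>\<not> v 0 > 0\<close> show False by linarith
    qed
    define t where "t = v 1 / v 0"
    have v1: "v 1 = v 0 * t" using v0 by (simp add: t_def)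
    have e: "cone_ext b v = v 0 * b t" "cone_ext c v = v 0 * c t"
      using v0 by (auto simp: cone_ext_def t_def)
    have y0: "y = v 0 * (1 - b t)" using 0 e by (simp add: algebra_simps)
    have "v 0 * (t - c t) = v 0 * ((1 - b t) * p)"
      using 1 e y0 v1 by (simp add: algebra_simps)
    then have tc: "t - c t = (1 - b t) * p" using v0 by simp
    have b1: "b t < 1" using y y0 v0 by (simp add: zero_less_mult_iff)
    then have "t \<noteq> p" using p by auto
    have "c t - b t * t = (1 - b t) * (t - p)" using tc by (simp add: algebra_simps)
    then have "(t - p) * (c t - b t * t) = (1 - b t) * (t - p)\<^sup>2"
      by (simp add: power2_eq_square)
    moreover have "\<dots> > 0" using b1 \<open>t \<noteq> p\<close> by simp
    ultimately show False using sgn[OF \<open>t \<noteq> p\<close>] by linarith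
  qed
qed (use m in \<open>auto simp: topspace_Euclidean_space fun_eq_iff intro: exI[of _ 0]\<close>)

text \<open>Only the sign of \<open>c t - t\<close> at the points with \<open>b t = 1\<close>
  matters: if the signs agree there, the segment between the two pairs stays regular.\<close>

lemma plane_degree_cong_offset:
  assumes m: "m \<ge> 2" and bd: "regular_pair b (\<lambda>t. b t * t + d t)" and be: "regular_pair b (\<lambda>t. b t * t + e t)"
    and pos: "\<And>t. b t = 1 \<Longrightarrow> d t * e t > 0"
  shows "plane_degree m b (\<lambda>t. b t * t + d t) = plane_degree m b (\<lambda>t. b t * t + e t)"
proof -
  obtain M where M: "\<And>t. M < \<bar>t\<bar> \<Longrightarrow> b t = 0" "\<And>t. M < \<bar>t\<bar> \<Longrightarrow> b t * t + d t = 0"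
    using bd by (rule regular_pair_supportE) blast
  obtain N where N: "\<And>t. N < \<bar>t\<bar> \<Longrightarrow> b t = 0" "\<And>t. N < \<bar>t\<bar> \<Longrightarrow> b t * t + e t = 0"
    using be by (rule regular_pair_supportE) blast
  define C where "C s t = (1 - s) * (b t * t + d t) + s * (b t * t + e t)" for s t
  have "plane_degree m ((\<lambda>_. b) (0::real)) (C 0) = plane_degree m ((\<lambda>_. b) (1::real)) (C 1)"
  proof (rule plane_degree_homotopy[OF m, where B = "\<lambda>_. b" and C = C and M = "max M N"])
    fix s t :: real
    assume s: "s \<in> {0..1}" and b1: "b t = 1"
    have "(1 - s) * d t + s * e t \<noteq> 0"
    proof (cases "d t > 0")
      case True
      then have "e t > 0" using pos[OF b1] by (simp add: zero_less_mult_iff)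
      then show ?thesis
        using True s by (cases "s = 0") (auto intro!: less_imp_neq[symmetric] add_nonneg_pos)
    next
      case False
      then have "d t < 0" "e t < 0" using pos[OF b1] by (auto simp: zero_less_mult_iff)
      then show ?thesis
        using s mult_pos_neg[of s "e t"] mult_nonneg_nonpos[of "1 - s" "d t"]
        by (cases "s = 0") auto
    qed
    moreover have "C s t = t + ((1 - s) * d t + s * e t)"
      using b1 by (simp add: C_def algebra_simps)
    ultimately show "C s t \<noteq> t" by simp
  next
    have "continuous_on A (\<lambda>z. b (snd z))"
      and "continuous_on A (\<lambda>z. b (snd z) * snd z + d (snd z))"
      and "continuous_on A (\<lambda>z. b (snd z) * snd z + e (snd z))" for A :: "(real \<times> real) set"
      using continuous_on_comp_snd[OF regular_pairD(3)[OF bd]] continuous_on_comp_snd[OF regular_pairD(4)[OF bd]]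
        continuous_on_comp_snd[OF regular_pairD(4)[OF be]] by auto
    note cts = this
    show "continuous_on ({0..1::real} \<times> UNIV) (\<lambda>z. b (snd z))" by (rule cts)
    show "continuous_on ({0..1} \<times> UNIV) (\<lambda>z. C (fst z) (snd z))"
      unfolding C_def by (intro continuous_on_add continuous_on_mult continuous_on_diff
          continuous_on_const continuous_on_fst_id cts)
  qed (use M N in \<open>auto simp: C_def\<close>)
  moreover have "C 0 = (\<lambda>t. b t * t + d t)" "C 1 = (\<lambda>t. b t * t + e t)"
    by (simp_all add: C_def fun_eq_iff)
  ultimately show ?thesis by simp
qed

text \<open>The offset may still vanish where \<open>b t > 1\<close>. Adding
  \<open>max 0 (b t - 1 / 2)\<close> with the same sign makes it nonzero there, keeps the signs at
  \<open>b t = 1\<close> and the bounded support, and leaves no crossing.\<close>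

lemma plane_degree_one_signed:
  assumes m: "m \<ge> 2" and be: "regular_pair b (\<lambda>t. b t * t + \<sigma> * e t)"
    and \<sigma>: "\<sigma> \<in> {1, -1}" and e: "\<And>t. e t \<ge> 0"
  shows "plane_degree m b (\<lambda>t. b t * t + \<sigma> * e t) = 1"
proof -
  let ?e = "\<lambda>t. \<sigma> * (e t + max 0 (b t - 1 / 2))"
  have s0: "\<sigma> * x = 0 \<longleftrightarrow> x = 0" for x using \<sigma> by auto
  have e1: "e t > 0" if "b t = 1" for t
    using regular_pairD(5)[OF be that] that e[of t] by (auto simp: less_le)
  obtain M where "\<And>t. M < \<bar>t\<bar> \<Longrightarrow> b t = 0" using be by (rule regular_pair_supportE) blast
  then have "compact_supp (\<lambda>t. max 0 (b t - 1 / 2))"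
    using regular_pairD(3)[OF be] by (auto simp: compact_supp_def intro!: continuous_intros exI[of _ M])
  then have "compact_supp (\<lambda>t. (b t * t + \<sigma> * e t) + \<sigma> * max 0 (b t - 1 / 2))"
    by (intro compact_supp_add compact_supp_mult regular_pairD(2)[OF be]) auto
  then have "compact_supp (\<lambda>t. b t * t + ?e t)" by (simp add: algebra_simps)
  moreover have "b t * t + ?e t \<noteq> t" if "b t = 1" for t
    using e1[OF that] that s0[of "e t + max 0 (b t - 1 / 2)"] by auto
  ultimately have be': "regular_pair b (\<lambda>t. b t * t + ?e t)"
    using regular_pairD(1)[OF be] by (simp add: regular_pair_def)
  have "plane_degree m b (\<lambda>t. b t * t + \<sigma> * e t) = plane_degree m b (\<lambda>t. b t * t + ?e t)"
  proof (rule plane_degree_cong_offset[OF m be be'])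
    fix t assume "b t = 1"
    then have "e t * (e t + max 0 (b t - 1 / 2)) > 0" using e1 by (intro mult_pos_pos add_pos_nonneg) auto
    moreover have "\<sigma> * e t * ?e t = e t * (e t + max 0 (b t - 1 / 2))"
      using \<sigma> by (auto simp: algebra_simps)
    ultimately show "\<sigma> * e t * ?e t > 0" by argo
  qed
  also have "\<dots> = 1"
  proof (rule plane_degree_no_crossing[OF m be'])
    fix t assume "b t > 1"
    then have "e t + max 0 (b t - 1 / 2) > 0" using e[of t] by (intro add_nonneg_pos) auto
    then show "b t * t + ?e t \<noteq> b t * t" using s0[of "e t + max 0 (b t - 1 / 2)"] by simp
  qed
  finally show ?thesis .
qed

text \<open>A crossing at \<open>p\<close> is cut into its two sides; the four combinations of their signs give fields
  of degree 2 (expanding), 1, 1 and 0 (contracting).\<close>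

lemma plane_degree_one_crossing:
  assumes m: "m \<ge> 2" and bc: "regular_pair b c" and p: "b p > 1" "c p = b p * p" and \<sigma>: "\<sigma> \<in> {1, -1 :: int}"
    and sgn: "\<And>t. t \<noteq> p \<Longrightarrow> b t \<ge> 1 \<Longrightarrow> of_int \<sigma> * (t - p) * (c t - b t * t) > 0"
  shows "plane_degree m b c = 1 + \<sigma>"
proof -
  have cb: "continuous_on UNIV b" and cc: "continuous_on UNIV c" by (rule regular_pairD[OF bc])+
  have "open (b -` {1<..})" using cb by (intro open_vimage) auto
  then obtain \<delta> where \<delta>: "\<delta> > 0" "\<And>t. \<bar>t - p\<bar> < \<delta> \<Longrightarrow> b t > 1"
    using p(1) by (auto simp: open_dist dist_real_def)
  define \<eta> where "\<eta> = \<delta> / 3"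
  have \<eta>: "\<eta> > 0" "\<And>t. \<bar>t - p\<bar> \<le> 2 * \<eta> \<Longrightarrow> b t > 1" using \<delta> by (auto simp: \<eta>_def)
  \<comment> \<open>Ramps that vanish up to distance \<open>\<eta>\<close> from p and reach 1 at
    distance \<open>2 * \<eta>\<close>. The condition \<open>b t = 1\<close> occurs only farther
    out, where exactly one of them is 1 and the other 0.\<close>
  define R where "R t = max 0 (min 1 ((t - p) / \<eta> - 1))" for t
  define L where "L t = max 0 (min 1 ((p - t) / \<eta> - 1))" for t
  define D where "D t = \<bar>c t - b t * t\<bar>" for t
  define e where "e \<alpha> \<gamma> t = (\<alpha> * L t + \<gamma> * R t) * D t" for \<alpha> \<gamma> t :: real
  define P where "P \<alpha> \<gamma> t = b t * t + e \<alpha> \<gamma> t" for \<alpha> \<gamma> t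
  have R0: "R t = 0" if "t < p + \<eta>" for t
    using that \<eta>(1) by (auto simp: R_def field_simps)
  have L0: "L t = 0" if "p - \<eta> < t" for t
    using that \<eta>(1) by (auto simp: L_def field_simps)
  have LR: "t > p \<and> R t = 1 \<and> L t = 0 \<or> t < p \<and> R t = 0 \<and> L t = 1" if "b t = 1" for t
  proof -
    have "\<not> \<bar>t - p\<bar> \<le> 2 * \<eta>" using \<eta>(2)[of t] that by auto
    then consider "p + 2 * \<eta> < t" | "t < p - 2 * \<eta>" by linarith
    then show ?thesis
    proof cases
      case 1
      then have "2 \<le> (t - p) / \<eta>" using \<eta>(1) by (simp add: pos_le_divide_eq)
      then show ?thesis using 1 \<eta>(1) by (simp add: R_def L0)
    next
      case 2
      then have "2 \<le> (p - t) / \<eta>" using \<eta>(1) by (simp add: pos_le_divide_eq)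
      then show ?thesis using 2 \<eta>(1) by (simp add: L_def R0)
    qed
  qed
  have D1: "D t > 0" if "b t = 1" for t
    using regular_pairD(5)[OF bc that] that by (simp add: D_def)
  have cD: "compact_supp D"
  proof -
    have "compact_supp (\<lambda>t. c t + (- t) * b t)"
      by (intro compact_supp_add compact_supp_mult regular_pairD[OF bc] continuous_intros)
    then have "compact_supp (\<lambda>t. c t - b t * t)" by (simp add: mult.commute)
    then show ?thesis
      unfolding D_def compact_supp_def by (auto intro!: continuous_intros)
  qed
  have P: "regular_pair b (P \<alpha> \<gamma>)" if "\<alpha> \<in> {1,-1}" "\<gamma> \<in> {1,-1}" for \<alpha> \<gamma>
  proof -
    have "compact_supp (\<lambda>t. t * b t + (\<alpha> * L t + \<gamma> * R t) * D t)"
      unfolding L_def R_def using \<eta>(1)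
      by (intro compact_supp_add compact_supp_mult regular_pairD[OF bc] cD continuous_intros) auto
    moreover have "P \<alpha> \<gamma> = (\<lambda>t. t * b t + (\<alpha> * L t + \<gamma> * R t) * D t)"
      by (simp add: P_def e_def fun_eq_iff mult.commute)
    ultimately have "compact_supp (P \<alpha> \<gamma>)" by simp
    moreover have "P \<alpha> \<gamma> t \<noteq> t" if "b t = 1" for t
      using LR[OF that] D1[OF that] that \<open>\<alpha> \<in> {1,-1}\<close> \<open>\<gamma> \<in> {1,-1}\<close> by (auto simp: P_def e_def)
    ultimately show ?thesis using regular_pairD(1)[OF bc] by (auto simp: regular_pair_def)
  qed
  let ?d = "\<lambda>\<alpha> \<gamma>. plane_degree m b (P \<alpha> \<gamma>)"
  \<comment> \<open>To the left of \<open>p + \<eta>\<close> the pair depends on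
    \<open>\<alpha>\<close> only, to the right of \<open>p - \<eta>\<close> on
    \<open>\<gamma>\<close> only. Three of the four degrees are found directly, and the identity
    yields 2 for the expanding one.\<close>
  have 4: "?d (-1) 1 + ?d 1 (-1) = ?d 1 1 + ?d (-1) (-1)"
    by (rule plane_degree_additive[OF m P P P P, of _ _ _ _ _ _ _ _ "{..<p + \<eta>}" "{p - \<eta><..}", rotated 8])
      (use \<eta>(1) in \<open>auto simp: P_def e_def R0 L0\<close>)
  have LRnn: "L t \<ge> 0" "R t \<ge> 0" "D t \<ge> 0" for t by (auto simp: L_def R_def D_def)
  have 1: "?d 1 1 = 1" "?d (-1) (-1) = 1"
  proof -
    have "?d \<sigma> \<sigma> = 1" if "\<sigma> \<in> {1,-1}" for \<sigma>
    proof -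
      have eq: "P \<sigma> \<sigma> = (\<lambda>t. b t * t + \<sigma> * ((L t + R t) * D t))"
        by (auto simp: P_def e_def fun_eq_iff algebra_simps)
      show ?thesis
        using plane_degree_one_signed[OF m P[OF that that, unfolded eq] that] LRnn by (simp add: eq)
    qed
    then show "?d 1 1 = 1" "?d (-1) (-1) = 1" by auto
  qed
  have 0: "?d 1 (-1) = 0"
  proof (rule plane_degree_contracting[OF m P p(1)])
    show "P 1 (-1) p = b p * p" using \<eta>(1) by (simp add: P_def e_def L0 R0)
    show "(t - p) * (P 1 (- 1) t - b t * t) \<le> 0" for t
    proof (cases "t \<le> p")
      case True
      then have "R t = 0" using \<eta>(1) by (intro R0) auto
      then show ?thesis using True LRnn by (auto simp: P_def e_def intro!: mult_nonpos_nonneg)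
    next
      case False
      then have "L t = 0" using \<eta>(1) by (intro L0) auto
      then show ?thesis using False LRnn by (auto simp: P_def e_def intro!: mult_nonneg_nonneg)
    qed
  qed auto
  have "plane_degree m b c = plane_degree m b (\<lambda>t. b t * t + (c t - b t * t))" by simp
  also have "\<dots> = plane_degree m b (\<lambda>t. b t * t + e (- of_int \<sigma>) (of_int \<sigma>) t)"
  proof (rule plane_degree_cong_offset[OF m])
    show "regular_pair b (\<lambda>t. b t * t + e (- of_int \<sigma>) (of_int \<sigma>) t)"
      using P[of "- of_int \<sigma>" "of_int \<sigma>"] \<sigma> by (auto simp: P_def[abs_def])
    show "(c t - b t * t) * e (- of_int \<sigma>) (of_int \<sigma>) t > 0" if "b t = 1" for t
    proof -
      have s: "of_int \<sigma> * (t - p) * (c t - b t * t) > 0"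
        using sgn[of t] LR[OF that] that by auto
      show ?thesis using LR[OF that]
      proof
        assume *: "p < t \<and> R t = 1 \<and> L t = 0"
        show ?thesis using \<sigma> s * D1[OF that] by (auto simp: e_def zero_less_mult_iff mult_less_0_iff)
      next
        assume *: "t < p \<and> R t = 0 \<and> L t = 1"
        show ?thesis using \<sigma> s * D1[OF that] by (auto simp: e_def zero_less_mult_iff mult_less_0_iff)
      qed
    qed
  qed (use bc in auto)
  also have "\<dots> = ?d (- of_int \<sigma>) (of_int \<sigma>)" by (simp add: P_def[abs_def])
  finally show ?thesis using \<sigma> 0 1 4 by auto
qed

text \<open>Each crossing is split off by a cutoff supported near it.\<close>

theorem plane_degree_eq_crossings:
  assumes m: "m \<ge> 2" and bc: "regular_pair b c"
    and T: "finite T" "{t. b t > 1 \<and> c t = b t * t} = T"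
    and \<sigma>: "\<And>p. p \<in> T \<Longrightarrow> \<sigma> p \<in> {1, -1 :: int}"
    and sgn: "\<And>p. p \<in> T \<Longrightarrow>
      \<exists>\<epsilon>>0. \<forall>t. 0 < \<bar>t - p\<bar> \<and> \<bar>t - p\<bar> < \<epsilon> \<longrightarrow> of_int (\<sigma> p) * (t - p) * (c t - b t * t) > 0"
  shows "plane_degree m b c = 1 + (\<Sum>p\<in>T. \<sigma> p)"
  using T bc \<sigma> sgn
proof (induction T arbitrary: b c rule: finite_induct)
  case empty
  then show ?case using plane_degree_no_crossing[OF m] by auto
next
  case (insert p T)
  note bc = insert.prems(2)
  have T: "b t > 1 \<and> c t = b t * t \<longleftrightarrow> t = p \<or> t \<in> T" for t using insert.prems(1) by blast
  have p: "b p > 1" "c p = b p * p" using T by auto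
  obtain \<epsilon> where \<epsilon>: "\<epsilon> > 0"
    "\<And>t. 0 < \<bar>t - p\<bar> \<Longrightarrow> \<bar>t - p\<bar> < \<epsilon> \<Longrightarrow> of_int (\<sigma> p) * (t - p) * (c t - b t * t) > 0"
    using insert.prems(4)[of p] by auto
  \<comment> \<open>\<open>k\<close> is a tent of radius \<open>\<epsilon> / 3\<close> with value 1
    only at p; \<open>l\<close> is 1 up to distance \<open>\<epsilon> / 2\<close> and 0 from
    \<open>3 * \<epsilon> / 4\<close> on. Thus \<open>1 - k\<close> removes the crossing at p,
    \<open>l\<close> removes all others, and the regions with \<open>l = 1\<close> and with
    \<open>k = 0\<close> overlap and cover the line.\<close>
  define k where "k t = max 0 (1 - 3 * \<bar>t - p\<bar> / \<epsilon>)" for t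
  define l where "l t = max 0 (min 1 (3 - 4 * \<bar>t - p\<bar> / \<epsilon>))" for t
  have k: "0 \<le> k t" "k t \<le> 1" and l: "0 \<le> l t" "l t \<le> 1" for t using \<epsilon>(1) by (auto simp: k_def l_def)
  have k0: "k t = 0" if "\<epsilon> / 3 \<le> \<bar>t - p\<bar>" for t using that \<epsilon>(1) by (simp add: k_def field_simps)
  have k1: "k t < 1" if "t \<noteq> p" for t using that \<epsilon>(1) by (simp add: k_def field_simps)
  have kp: "k p = 1" "l p = 1" by (simp_all add: k_def l_def)
  have l0: "l t = 0" if "\<epsilon> \<le> \<bar>t - p\<bar>" for t using that \<epsilon>(1) by (simp add: l_def field_simps)
  have l1: "l t = 1" if "\<bar>t - p\<bar> < \<epsilon> / 2" for t using that \<epsilon>(1) by (simp add: l_def field_simps)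
  have cts: "continuous_on UNIV k" "continuous_on UNIV l"
    using \<epsilon>(1) unfolding k_def l_def by (auto intro!: continuous_intros)
  \<comment> \<open>A violation for the scaled pair has \<open>c t = b t * t\<close> with
    \<open>b t \<ge> 1\<close>, hence is a crossing of the original pair; there \<open>h\<close> is
    0 or 1, and neither value lets the scaled weight equal 1.\<close>
  have reg: "regular_pair (\<lambda>t. h t * b t) (\<lambda>t. h t * c t)"
    if h: "continuous_on UNIV h" "\<And>t. 0 \<le> h t \<and> h t \<le> 1" and hT: "\<And>t. t \<in> insert p T \<Longrightarrow> h t \<in> {0, 1}" for h
  proof -
    have "h t * c t \<noteq> t" if hb: "h t * b t = 1" for t
    proof
      assume hc: "h t * c t = t"
      have h0: "h t > 0" using hb h(2)[of t] by (cases "h t = 0") auto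
      have "h t * b t \<le> b t \<or> b t < 0" using h(2)[of t] mult_left_le_one_le[of "b t" "h t"] by (cases "b t < 0") auto
      then have b1: "b t \<ge> 1" using hb h0 mult_pos_neg[of "h t" "b t"] by linarith
      have "h t * c t = h t * (b t * t)" using hb hc by (simp flip: mult.assoc)
      then have ct: "c t = b t * t" using h0 by simp
      show False
      proof (cases "b t = 1")
        case True
        then show False using regular_pairD(5)[OF bc True] ct by simp
      next
        case False
        then have "t \<in> insert p T" using T[of t] b1 ct by auto
        then have "h t = 1" using hT h0 by force
        then show False using hb False by simp
      qed
    qed
    then show ?thesis
      using h(1) regular_pairD[OF bc] by (auto simp: regular_pair_def intro!: compact_supp_mult)
  qed
  have notT: "\<epsilon> \<le> \<bar>t - p\<bar>" if "t \<in> T" for t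
  proof (rule ccontr)
    assume "\<not> \<epsilon> \<le> \<bar>t - p\<bar>"
    moreover have "t \<noteq> p" using that insert.hyps by auto
    ultimately have "of_int (\<sigma> p) * (t - p) * (c t - b t * t) > 0" using \<epsilon>(2)[of t] by auto
    moreover have "c t = b t * t" using T that by blast
    ultimately show False by simp
  qed
  have kT: "k t = 0" "l t = 0" if "t \<in> T" for t
    using notT[OF that] \<epsilon>(1) by (auto intro!: k0 l0)
  have r2: "regular_pair (\<lambda>t. (1 - k t) * b t) (\<lambda>t. (1 - k t) * c t)"
    using kT kp k by (intro reg continuous_intros cts) auto
  have r3: "regular_pair (\<lambda>t. l t * b t) (\<lambda>t. l t * c t)"
    using kT kp l by (intro reg cts) auto
  have r4: "regular_pair (\<lambda>t. (l t * (1 - k t)) * b t) (\<lambda>t. (l t * (1 - k t)) * c t)"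
    using kT kp k l by (intro reg continuous_intros cts) (auto intro: mult_le_one)
  \<comment> \<open>The factor \<open>l\<close> is invisible near p and \<open>1 - k\<close> away
    from p, so the identity applies. The pair with both factors has no crossing and degree 1; what p
    adds is therefore the degree of the \<open>l\<close>-pair minus 1.\<close>
  have "plane_degree m b c + plane_degree m (\<lambda>t. (l t * (1 - k t)) * b t) (\<lambda>t. (l t * (1 - k t)) * c t)
     = plane_degree m (\<lambda>t. (1 - k t) * b t) (\<lambda>t. (1 - k t) * c t)
     + plane_degree m (\<lambda>t. l t * b t) (\<lambda>t. l t * c t)"
  proof (rule plane_degree_additive[OF m bc r2 r3 r4])
    show "open {t. \<bar>t - p\<bar> < \<epsilon> / 2}" "open {t. \<epsilon> / 3 < \<bar>t - p\<bar>}"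
      by (intro open_Collect_less continuous_intros)+
    show "{t. \<bar>t - p\<bar> < \<epsilon> / 2} \<union> {t. \<epsilon> / 3 < \<bar>t - p\<bar>} = UNIV" using \<epsilon>(1) by auto
  qed (auto simp: l1 k0)
  moreover have "plane_degree m (\<lambda>t. (l t * (1 - k t)) * b t) (\<lambda>t. (l t * (1 - k t)) * c t) = 1"
  proof (rule plane_degree_no_crossing[OF m r4], rule notI)
    fix t assume *: "1 < l t * (1 - k t) * b t" "l t * (1 - k t) * c t = l t * (1 - k t) * b t * t"
    let ?h = "l t * (1 - k t)"
    have h: "0 \<le> ?h" "?h \<le> 1" using k l by (auto intro: mult_le_one)
    have "?h \<noteq> 0" using *(1) by auto
    then have h0: "?h > 0" using h(1) by linarith
    then have "c t = b t * t" using *(2) by (auto simp: mult.assoc)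
    moreover have "b t > 1"
      using *(1) h h0 mult_left_le_one_le[of "b t" ?h] mult_pos_neg[of ?h "b t"] by (cases "b t < 0") auto
    ultimately have "t = p \<or> t \<in> T" using T by blast
    then show False using h0 kT kp by auto
  qed
  moreover have "plane_degree m (\<lambda>t. l t * b t) (\<lambda>t. l t * c t) = 1 + \<sigma> p"
  proof (rule plane_degree_one_crossing[OF m r3])
    show "\<sigma> p \<in> {1, -1}" using insert.prems(3) by simp
    show "1 < l p * b p" "l p * c p = l p * b p * p" using p kp by auto
    fix t assume t: "t \<noteq> p" "1 \<le> l t * b t"
    have l0': "l t > 0" using t(2) l(1)[of t] by (cases "l t = 0") auto
    then have "\<bar>t - p\<bar> < \<epsilon>" using l0[of t] by fastforce
    then have "l t * (of_int (\<sigma> p) * (t - p) * (c t - b t * t)) > 0"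
      using \<epsilon>(2)[of t] t(1) by (intro mult_pos_pos[OF l0']) auto
    then show "0 < of_int (\<sigma> p) * (t - p) * (l t * c t - l t * b t * t)"
      by (simp add: algebra_simps)
  qed
  moreover have "plane_degree m (\<lambda>t. (1 - k t) * b t) (\<lambda>t. (1 - k t) * c t) = 1 + (\<Sum>p\<in>T. \<sigma> p)"
  proof (rule insert.IH[OF _ r2])
    show "{t. 1 < (1 - k t) * b t \<and> (1 - k t) * c t = (1 - k t) * b t * t} = T"
    proof (intro equalityI subsetI)
      fix t assume "t \<in> T"
      then show "t \<in> {t. 1 < (1 - k t) * b t \<and> (1 - k t) * c t = (1 - k t) * b t * t}"
        using kT T by auto
    next
      fix t assume "t \<in> {t. 1 < (1 - k t) * b t \<and> (1 - k t) * c t = (1 - k t) * b t * t}"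
      then have *: "1 < (1 - k t) * b t" "(1 - k t) * c t = (1 - k t) * (b t * t)" by (auto simp: mult.assoc)
      then have tp: "t \<noteq> p" using kp by auto
      then have h: "0 < 1 - k t" "1 - k t \<le> 1" using k k1 by auto
      then have "c t = b t * t" using *(2) by simp
      moreover have "b t > 1"
        using *(1) h mult_left_le_one_le[of "b t" "1 - k t"] mult_pos_neg[of "1 - k t" "b t"]
        by (cases "b t < 0") auto
      ultimately show "t \<in> T" using T tp by blast
    qed
    fix q assume q: "q \<in> T"
    show "\<sigma> q \<in> {1, -1}" using insert.prems(3) q by simp
    obtain \<delta> where \<delta>: "\<delta> > 0"
      "\<And>t. 0 < \<bar>t - q\<bar> \<Longrightarrow> \<bar>t - q\<bar> < \<delta> \<Longrightarrow> of_int (\<sigma> q) * (t - q) * (c t - b t * t) > 0"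
      using insert.prems(4)[of q] q by auto
    show "\<exists>\<epsilon>>0. \<forall>t. 0 < \<bar>t - q\<bar> \<and> \<bar>t - q\<bar> < \<epsilon> \<longrightarrow>
        0 < of_int (\<sigma> q) * (t - q) * ((1 - k t) * c t - (1 - k t) * b t * t)"
    proof (intro exI[of _ "min \<delta> (\<epsilon> / 3)"] conjI allI impI)
      show "0 < min \<delta> (\<epsilon> / 3)" using \<delta>(1) \<epsilon>(1) by simp
      fix t assume t: "0 < \<bar>t - q\<bar> \<and> \<bar>t - q\<bar> < min \<delta> (\<epsilon> / 3)"
      then have "\<epsilon> / 3 \<le> \<bar>t - p\<bar>" using notT[OF q] by arith
      then show "0 < of_int (\<sigma> q) * (t - q) * ((1 - k t) * c t - (1 - k t) * b t * t)"
        using \<delta>(2)[of t] t by (simp add: k0)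
    qed
  qed
  ultimately show ?case using insert.hyps by simp
qed

section \<open>A one-dimensional system with prescribed periodic orbits\<close>

text \<open>At each point at most one term is nonzero, so the tail of the series is bounded by a
  single \<open>M i\<close> and the convergence is uniform.\<close>

lemma continuous_on_disjoint_series:
  fixes g :: "nat \<Rightarrow> 'a::topological_space \<Rightarrow> real"
  assumes g: "\<And>i. continuous_on UNIV (g i)"
    and disj: "\<And>t i j. g i t \<noteq> 0 \<Longrightarrow> g j t \<noteq> 0 \<Longrightarrow> i = j"
    and M: "\<And>i t. \<bar>g i t\<bar> \<le> M i" "M \<longlonglongrightarrow> 0"
  shows "continuous_on UNIV (\<lambda>t. suminf (\<lambda>i. g i t))"
proof (rule uniform_limit_theorem[where F = sequentially and f = "\<lambda>n t. \<Sum>i<n. g i t"])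
  have single: "(suminf (\<lambda>i. g i t)) = g j t" "(\<Sum>i<n. g i t) = (if j < n then g j t else 0)"
    if "g j t \<noteq> 0" for j t n
  proof -
    have z: "g i t = 0" if "i \<noteq> j" for i using disj[of i t j] \<open>g j t \<noteq> 0\<close> that by blast
    show "(suminf (\<lambda>i. g i t)) = g j t"
      using suminf_finite[of "{j}" "\<lambda>i. g i t"] z by auto
    have "(\<Sum>i<n. g i t) = (\<Sum>i<n. if i = j then g j t else 0)"
      using z by (intro sum.cong) auto
    then show "(\<Sum>i<n. g i t) = (if j < n then g j t else 0)" by simp
  qed
  show "uniform_limit UNIV (\<lambda>n t. \<Sum>i<n. g i t) (\<lambda>t. suminf (\<lambda>i. g i t)) sequentially"
  proof (rule uniform_limitI)
    fix e :: real assume e: "e > 0"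
    obtain N where N: "\<And>i. i \<ge> N \<Longrightarrow> \<bar>M i\<bar> < e"
      using LIMSEQ_D[OF M(2) e] by auto
    show "\<forall>\<^sub>F n in sequentially. \<forall>t\<in>UNIV. dist (\<Sum>i<n. g i t) (suminf (\<lambda>i. g i t)) < e"
      unfolding eventually_sequentially
    proof (intro exI[of _ N] allI impI ballI)
      fix n t assume n: "N \<le> n"
      show "dist (\<Sum>i<n. g i t) (suminf (\<lambda>i. g i t)) < e"
      proof (cases "\<exists>j. g j t \<noteq> 0")
        case True
        then obtain j where j: "g j t \<noteq> 0" by blast
        show ?thesis
          using N[of j] M(1)[of j t] e n by (auto simp: single[OF j] dist_real_def)
      qed (use e in auto)
    qed
  qed
qed (auto intro!: always_eventually continuous_on_sum g)

text \<open>The map \<open>step\<close> doubles on \<open>[-1, 1]\<close>. The window of radius \<open>rad i\<close> about \<open>site i\<close> is thrown back so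
  close to 0 that it takes \<open>per i - 1\<close> doublings to return, and \<open>slope i\<close> is the derivative of the
  return map: 0 gives a contracting and 2 an expanding orbit. The weight vanishes between the windows, which kills all
  other orbits, and its product along the orbit of \<open>site i\<close> is 2, although the weight of the windows tends
  to 0.\<close>

locale towers =
  fixes I :: "nat set" and per :: "nat \<Rightarrow> nat" and slope :: "nat \<Rightarrow> real"
  assumes per: "i \<in> I \<Longrightarrow> per i \<ge> 1" and slope: "slope i \<in> {0, 2}"
    and fin: "finite {i \<in> I. per i = k}"
begin

text \<open>The sites decrease to 5/4, and neighbours are far enough apart for the windows to stay
  disjoint after their radii are doubled. All of this lies between 5/4 and 7/4: halving such a point
  gives at most 7/8, and two such points never differ by a factor 2.\<close>

definition site :: "nat \<Rightarrow> real" where "site i = 5 / 4 + (1 / 2) ^ i / 4"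
definition rad :: "nat \<Rightarrow> real" where "rad i = (1 / 2) ^ i / 100"
definition height :: "nat \<Rightarrow> real" where "height i = (if i \<in> I then 2 * (1 / 4) ^ (per i - 1) else 0)"
definition bump :: "nat \<Rightarrow> real \<Rightarrow> real" where
  "bump i t = height i * max 0 (1 - \<bar>t - site i\<bar> / rad i)"
text \<open>The factor 32 makes it equal to 4 up to 7/8, the range of all halved window points, and
  0 from 1 on, where \<open>step\<close> ceases to double.\<close>

definition plateau :: "real \<Rightarrow> real" where "plateau t = max 0 (min 4 (32 * (1 - \<bar>t\<bar>)))"
definition weight :: "real \<Rightarrow> real" where "weight t = plateau t + (suminf (\<lambda>i. bump i t))"
definition ret :: "nat \<Rightarrow> real \<Rightarrow> real" where "ret i t = site i + slope i * (t - site i)"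
text \<open>It jumps at 1 and at the edges of the windows, but the weight vanishes there, and only
  its products with the weight have to be continuous. The final 0 is a placeholder.\<close>

definition step :: "real \<Rightarrow> real" where
  "step t = (if \<bar>t\<bar> \<le> 1 then 2 * t
     else if \<exists>i. \<bar>t - site i\<bar> < rad i
     then let i = THE i. \<bar>t - site i\<bar> < rad i in ret i t / 2 ^ (per i - 1) else 0)"
definition total_weight :: "nat \<Rightarrow> real \<Rightarrow> real" where
  "total_weight n t = (\<Prod>j<n. weight ((step ^^ j) t))"

section \<open>Windows, and continuity of the weighted step\<close>

lemma rad_pos: "rad i > 0" by (simp add: rad_def)

text \<open>Doubled radii are needed because a return map of slope 2 carries the window onto the
  window of twice the radius.\<close>

lemma window_disjoint:
  assumes "\<bar>t - site i\<bar> < 2 * rad i" "\<bar>t - site j\<bar> < 2 * rad j"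
  shows "i = j"
proof -
  have less: False if "i < j" "\<bar>t - site i\<bar> < 2 * rad i" "\<bar>t - site j\<bar> < 2 * rad j" for i j
  proof -
    have "(1 / 2 :: real) ^ j \<le> (1 / 2) ^ Suc i" using that(1) by (intro power_decreasing) auto
    moreover have "(1 / 2 :: real) ^ i > 0" by simp
    ultimately show False
      using that(2,3) unfolding site_def rad_def abs_less_iff power_Suc by linarith
  qed
  show ?thesis using less[of i j] less[of j i] assms by (metis nat_neq_iff)
qed

lemma window_disjoint':
  "\<bar>t - site i\<bar> < rad i \<Longrightarrow> \<bar>t - site j\<bar> < 2 * rad j \<Longrightarrow> i = j"
  using window_disjoint[of t i j] rad_pos[of i] by simp

lemma window_range:
  assumes "\<bar>t - site i\<bar> < 2 * rad i"
  shows "5 / 4 < t" "t < 7 / 4"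
proof -
  have "(1 / 2 :: real) ^ i > 0" "(1 / 2 :: real) ^ i \<le> 1" by (auto intro: power_le_one)
  then show "5 / 4 < t" "t < 7 / 4"
    using assms unfolding site_def rad_def abs_less_iff by linarith+
qed

lemma site_window [simp]: "\<bar>site i - site i\<bar> < rad i" "\<bar>site i - site i\<bar> < 2 * rad i"
  using rad_pos by auto

lemma ret_window: "\<bar>t - site i\<bar> < rad i \<Longrightarrow> \<bar>ret i t - site i\<bar> < 2 * rad i"
  using slope[of i] rad_pos[of i] by (auto simp: ret_def)

lemma bump_nonzero: "bump i t \<noteq> 0 \<Longrightarrow> i \<in> I \<and> \<bar>t - site i\<bar> < rad i"
  using rad_pos[of i] by (auto simp: bump_def height_def max_def divide_le_eq split: if_splits)

text \<open>By \<open>fin\<close> only finitely many towers have period at most K, so the periods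
  tend to infinity along \<open>I\<close>.\<close>

lemma height_tendsto_0: "height \<longlonglongrightarrow> 0"
proof (rule LIMSEQ_I)
  fix e :: real assume e: "e > 0"
  have "(\<lambda>k. 2 * (1 / 4 :: real) ^ k) \<longlonglongrightarrow> 2 * 0"
    by (intro tendsto_intros LIMSEQ_power_zero) auto
  then obtain K where K: "\<And>k. k \<ge> K \<Longrightarrow> 2 * (1 / 4 :: real) ^ k < e"
    using e LIMSEQ_D[of "\<lambda>k. 2 * (1 / 4 :: real) ^ k" 0 e] by auto
  have "finite (\<Union>k\<le>K. {i \<in> I. per i = k})" using fin by blast
  then obtain N where N: "\<And>i. i \<in> I \<Longrightarrow> per i \<le> K \<Longrightarrow> i < N"
    by (auto simp: finite_nat_set_iff_bounded)
  have "norm (height i - 0) < e" if "i \<ge> N" for i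
    using N[of i] K[of "per i - 1"] e that by (cases "i \<in> I \<and> per i \<le> K") (auto simp: height_def)
  then show "\<exists>N. \<forall>i\<ge>N. norm (height i - 0) < e" by blast
qed

lemma height_nonneg: "height i \<ge> 0" by (simp add: height_def)

lemma bump_bound: "\<bar>bump i t\<bar> \<le> height i"
proof -
  have "\<bar>max 0 (1 - \<bar>t - site i\<bar> / rad i)\<bar> \<le> 1" using rad_pos[of i] by simp
  then show ?thesis
    using mult_left_le[of "\<bar>max 0 (1 - \<bar>t - site i\<bar> / rad i)\<bar>" "height i"] height_nonneg[of i]
    by (simp add: bump_def abs_mult)
qed

lemma continuous_on_bump: "continuous_on UNIV (bump i)"
  using rad_pos[of i] unfolding bump_def by (intro continuous_intros) auto

lemma bump_disjoint: "bump i t \<noteq> 0 \<Longrightarrow> bump j t \<noteq> 0 \<Longrightarrow> i = j"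
  using window_disjoint'[of t i j] bump_nonzero[of i t] bump_nonzero[of j t] rad_pos[of j] by auto

text \<open>In the outer half of the doubled window this value is 0: an orbit stretched out of its
  window is killed at its return.\<close>

lemma weight_window:
  assumes "\<bar>t - site i\<bar> < 2 * rad i"
  shows "weight t = bump i t"
proof -
  have "bump j t = 0" if "j \<noteq> i" for j
    using bump_nonzero[of j t] window_disjoint'[of t j i] assms that by blast
  then have "(suminf (\<lambda>j. bump j t)) = bump i t"
    using suminf_finite[of "{i}" "\<lambda>j. bump j t"] by auto
  then show ?thesis using window_range[OF assms] by (simp add: weight_def plateau_def)
qed

lemma weight_low:
  assumes "\<bar>t\<bar> \<le> 5 / 4"
  shows "weight t = plateau t"
proof -
  have "bump j t = 0" for j
    using bump_nonzero[of j t] window_range(1)[of t j] rad_pos[of j] assms by fastforce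
  then show ?thesis by (simp add: weight_def)
qed

lemma weight_nonzero:
  assumes "weight t \<noteq> 0"
  shows "\<bar>t\<bar> < 1 \<or> (\<exists>i\<in>I. \<bar>t - site i\<bar> < rad i)"
proof (rule ccontr)
  assume neg: "\<not> ?thesis"
  then have "bump j t = 0" for j using bump_nonzero[of j t] by blast
  then show False using assms neg by (simp add: weight_def plateau_def)
qed

lemma weight_nonneg: "weight t \<ge> 0"
proof -
  have "(suminf (\<lambda>i. bump i t)) \<ge> 0"
  proof (cases "\<exists>j. bump j t \<noteq> 0")
    case True
    then obtain j where j: "bump j t \<noteq> 0" by blast
    then have "bump i t = 0" if "i \<noteq> j" for i using bump_disjoint[of i t j] that by blast
    then have "(suminf (\<lambda>i. bump i t)) = bump j t" using suminf_finite[of "{j}" "\<lambda>i. bump i t"] by auto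
    then show ?thesis using height_nonneg[of j] by (simp add: bump_def)
  qed auto
  then show ?thesis by (simp add: weight_def plateau_def)
qed

lemma step_low: "\<bar>t\<bar> \<le> 1 \<Longrightarrow> step t = 2 * t"
  by (simp add: step_def)

lemma step_window:
  assumes "\<bar>t - site i\<bar> < rad i"
  shows "step t = ret i t / 2 ^ (per i - 1)"
proof -
  have "\<bar>t - site i\<bar> < 2 * rad i" using assms rad_pos[of i] by simp
  note r = window_range[OF this]
  have "(THE i. \<bar>t - site i\<bar> < rad i) = i"
  proof (rule the_equality)
    show "\<bar>t - site i\<bar> < rad i" by (rule assms)
    show "j = i" if "\<bar>t - site j\<bar> < rad j" for j
      using window_disjoint'[OF that, of i] assms rad_pos[of i] by simp
  qed
  then show ?thesis using r assms by (auto simp: step_def)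
qed

lemma compact_supp_weight: "compact_supp weight"
proof -
  have "continuous_on UNIV weight"
    unfolding weight_def plateau_def
    by (intro continuous_intros continuous_on_disjoint_series[OF continuous_on_bump bump_disjoint bump_bound height_tendsto_0])
  moreover have "weight t = 0" if big: "2 < \<bar>t\<bar>" for t
  proof (rule ccontr)
    assume "weight t \<noteq> 0"
    then obtain i where "\<bar>t - site i\<bar> < rad i" using weight_nonzero[of t] big by auto
    then have "\<bar>t - site i\<bar> < 2 * rad i" using rad_pos[of i] by simp
    from window_range[OF this] big show False by simp
  qed
  ultimately show ?thesis by (auto simp: compact_supp_def)
qed

lemma ret_div_bound:
  assumes "\<bar>t - site i\<bar> < rad i"
  shows "\<bar>ret i t / 2 ^ k\<bar> \<le> 2"
proof -
  have "\<bar>ret i t\<bar> \<le> 2" using window_range[OF ret_window[OF assms]] by simp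
  also have "2 \<le> 2 * (2::real) ^ k" by simp
  finally show ?thesis by (simp add: field_simps)
qed

text \<open>The right-hand side is continuous term by term, while \<open>step\<close> is
  not.\<close>

lemma weight_step_eq:
  "weight t * step t = 2 * t * plateau t + (suminf (\<lambda>i. bump i t * (ret i t / 2 ^ (per i - 1))))"
proof (cases "\<exists>i. bump i t \<noteq> 0")
  case True
  then obtain i where i: "bump i t \<noteq> 0" by blast
  then have win: "\<bar>t - site i\<bar> < rad i" using bump_nonzero by blast
  then have win2: "\<bar>t - site i\<bar> < 2 * rad i" using rad_pos[of i] by simp
  have "bump j t = 0" if "j \<noteq> i" for j using bump_disjoint[OF i, of j] that by blast
  then have "(suminf (\<lambda>i. bump i t * (ret i t / 2 ^ (per i - 1)))) = bump i t * (ret i t / 2 ^ (per i - 1))"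
    using suminf_finite[of "{i}" "\<lambda>i. bump i t * (ret i t / 2 ^ (per i - 1))"] by auto
  moreover have "plateau t = 0" using window_range[OF win2] by (simp add: plateau_def)
  ultimately show ?thesis by (simp add: weight_window[OF win2] step_window[OF win])
next
  case False
  then have "weight t = plateau t" by (simp add: weight_def)
  then show ?thesis using False step_low[of t] by (cases "\<bar>t\<bar> \<le> 1") (auto simp: plateau_def)
qed

lemma compact_supp_weight_step: "compact_supp (\<lambda>t. weight t * step t)"
proof -
  let ?g = "\<lambda>i t. bump i t * (ret i t / 2 ^ (per i - 1))"
  have "continuous_on UNIV (\<lambda>t. suminf (\<lambda>i. ?g i t))"
  proof (rule continuous_on_disjoint_series[where M = "\<lambda>i. height i * 2"])
    show "continuous_on UNIV (?g i)" for i
      unfolding ret_def by (intro continuous_intros continuous_on_bump) auto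
    show "\<bar>?g i t\<bar> \<le> height i * 2" for i t
    proof (cases "bump i t = 0")
      case False
      then have "\<bar>ret i t / 2 ^ (per i - 1)\<bar> \<le> 2" using bump_nonzero ret_div_bound by blast
      then have "\<bar>bump i t\<bar> * \<bar>ret i t / 2 ^ (per i - 1)\<bar> \<le> height i * 2"
        using bump_bound[of i t] height_nonneg[of i] by (intro mult_mono) auto
      then show ?thesis by (simp add: abs_mult)
    qed (simp add: height_nonneg)
    show "(\<lambda>i. height i * 2) \<longlonglongrightarrow> 0"
      using tendsto_mult_right[OF height_tendsto_0, of 2] by simp
  qed (use bump_disjoint in auto)
  then have "continuous_on UNIV (\<lambda>t. weight t * step t)"
    unfolding weight_step_eq plateau_def by (intro continuous_intros)
  moreover obtain M where "\<And>t. M < \<bar>t\<bar> \<Longrightarrow> weight t = 0"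
    using compact_supp_weight by (auto simp: compact_supp_def)
  ultimately show ?thesis unfolding compact_supp_def by (metis mult_zero_left)
qed

section \<open>Periodic orbits of nonzero weight\<close>

lemma total_weight_add: "total_weight (j + n) t = total_weight j t * total_weight n ((step ^^ j) t)"
proof -
  have "total_weight (j + n) t = total_weight j t * (\<Prod>k<n. weight ((step ^^ (j + k)) t))"
    unfolding total_weight_def
  proof (induction n)
    case (Suc n)
    then show ?case by (simp add: mult.assoc)
  qed simp
  moreover have "(step ^^ (j + k)) t = (step ^^ k) ((step ^^ j) t)" for k
    by (metis add.commute funpow_add o_apply)
  ultimately show ?thesis by (simp add: total_weight_def)
qed

lemma total_weight_0 [simp]: "total_weight 0 t = 1"
  and total_weight_1 [simp]: "total_weight (Suc 0) t = weight t"
  by (simp_all add: total_weight_def)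

text \<open>Every point that is doubled here is \<open>w / 2 ^ k\<close> with
  \<open>k \<ge> 1\<close>, hence at most 7/8 in absolute value, on the flat part of the
  plateau.\<close>

lemma doubling:
  assumes "\<bar>w\<bar> \<le> 7 / 4" "j \<le> l"
  shows "(step ^^ j) (w / 2 ^ l) = w / 2 ^ (l - j)" "total_weight j (w / 2 ^ l) = 4 ^ j"
proof -
  have "(step ^^ j) (w / 2 ^ l) = w / 2 ^ (l - j) \<and> total_weight j (w / 2 ^ l) = 4 ^ j"
    using assms(2)
  proof (induction j)
    case (Suc j)
    obtain r where r: "l - j = Suc r" using Suc.prems by (metis Suc_diff_Suc Suc_le_lessD)
    have "(2::real) ^ r \<ge> 1" by simp
    then have "\<bar>w\<bar> \<le> 7 / 4 * 2 ^ r" using assms(1) by linarith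
    then have "\<bar>w / 2 ^ (l - j)\<bar> \<le> 7 / 8" by (simp add: r field_simps)
    moreover have "weight z = 4 \<and> step z = 2 * z" if "\<bar>z\<bar> \<le> 7 / 8" for z
      using that by (simp add: weight_low plateau_def step_low)
    ultimately have "weight (w / 2 ^ (l - j)) = 4" "step (w / 2 ^ (l - j)) = 2 * (w / 2 ^ (l - j))"
      by blast+
    moreover have "l - Suc j = r" using r by simp
    ultimately show ?case
      using Suc by (simp add: total_weight_def r)
  qed simp
  then show "(step ^^ j) (w / 2 ^ l) = w / 2 ^ (l - j)" "total_weight j (w / 2 ^ l) = 4 ^ j"
    by auto
qed

text \<open>One throw towards 0 followed by \<open>r - 1\<close> doublings of weight 4.\<close>

lemma excursion:
  assumes i: "i \<in> I" and u: "\<bar>u - site i\<bar> < rad i" and r: "1 \<le> r" "r \<le> per i"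
  shows "(step ^^ r) u = ret i u / 2 ^ (per i - r)" "total_weight r u = bump i u * 4 ^ (r - 1)"
proof -
  obtain q where q: "r = Suc q" using r(1) by (cases r) auto
  have u2: "\<bar>u - site i\<bar> < 2 * rad i" using u rad_pos[of i] by simp
  have w: "\<bar>ret i u\<bar> \<le> 7 / 4" using window_range[OF ret_window[OF u]] by simp
  have "(step ^^ r) u = (step ^^ q) (step u)" by (simp add: q funpow_swap1)
  then show "(step ^^ r) u = ret i u / 2 ^ (per i - r)"
    using doubling(1)[OF w, of q "per i - 1"] r(2) by (simp add: step_window[OF u] q)
  have "total_weight r u = weight u * total_weight q (step u)"
    using total_weight_add[of 1 q u] by (simp add: q)
  then show "total_weight r u = bump i u * 4 ^ (r - 1)"
    using doubling(2)[OF w, of q "per i - 1"] r(2) by (simp add: step_window[OF u] q weight_window[OF u2])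
qed

lemma return:
  assumes "i \<in> I" "\<bar>u - site i\<bar> < rad i"
  shows "(step ^^ per i) u = ret i u"
  using excursion(1)[OF assms per[OF assms(1)] order_refl] by simp

lemma ret_iterate: "(ret i ^^ r) u = site i + slope i ^ r * (u - site i)"
  by (induction r) (auto simp: ret_def)

lemma total_weight_nonzero: "total_weight n t \<noteq> 0 \<Longrightarrow> j < n \<Longrightarrow> weight ((step ^^ j) t) \<noteq> 0"
  by (auto simp: total_weight_def)

text \<open>A return lands in the doubled window and must hit the window itself, since the weight
  would vanish otherwise; so the orbit follows the return map. A power of the return map is affine
  with slope other than 1 and fixes only the site.\<close>

lemma periodic_in_window:
  assumes i: "i \<in> I" and u: "\<bar>u - site i\<bar> < rad i"
    and n: "n \<ge> 1" "(step ^^ n) u = u" "total_weight n u \<noteq> 0"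
  shows "u = site i" "per i dvd n"
proof -
  have iter: "(step ^^ (per i * r)) u = (ret i ^^ r) u \<and> \<bar>(ret i ^^ r) u - site i\<bar> < rad i"
    if "per i * r \<le> n" for r
    using that
  proof (induction r)
    case (Suc r)
    then have IH: "(step ^^ (per i * r)) u = (ret i ^^ r) u" "\<bar>(ret i ^^ r) u - site i\<bar> < rad i" by auto
    have eq: "(step ^^ (per i * Suc r)) u = (ret i ^^ Suc r) u"
      using return[OF i IH(2)] IH(1) by (simp add: funpow_add)
    moreover have "\<bar>(ret i ^^ Suc r) u - site i\<bar> < rad i"
    proof (cases "per i * Suc r = n")
      case True
      then have "(ret i ^^ Suc r) u = u" using eq n(2) by metis
      then show ?thesis using u by simp
    next
      case False
      then have "weight ((ret i ^^ Suc r) u) \<noteq> 0"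
        using total_weight_nonzero[OF n(3), of "per i * Suc r"] eq Suc.prems by simp
      moreover have win: "\<bar>(ret i ^^ Suc r) u - site i\<bar> < 2 * rad i" using ret_window[OF IH(2)] by simp
      ultimately have "bump i ((ret i ^^ Suc r) u) \<noteq> 0" by (simp add: weight_window)
      then show ?thesis using bump_nonzero by blast
    qed
    ultimately show ?case by blast
  qed (use u in simp)
  define q r where "q = n div per i" and "r = n mod per i"
  have nqr: "n = per i * q + r" by (simp add: q_def r_def)
  have rper: "r < per i" using per[OF i] by (simp add: r_def)
  have q: "(step ^^ (per i * q)) u = (ret i ^^ q) u" "\<bar>(ret i ^^ q) u - site i\<bar> < rad i"
    using iter[of q] nqr by auto
  have ru: "(step ^^ r) ((ret i ^^ q) u) = u"
    using n(2) q(1) unfolding nqr by (metis add.commute funpow_add o_apply)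
  \<comment> \<open>An unfinished excursion lies below 7/8, but the window lies above 5/4.\<close>
  have r0: "r = 0"
  proof (rule ccontr)
    assume "r \<noteq> 0"
    let ?w = "ret i ((ret i ^^ q) u)"
    have u54: "5 / 4 < u" using window_range(1)[of u i] u rad_pos[of i] by simp
    have "u = ?w / 2 ^ (per i - r)"
      using excursion(1)[OF i q(2), of r] ru \<open>r \<noteq> 0\<close> rper by simp
    then have "u * 2 ^ (per i - r) = ?w" by (simp add: field_simps)
    moreover have "(2::real) ^ 1 \<le> 2 ^ (per i - r)" using rper by (intro power_increasing) auto
    then have "u * 2 \<le> u * 2 ^ (per i - r)" using u54 by (intro mult_left_mono) auto
    moreover have "?w < 7 / 4" using window_range[OF ret_window[OF q(2)]] by simp
    ultimately show False using u54 by linarith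
  qed
  then show "per i dvd n" using nqr by simp
  have "q \<ge> 1" using n(1) nqr r0 by (cases q) auto
  have "u = site i + slope i ^ q * (u - site i)"
    using ru r0 by (simp add: ret_iterate)
  then have "(1 - slope i ^ q) * (u - site i) = 0" by (simp add: algebra_simps)
  moreover have "slope i ^ q \<noteq> 1"
    using slope[of i] \<open>q \<ge> 1\<close> by (auto simp: power_0_left less_imp_neq[OF one_less_power, symmetric])
  ultimately show "u = site i" by simp
qed

lemma total_weight_shift:
  assumes "(step ^^ n) t = t" "total_weight j t \<noteq> 0"
  shows "total_weight n ((step ^^ j) t) = total_weight n t"
proof -
  have "total_weight j t * total_weight n ((step ^^ j) t) = total_weight n t * total_weight j t"
    using total_weight_add[of j n t] total_weight_add[of n j t] assms(1) by (simp add: add.commute)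
  then show ?thesis using assms(2) by simp
qed

lemma site_fixed:
  assumes "i \<in> I"
  shows "(step ^^ (per i * q)) (site i) = site i"
  using return[OF assms, of "site i"]
  by (induction q) (auto simp: funpow_add ret_def rad_pos)

text \<open>An orbit that stays in (-1, 1) is doubled all the time and must be 0. Any other orbit of
  nonzero weight visits a window, hence passes through its site, and t is found by following it from
  there; \<open>l\<close> counts the doublings left before the site.\<close>

lemma fixed_points:
  assumes n: "n \<ge> 1" "(step ^^ n) t = t" "total_weight n t \<noteq> 0"
  shows "t = 0 \<or> (\<exists>i\<in>I. per i dvd n \<and> (\<exists>l<per i. t = site i / 2 ^ l))"
proof (cases "\<forall>j<n. \<bar>(step ^^ j) t\<bar> < 1")
  case True
  have "(step ^^ j) t = 2 ^ j * t" if "j \<le> n" for j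
    using that
  proof (induction j)
    case (Suc j)
    have "\<bar>(step ^^ j) t\<bar> < 1" using True Suc.prems by (simp add: Suc_le_eq)
    then show ?case using Suc by (simp add: step_low)
  qed simp
  from this[of n] n have "(2 ^ n - 1) * t = 0" by (simp add: algebra_simps)
  moreover have "(2::real) ^ n > 1" using n(1) by (intro one_less_power) auto
  ultimately show ?thesis by auto
next
  case False
  then obtain j where j: "j < n" "\<not> \<bar>(step ^^ j) t\<bar> < 1" by blast
  define u where "u = (step ^^ j) t"
  obtain i where i: "i \<in> I" "\<bar>u - site i\<bar> < rad i"
    using weight_nonzero[OF total_weight_nonzero[OF n(3) j(1)]] j(2) by (auto simp: u_def)
  have "total_weight j t \<noteq> 0" using n(3) j(1) by (auto simp: total_weight_def)
  then have "total_weight n u \<noteq> 0" using total_weight_shift[OF n(2)] n(3) by (simp add: u_def)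
  moreover have "(step ^^ n) u = u"
    unfolding u_def by (metis add.commute funpow_add n(2) o_apply)
  ultimately have u: "u = site i" "per i dvd n"
    using periodic_in_window[OF i n(1)] by blast+
  have "t = (step ^^ (n - j)) u"
    unfolding u_def using j(1) n(2) by (metis funpow_add le_add_diff_inverse2 less_imp_le o_apply)
  also have "\<dots> = (step ^^ ((n - j) mod per i)) ((step ^^ (per i * ((n - j) div per i))) u)"
    by (metis funpow_add mod_mult_div_eq o_apply)
  finally have t: "t = (step ^^ ((n - j) mod per i)) (site i)"
    using site_fixed[OF i(1)] u(1) by simp
  let ?r = "(n - j) mod per i"
  have r: "?r < per i" using per[OF i(1)] by simp
  have "\<exists>l<per i. t = site i / 2 ^ l"
  proof (cases "?r = 0")
    case True
    then show ?thesis using t per[OF i(1)] by (intro exI[of _ 0]) auto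
  next
    case False
    then show ?thesis
      using t excursion(1)[OF i(1), of "site i" ?r] r rad_pos[of i]
      by (intro exI[of _ "per i - ?r"]) (auto simp: ret_def)
  qed
  then show ?thesis using i(1) u(2) by blast
qed

text \<open>The return map at most doubles the distance to the site, so N returns are affordable
  from distance \<open>rad i / 2 ^ N\<close>.\<close>

lemma return_iterate:
  assumes i: "i \<in> I" and s: "\<bar>s - site i\<bar> < rad i / 2 ^ N"
  shows "(step ^^ (per i * N)) s = (ret i ^^ N) s \<and> \<bar>(ret i ^^ N) s - site i\<bar> < rad i"
  using s
proof (induction N)
  case (Suc N)
  have "rad i / 2 ^ Suc N \<le> rad i / 2 ^ N" using rad_pos[of i] by (simp add: field_simps)
  then have IH: "(step ^^ (per i * N)) s = (ret i ^^ N) s" "\<bar>(ret i ^^ N) s - site i\<bar> < rad i"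
    using Suc by auto
  have "(step ^^ (per i * Suc N)) s = (ret i ^^ Suc N) s"
    using return[OF i IH(2)] IH(1) by (simp add: funpow_add)
  moreover have "\<bar>(ret i ^^ Suc N) s - site i\<bar> \<le> 2 ^ Suc N * \<bar>s - site i\<bar>"
    unfolding ret_iterate using slope[of i] by (auto simp: abs_mult)
  moreover have "2 ^ Suc N * \<bar>s - site i\<bar> < rad i"
    using Suc.prems by (simp add: field_simps)
  ultimately show ?case by linarith
qed simp

lemma total_weight_site:
  assumes i: "i \<in> I"
  shows "total_weight (per i * N) (site i) = 2 ^ N"
proof (induction N)
  case (Suc N)
  have "total_weight (per i) (site i) = 2"
    using excursion(2)[OF i _ per[OF i] order_refl, of "site i"] rad_pos[of i] i
    by (simp add: bump_def height_def power_one_over)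
  then show ?case
    using Suc total_weight_add[of "per i" "per i * N" "site i"] site_fixed[OF i, of 1] by simp
qed simp

lemma crossing:
  assumes i: "i \<in> I" and n: "n = per i * N" "n \<ge> 1" and l: "l < per i"
  defines "p \<equiv> site i / 2 ^ l"
  shows "total_weight n p = 2 ^ N"
    and "\<exists>\<epsilon>>0. \<forall>t. \<bar>t - p\<bar> < \<epsilon> \<longrightarrow> (step ^^ n) t = p + slope i ^ N * (t - p)"
proof -
  obtain N' where N': "N = Suc N'" using n by (cases N) auto
  \<comment> \<open>Itinerary of \<open>p\<close>: \<open>l\<close> doublings up to the site,
    \<open>N - 1\<close> full returns, and \<open>per i - l\<close> steps back to \<open>p\<close>.
    The corresponding weights are \<open>4 ^ l\<close>, \<open>2 ^ (N - 1)\<close> and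
    \<open>2 / 4 ^ l\<close>.\<close>
  let ?r = "per i - l"
  have r: "1 \<le> ?r" "?r \<le> per i" using l by auto
  have nsum: "n = l + (per i * N' + ?r)" using n N' l by simp
  have split: "(step ^^ n) t = (step ^^ ?r) ((step ^^ (per i * N')) ((step ^^ l) t))" for t
    unfolding nsum by (metis add.commute funpow_add o_apply)
  have site: "\<bar>site i\<bar> \<le> 7 / 4" using window_range[of "site i" i] rad_pos[of i] by simp
  have "bump i (site i) * 4 ^ (?r - 1) = 2 / 4 ^ l"
  proof -
    obtain k where k: "per i = Suc (l + k)" using l less_imp_Suc_add by blast
    show ?thesis using i by (simp add: bump_def height_def k power_add power_one_over)
  qed
  then show "total_weight n p = 2 ^ N"
    using doubling[OF site order_refl, of l] excursion(2)[OF i _ r, of "site i"] rad_pos[of i]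
    unfolding nsum total_weight_add p_def by (simp add: total_weight_site[OF i] site_fixed[OF i] N')
  show "\<exists>\<epsilon>>0. \<forall>t. \<bar>t - p\<bar> < \<epsilon> \<longrightarrow> (step ^^ n) t = p + slope i ^ N * (t - p)"
  proof (intro exI[of _ "rad i / 2 ^ N' / 2 ^ l"] conjI allI impI)
    show "rad i / 2 ^ N' / 2 ^ l > 0" using rad_pos by simp
    fix t assume t: "\<bar>t - p\<bar> < rad i / 2 ^ N' / 2 ^ l"
    define s where "s = t * 2 ^ l"
    have ts: "t = s / 2 ^ l" by (simp add: s_def)
    have "s - site i = 2 ^ l * (t - p)"
      by (simp add: s_def p_def algebra_simps)
    then have "\<bar>s - site i\<bar> = 2 ^ l * \<bar>t - p\<bar>"
      by (simp add: abs_mult)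
    then have s: "\<bar>s - site i\<bar> < rad i / 2 ^ N'"
      using t by (simp add: field_simps)
    moreover have "rad i / 2 ^ N' \<le> rad i" using rad_pos[of i] by (simp add: divide_le_eq)
    ultimately have "\<bar>s - site i\<bar> < 2 * rad i" using rad_pos[of i] by linarith
    then have s74: "\<bar>s\<bar> \<le> 7 / 4" using window_range[of s i] by simp
    have "(step ^^ l) t = s" using doubling(1)[OF s74 order_refl, of l] by (simp add: ts)
    moreover note ri = return_iterate[OF i s]
    ultimately have "(step ^^ n) t = ret i ((ret i ^^ N') s) / 2 ^ l"
      using excursion(1)[OF i conjunct2[OF ri] r] l by (simp add: split)
    also have "ret i ((ret i ^^ N') s) = (ret i ^^ N) s" by (simp add: N')
    finally show "(step ^^ n) t = p + slope i ^ N * (t - p)"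
      by (simp add: ret_iterate p_def ts field_simps)
  qed
qed

lemma crossing_0:
  shows "total_weight n 0 = 4 ^ n"
    and "\<exists>\<epsilon>>0. \<forall>t. \<bar>t\<bar> < \<epsilon> \<longrightarrow> (step ^^ n) t = 2 ^ n * t"
proof -
  show "total_weight n 0 = 4 ^ n" using doubling(2)[of 0 n n] by simp
  show "\<exists>\<epsilon>>0. \<forall>t. \<bar>t\<bar> < \<epsilon> \<longrightarrow> (step ^^ n) t = 2 ^ n * t"
  proof (intro exI[of _ "1 / 2 ^ n"] conjI allI impI)
    fix t :: real assume "\<bar>t\<bar> < 1 / 2 ^ n"
    then have "\<bar>2 ^ n * t\<bar> \<le> 7 / 4" by (simp add: abs_mult field_simps)
    from doubling(1)[OF this order_refl, of n] show "(step ^^ n) t = 2 ^ n * t" by simp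
  qed simp
qed

lemma total_weight_Suc: "total_weight (Suc n) t = weight t * total_weight n (step t)"
  using total_weight_add[of 1 n t] by simp

text \<open>The function on the right is continuous although \<open>step\<close> jumps, because it
  is \<open>cone_ext g\<close> along the continuous curve (weight t, weight t * step t).\<close>

lemma cone_ext_weight: "cone_ext g (\<lambda>i::nat. if i = 0 then weight t else weight t * step t) = weight t * g (step t)"
  using weight_nonneg[of t] by (auto simp: cone_ext_def max_def)

lemma compact_supp_total_weight:
  shows "compact_supp (total_weight (Suc n))"
    and "compact_supp (\<lambda>t. total_weight (Suc n) t * (step ^^ Suc n) t)"
proof -
  have *: "compact_supp (\<lambda>t. weight t * g (step t))" if "compact_supp g" for g
  proof -
    have "continuous_on UNIV (\<lambda>t. (\<lambda>i::nat. if i = 0 then weight t else weight t * step t))"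
    proof (rule continuous_on_coordinatewise_then_product)
      show "continuous_on UNIV (\<lambda>t. if i = 0 then weight t else weight t * step t)" for i :: nat
        using compact_supp_weight compact_supp_weight_step by (cases "i = 0") (auto simp: compact_supp_def)
    qed
    then have "continuous_on UNIV (\<lambda>t. cone_ext g (\<lambda>i. if i = 0 then weight t else weight t * step t))"
      by (intro continuous_on_compose2[OF continuous_on_cone_ext[OF that, of UNIV]]) auto
    moreover obtain M where "\<And>t. M < \<bar>t\<bar> \<Longrightarrow> weight t = 0"
      using compact_supp_weight by (auto simp: compact_supp_def)
    ultimately show ?thesis unfolding compact_supp_def cone_ext_weight by (metis mult_zero_left)
  qed
  have "compact_supp (total_weight (Suc n)) \<and> compact_supp (\<lambda>t. total_weight (Suc n) t * (step ^^ Suc n) t)"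
  proof (induction n)
    case 0
    have "total_weight (Suc 0) = weight" by (simp add: fun_eq_iff)
    then show ?case using compact_supp_weight compact_supp_weight_step by simp
  next
    case (Suc n)
    have "total_weight (Suc (Suc n)) = (\<lambda>t. weight t * total_weight (Suc n) (step t))"
      by (simp only: fun_eq_iff total_weight_Suc simp_thms)
    moreover have "(\<lambda>t. total_weight (Suc (Suc n)) t * (step ^^ Suc (Suc n)) t)
        = (\<lambda>t. weight t * (total_weight (Suc n) (step t) * (step ^^ Suc n) (step t)))"
      by (simp only: fun_eq_iff total_weight_Suc[of "Suc n"] funpow_Suc_right[of "Suc n"] o_apply mult.assoc simp_thms)
    ultimately show ?case using Suc[THEN conjunct1, THEN *] Suc[THEN conjunct2, THEN *] by simp
  qed
  then show "compact_supp (total_weight (Suc n))"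
    "compact_supp (\<lambda>t. total_weight (Suc n) t * (step ^^ Suc n) t)" by auto
qed

text \<open>All sites lie between 5/4 and 7/4, so their ratios are never a nontrivial power of
  2.\<close>

lemma site_orbits_disjoint:
  assumes "site i / 2 ^ k = site j / 2 ^ l"
  shows "i = j \<and> k = l"
proof -
  have no: False if kl: "k < l" "site i / 2 ^ k = site j / 2 ^ l" for i j k l
  proof -
    obtain r where l: "l = Suc (k + r)" using less_imp_Suc_add[OF kl(1)] by blast
    have "site j = site i * 2 ^ Suc r" using kl(2) by (simp add: l power_add field_simps)
    moreover have "site i * 2 \<le> site i * 2 ^ Suc r"
      using window_range[of "site i" i] rad_pos[of i] by (intro mult_left_mono) auto
    ultimately show False
      using window_range[OF site_window(2), of i] window_range[OF site_window(2), of j] by linarith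
  qed
  have "k = l" using no[of k l i j] no[of l k j i] assms by (metis nat_neq_iff)
  then have "site i = site j" using assms by simp
  then show ?thesis using window_disjoint[of "site i" i j] site_window \<open>k = l\<close> by simp
qed

section \<open>Crossings of the iterates and their signs\<close>

definition crossings :: "nat \<Rightarrow> (nat \<times> nat) set" where
  "crossings n = (SIGMA i : {i \<in> I. per i dvd n}. {..<per i})"

definition crossing_pt :: "nat \<times> nat \<Rightarrow> real" where
  "crossing_pt z = site (fst z) / 2 ^ snd z"

lemma inj_crossing_pt: "inj crossing_pt"
  using site_orbits_disjoint by (fastforce simp: inj_def crossing_pt_def)

lemma crossing_pt_pos: "crossing_pt z > 0"
  using window_range(1)[OF site_window(2), of "fst z"] by (simp add: crossing_pt_def)

lemma finite_periods: "n \<ge> 1 \<Longrightarrow> finite {i \<in> I. per i dvd n}"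
  by (rule finite_subset[of _ "\<Union>k\<le>n. {i \<in> I. per i = k}"]) (auto intro: fin dest: dvd_imp_le)

text \<open>A periodic slope has weight 0 or more than 1, never exactly 1. This gap excludes rays of
  fixed points and is the source of the isolation of the origin for every iterate.\<close>

lemma crossings_iff:
  assumes n: "n \<ge> 1"
  shows "total_weight n t \<noteq> 0 \<and> (step ^^ n) t = t \<longleftrightarrow> t \<in> insert 0 (crossing_pt ` crossings n)" (is "?l \<longleftrightarrow> ?r")
    and "t \<in> insert 0 (crossing_pt ` crossings n) \<Longrightarrow> total_weight n t > 1"
proof -
  have r: "total_weight n t > 1 \<and> (step ^^ n) t = t" if ?r
    using that
  proof
    assume "t = 0"
    then show ?thesis using crossing_0[of n] n by (auto simp: one_less_power)
  next
    assume "t \<in> crossing_pt ` crossings n"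
    then obtain i l where il: "i \<in> I" "per i dvd n" "l < per i" and t: "t = site i / 2 ^ l"
      by (auto simp: crossings_def crossing_pt_def)
    then obtain N where N: "n = per i * N" by (auto simp: dvd_def)
    note c = crossing[OF il(1) N n il(3), folded t]
    have "N \<ge> 1" using n N by (cases N) auto
    then have "total_weight n t > 1" using c(1) by (simp add: one_less_power)
    moreover obtain \<epsilon> where "\<epsilon> > 0" "\<And>s. \<bar>s - t\<bar> < \<epsilon> \<Longrightarrow> (step ^^ n) s = t + slope i ^ N * (s - t)"
      using c(2) by blast
    from this(2)[of t] this(1) have "(step ^^ n) t = t" by simp
    ultimately show ?thesis ..
  qed
  then show "?r \<Longrightarrow> total_weight n t > 1" by blast
  have "?r" if ?l
    using fixed_points[OF n, of t] that by (auto simp: crossings_def crossing_pt_def image_iff)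
  with r show "?l \<longleftrightarrow> ?r" by fastforce
qed

definition crossing_sign :: "real \<Rightarrow> int" where
  "crossing_sign p = (if p = 0 then 1
     else if slope (fst (inv_into UNIV crossing_pt p)) = 2 then 1 else - 1)"

lemma crossing_sign_pt: "crossing_sign (crossing_pt z) = (if slope (fst z) = 2 then 1 else - 1)"
  using crossing_pt_pos[of z] by (simp add: crossing_sign_def inv_f_f[OF inj_crossing_pt])

text \<open>Near \<open>p\<close> the iterate is affine with derivative c, either
  \<open>2 ^ n\<close> or \<open>slope i ^ N\<close>. For slopes 0 and 2 the sign of
  \<open>c - 1\<close> is the same for all \<open>N \<ge> 1\<close>, so the sign can be attached to
  \<open>p\<close> independently of \<open>n\<close>.\<close>

lemma crossing_local:
  assumes n: "n \<ge> 1" and p: "p \<in> insert 0 (crossing_pt ` crossings n)"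
  shows "\<exists>\<epsilon>>0. \<forall>t. 0 < \<bar>t - p\<bar> \<and> \<bar>t - p\<bar> < \<epsilon> \<longrightarrow>
    of_int (crossing_sign p) * (t - p) * (total_weight n t * (step ^^ n) t - total_weight n t * t) > 0"
proof -
  have "\<exists>\<epsilon>>0. \<exists>c. of_int (crossing_sign p) * (c - 1) > 0 \<and> (\<forall>t. \<bar>t - p\<bar> < \<epsilon> \<longrightarrow> (step ^^ n) t = p + c * (t - p))"
    using p
  proof
    assume p: "p = 0"
    have "(2::real) ^ n > 1" using n by (intro one_less_power) auto
    then show ?thesis using crossing_0(2)[of n] p by (auto simp: crossing_sign_def)
  next
    assume "p \<in> crossing_pt ` crossings n"
    then obtain i l where il: "i \<in> I" "per i dvd n" "l < per i" and p: "p = crossing_pt (i, l)"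
      by (auto simp: crossings_def)
    then obtain N where N: "n = per i * N" by (auto simp: dvd_def)
    have "N \<ge> 1" using n N by (cases N) auto
    then have "of_int (crossing_sign p) * (slope i ^ N - 1) > 0"
      using slope[of i] one_less_power[of "2::real" N] by (auto simp: p crossing_sign_pt power_0_left)
    then show ?thesis
      using crossing(2)[OF il(1) N n il(3)] by (auto simp: p crossing_pt_def)
  qed
  then obtain \<epsilon> c where \<epsilon>: "\<epsilon> > 0" and c: "of_int (crossing_sign p) * (c - 1) > 0"
    and eq: "\<And>t. \<bar>t - p\<bar> < \<epsilon> \<Longrightarrow> (step ^^ n) t = p + c * (t - p)" by blast
  obtain n' where n': "n = Suc n'" using n by (cases n) auto
  have "continuous_on UNIV (total_weight n)"
    using compact_supp_total_weight(1)[of n'] by (simp add: n' compact_supp_def)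
  then have "open (total_weight n -` {0<..})" by (intro open_vimage) auto
  moreover have "p \<in> total_weight n -` {0<..}" using crossings_iff(2)[OF n p] by simp
  ultimately obtain \<delta> where \<delta>: "\<delta> > 0" "\<And>t. \<bar>t - p\<bar> < \<delta> \<Longrightarrow> total_weight n t > 0"
    by (auto simp: open_dist dist_real_def)
  show ?thesis
  proof (intro exI[of _ "min \<epsilon> \<delta>"] conjI allI impI)
    show "min \<epsilon> \<delta> > 0" using \<epsilon> \<delta> by simp
    fix t assume t: "0 < \<bar>t - p\<bar> \<and> \<bar>t - p\<bar> < min \<epsilon> \<delta>"
    then have e: "(step ^^ n) t = p + c * (t - p)" using eq[of t] by simp
    have "of_int (crossing_sign p) * (t - p) * (total_weight n t * (step ^^ n) t - total_weight n t * t)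
      = (of_int (crossing_sign p) * (c - 1)) * (total_weight n t * (t - p)\<^sup>2)"
      unfolding e by (simp add: algebra_simps power2_eq_square)
    moreover have "total_weight n t * (t - p)\<^sup>2 > 0" using t \<delta>(2)[of t] by simp
    ultimately show "0 < of_int (crossing_sign p) * (t - p) * (total_weight n t * (step ^^ n) t - total_weight n t * t)"
      using c by (simp only: mult_pos_pos)
  qed
qed

text \<open>The 2 consists of the degree 1 without crossings and the expanding crossing at 0; each
  tower of period dividing n has \<open>per i\<close> crossings of equal sign, one for each point of
  its orbit.\<close>

theorem plane_degree_towers:
  assumes m: "m \<ge> 2" and n: "n \<ge> 1"
  shows "regular_pair (total_weight n) (\<lambda>t. total_weight n t * (step ^^ n) t)"
    and "plane_degree m (total_weight n) (\<lambda>t. total_weight n t * (step ^^ n) t)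
      = 2 + (\<Sum>i | i \<in> I \<and> per i dvd n. int (per i) * (if slope i = 2 then 1 else - 1))"
proof -
  let ?T = "insert 0 (crossing_pt ` crossings n)"
  obtain n' where n': "n = Suc n'" using n by (cases n) auto
  have "(step ^^ n) t \<noteq> t" if "total_weight n t = 1" for t
    using crossings_iff[OF n, of t] that by auto
  then show reg: "regular_pair (total_weight n) (\<lambda>t. total_weight n t * (step ^^ n) t)"
    using compact_supp_total_weight[of n'] by (simp add: regular_pair_def n')
  have fin: "finite (crossings n)" unfolding crossings_def using finite_periods[OF n] by blast
  have "plane_degree m (total_weight n) (\<lambda>t. total_weight n t * (step ^^ n) t) = 1 + (\<Sum>p\<in>?T. crossing_sign p)"
  proof (rule plane_degree_eq_crossings[OF m reg])
    show "{t. 1 < total_weight n t \<and> total_weight n t * (step ^^ n) t = total_weight n t * t} = ?T"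
    proof (intro equalityI subsetI)
      fix t assume "t \<in> ?T"
      then show "t \<in> {t. 1 < total_weight n t \<and> total_weight n t * (step ^^ n) t = total_weight n t * t}"
        using crossings_iff[OF n, of t] by simp
    next
      fix t assume "t \<in> {t. 1 < total_weight n t \<and> total_weight n t * (step ^^ n) t = total_weight n t * t}"
      then have "total_weight n t \<noteq> 0 \<and> (step ^^ n) t = t" by auto
      then show "t \<in> ?T" using crossings_iff(1)[OF n, of t] by blast
    qed
    show "finite ?T" using fin by blast
    show "crossing_sign p \<in> {1, - 1}" for p by (auto simp: crossing_sign_def)
    show "\<exists>\<epsilon>>0. \<forall>t. 0 < \<bar>t - p\<bar> \<and> \<bar>t - p\<bar> < \<epsilon> \<longrightarrow>
      of_int (crossing_sign p) * (t - p) * (total_weight n t * (step ^^ n) t - total_weight n t * t) > 0"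
      if "p \<in> ?T" for p by (rule crossing_local[OF n that])
  qed
  also have "(\<Sum>p\<in>?T. crossing_sign p) = crossing_sign 0 + (\<Sum>p\<in>crossing_pt ` crossings n. crossing_sign p)"
  proof (rule sum.insert)
    show "0 \<notin> crossing_pt ` crossings n" using crossing_pt_pos by (metis imageE less_irrefl)
  qed (use fin in blast)
  also have "(\<Sum>p\<in>crossing_pt ` crossings n. crossing_sign p) = (\<Sum>z\<in>crossings n. if slope (fst z) = 2 then 1 else - 1)"
    using inj_on_subset[OF inj_crossing_pt, of "crossings n"]
    by (subst sum.reindex) (auto simp: crossing_sign_pt)
  also have "\<dots> = (\<Sum>i\<in>{i \<in> I. per i dvd n}. \<Sum>l<per i. if slope i = 2 then 1 else - 1)"
    unfolding crossings_def using finite_periods[OF n]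
    by (subst sum.Sigma) (auto intro!: sum.cong simp: case_prod_beta)
  also have "\<dots> = (\<Sum>i | i \<in> I \<and> per i dvd n. int (per i) * (if slope i = 2 then 1 else - 1))"
    by (intro sum.cong) auto
  finally show "plane_degree m (total_weight n) (\<lambda>t. total_weight n t * (step ^^ n) t)
      = 2 + (\<Sum>i | i \<in> I \<and> per i dvd n. int (per i) * (if slope i = 2 then 1 else - 1))"
    by (simp add: crossing_sign_def)
qed

end

section \<open>The homeomorphism\<close>

lemma direction_scale: "r > 0 \<Longrightarrow> direction m (\<lambda>i. r * w i) = direction m w"
  by (simp add: direction_def fun_eq_iff flip: L2_set_right_distrib)

lemma field_degree_scale: "r > 0 \<Longrightarrow> field_degree m (\<lambda>u i. r * V u i) = field_degree m V"
  by (simp add: field_degree_def direction_scale)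

lemma sphere_degree_eq_field_degree:
  assumes "r > 0" "\<And>u i. g (\<lambda>i. p i + r * u i) i = r * V u i"
  shows "sphere_degree m g p r = field_degree m V"
proof -
  have "g (\<lambda>i. p i + r * u i) = (\<lambda>i. r * V u i)" for u using assms(2) by blast
  then show ?thesis
    using assms(1) by (simp add: sphere_degree_def field_degree_def direction_scale)
qed

section \<open>The swap as the model of orientation reversal\<close>

definition swap12 :: "(nat \<Rightarrow> real) \<Rightarrow> nat \<Rightarrow> real" where
  "swap12 v = (\<lambda>i. if i = 1 then v 2 else if i = 2 then v 1 else v i)"

lemma sphere_pts_nonzero: "m \<ge> 1 \<Longrightarrow> u \<in> sphere_pts m \<Longrightarrow> \<exists>i. u i \<noteq> 0"
  by (rule ccontr) (simp add: sphere_pts_iff)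

text \<open>The reflections in the hyperplanes orthogonal to \<open>(1 - s) e\<^sub>0 + s (e\<^sub>1 - e\<^sub>2)\<close> lead from the reflection
  of the first coordinate to the swap.\<close>

lemma field_degree_swap12:
  assumes m: "m \<ge> 3"
  shows "field_degree m swap12 = - 1"
proof -
  define a :: "real \<Rightarrow> nat \<Rightarrow> real" where
    "a s = (\<lambda>i. if i = 0 then 1 - s else if i = 1 then s else if i = 2 then - s else 0)" for s
  \<comment> \<open>\<open>N s\<close> is the squared length of \<open>a s\<close> and
    \<open>k s u\<close> the inner product of \<open>a s\<close> with \<open>u\<close>.\<close>
  define N :: "real \<Rightarrow> real" where "N s = (1 - s)\<^sup>2 + 2 * s\<^sup>2" for s
  define k :: "real \<Rightarrow> (nat \<Rightarrow> real) \<Rightarrow> real" where "k s u = (1 - s) * u 0 + s * (u 1 - u 2)" for s u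
  define H :: "real \<Rightarrow> (nat \<Rightarrow> real) \<Rightarrow> nat \<Rightarrow> real" where "H s u = (\<lambda>i. u i - 2 * k s u / N s * a s i)" for s u
  have N: "N s > 0" for s
    by (cases "s = 0") (auto simp: N_def intro: add_nonneg_pos)
  have "field_degree m (H 0) = field_degree m (H 1)"
  proof (rule field_degree_homotopy)
    show "continuous_on ({0..1} \<times> sphere_pts m) (\<lambda>z. H (fst z) (snd z))"
    proof (rule continuous_on_coordinatewise_then_product)
      have "continuous_on A (\<lambda>z. a (fst z) i)" for A :: "(real \<times> (nat \<Rightarrow> real)) set" and i
        unfolding a_def by (cases "i = 0"; cases "i = 1"; cases "i = 2"; simp; intro continuous_intros)
      moreover have "continuous_on A (\<lambda>z. k (fst z) (snd z))" for A :: "(real \<times> (nat \<Rightarrow> real)) set"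
        unfolding k_def by (intro continuous_intros continuous_on_snd_coord)
      moreover have "continuous_on A (\<lambda>z. N (fst z))" for A :: "(real \<times> (nat \<Rightarrow> real)) set"
        unfolding N_def by (intro continuous_intros)
      ultimately show "continuous_on ({0..1} \<times> sphere_pts m) (\<lambda>z. H (fst z) (snd z) i)" for i
        unfolding H_def using N by (intro continuous_intros continuous_on_snd_coord) (auto simp: less_imp_neq[symmetric])
    qed
    show "H s u \<in> topspace (Euclidean_space m)" if "u \<in> sphere_pts m" for s u
      using that m by (auto simp: H_def a_def topspace_Euclidean_space sphere_pts_iff)
    show "H s u \<noteq> (\<lambda>_. 0)" if u: "u \<in> sphere_pts m" for s u
    proof
      assume "H s u = (\<lambda>_. 0)"
      then have ui: "u i = 2 * k s u / N s * a s i" for i by (simp add: H_def fun_eq_iff)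
      define q where "q = 2 * k s u / N s"
      have uq: "u i = q * a s i" for i using ui by (simp add: q_def)
      have "k s u = q * ((1 - s) * a s 0 + s * (a s 1 - a s 2))"
        unfolding k_def uq by (simp add: algebra_simps)
      also have "(1 - s) * a s 0 + s * (a s 1 - a s 2) = N s"
        by (simp add: a_def N_def power2_eq_square)
      finally have "k s u = 0" using N[of s] by (simp add: q_def)
      then have "u i = 0" for i using ui[of i] by simp
      then show False using sphere_pts_nonzero[OF _ u] m by auto
    qed
  qed (use m in auto)
  moreover have "H 0 = (\<lambda>u i. if i = 0 then - u i else u i)"
    by (auto simp: H_def k_def N_def a_def fun_eq_iff)
  moreover have "H 1 = swap12"
    by (auto simp: H_def k_def N_def a_def fun_eq_iff swap12_def diff_divide_distrib)
  ultimately show ?thesis using field_degree_reflection[of m] m by simp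
qed

text \<open>An odd homeomorphism of the line, homogeneous of degree 2: negligible at 0 against the
  leading term, yet injective.\<close>

definition sq :: "real \<Rightarrow> real" where "sq t = t * \<bar>t\<bar>"

lemma sq_strict_mono: "strict_mono sq"
proof (rule strict_monoI)
  fix x y :: real assume "x < y"
  consider "0 \<le> x" | "x < 0" "0 \<le> y" | "y < 0" by linarith
  then show "sq x < sq y"
  proof cases
    case 1
    then show ?thesis using \<open>x < y\<close> by (simp add: sq_def mult_strict_mono)
  next
    case 2
    then have "sq x < 0" "0 \<le> sq y" by (auto simp: sq_def mult_neg_pos mult_neg_neg)
    then show ?thesis by simp
  next
    case 3
    then have "y * y < x * x" using \<open>x < y\<close> mult_strict_mono[of "- y" "- x" "- y" "- x"] by simp
    then show ?thesis using 3 \<open>x < y\<close> by (simp add: sq_def)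
  qed
qed

lemma sq_surj: "\<exists>x. sq x = y"
  by (rule exI[of _ "sgn y * sqrt \<bar>y\<bar>"]) (simp add: sq_def abs_mult sgn_if)

lemma sq_0 [simp]: "sq 0 = 0" by (simp add: sq_def)

lemma sq_scale: "s \<ge> 0 \<Longrightarrow> sq (s * x) = s * (s * sq x)"
  by (simp add: sq_def abs_mult)

lemma cone_ext_scale: "s > 0 \<Longrightarrow> cone_ext g (\<lambda>i. s * v i) = s * cone_ext g v"
  by (simp add: cone_ext_def max_mult_distrib_left)

definition pnorm :: "(nat \<Rightarrow> real) \<Rightarrow> real" where "pnorm v = \<bar>v 0\<bar> + \<bar>v 1\<bar>"

context towers
begin

text \<open>Homogeneous of degree 1 for \<open>s = 0\<close>, and \<open>tower_map s\<close> is \<open>tower_map 1\<close> seen at scale \<open>s\<close>. For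
  \<open>s > 0\<close> the second order terms make it a homeomorphism.\<close>

definition tower_map :: "real \<Rightarrow> (nat \<Rightarrow> real) \<Rightarrow> nat \<Rightarrow> real" where
  "tower_map s v = (\<lambda>i. if i = 0 then s * (pnorm v * v 0) + cone_ext weight v
     else if i = 1 then cone_ext (\<lambda>t. weight t * step t) v + s * sq (v 2)
     else if i = 2 then s * (pnorm v * v 1) + cone_ext (\<lambda>t. weight t * t) v
     else s * sq (v i))"

lemma compact_supp_weight_id: "compact_supp (\<lambda>t. weight t * t)"
  using compact_supp_mult[OF compact_supp_weight continuous_on_id] by (simp add: mult.commute)

lemma continuous_on_tower_map: "continuous_on A (\<lambda>z. tower_map (fst z) (snd z))"
proof (rule continuous_on_coordinatewise_then_product)
  have "continuous_on A (\<lambda>z. cone_ext g (snd z))" if "compact_supp g" for g and A :: "(real \<times> (nat \<Rightarrow> real)) set"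
    by (rule continuous_on_compose2[OF continuous_on_cone_ext[OF that, of UNIV]]) (auto intro: continuous_intros)
  note cts = this[OF compact_supp_weight] this[OF compact_supp_weight_step] this[OF compact_supp_weight_id]
  show "continuous_on A (\<lambda>z. tower_map (fst z) (snd z) i)" for i
    unfolding tower_map_def pnorm_def sq_def
    by (cases "i = 0"; cases "i = 1"; cases "i = 2"; simp; intro continuous_intros continuous_on_snd_coord cts)
qed

lemma tower_map_Euclidean_space:
  "m \<ge> 3 \<Longrightarrow> v \<in> topspace (Euclidean_space m) \<Longrightarrow> tower_map s v \<in> topspace (Euclidean_space m)"
  by (auto simp: tower_map_def topspace_Euclidean_space)

lemma tower_map_iterate_Euclidean_space:
  "m \<ge> 3 \<Longrightarrow> v \<in> topspace (Euclidean_space m) \<Longrightarrow> (tower_map s ^^ n) v \<in> topspace (Euclidean_space m)"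
  by (induction n) (auto intro: tower_map_Euclidean_space)

lemma continuous_on_tower_map_iterate:
  "continuous_on A (\<lambda>z. (tower_map (fst z) ^^ n) (snd z))"
proof (induction n)
  case (Suc n)
  have "continuous_on A (\<lambda>z. (\<lambda>z. tower_map (fst z) (snd z)) (fst z, (tower_map (fst z) ^^ n) (snd z)))"
    by (rule continuous_on_compose2[OF continuous_on_tower_map[of UNIV]]) (auto intro!: continuous_intros Suc)
  then show ?case by simp
qed (auto intro: continuous_intros)

lemma tower_map_rescale: "s > 0 \<Longrightarrow> tower_map 1 (\<lambda>i. s * v i) = (\<lambda>i. s * tower_map s v i)"
  by (simp add: tower_map_def fun_eq_iff cone_ext_scale sq_scale pnorm_def abs_mult algebra_simps)

lemma tower_map_iterate_rescale: "s > 0 \<Longrightarrow> (tower_map 1 ^^ n) (\<lambda>i. s * v i) = (\<lambda>i. s * (tower_map s ^^ n) v i)"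
  by (induction n) (simp_all add: tower_map_rescale)

lemma total_weight_nonneg: "total_weight n t \<ge> 0"
  by (simp add: total_weight_def prod_nonneg weight_nonneg)

text \<open>For \<open>s = 0\<close> coordinate 2 is written but never read, so coordinates 0 and 1
  are a planar system: weights multiply along the orbit of the slope.\<close>

lemma tower_map_0_iterate:
  shows "(tower_map 0 ^^ Suc n) v 0 = cone_ext (total_weight (Suc n)) v"
    and "(tower_map 0 ^^ Suc n) v 1 = cone_ext (\<lambda>t. total_weight (Suc n) t * (step ^^ Suc n) t) v"
    and "i \<ge> 3 \<Longrightarrow> (tower_map 0 ^^ Suc n) v i = 0"
proof -
  have "(tower_map 0 ^^ Suc n) v 0 = cone_ext (total_weight (Suc n)) v \<and>
    (tower_map 0 ^^ Suc n) v 1 = cone_ext (\<lambda>t. total_weight (Suc n) t * (step ^^ Suc n) t) v"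
  proof (induction n)
    case 0
    show ?case by (simp add: tower_map_def cone_ext_def)
  next
    case (Suc n)
    define w where "w = (tower_map 0 ^^ Suc n) v"
    define t where "t = v 1 / v 0"
    have w: "w 0 = max 0 (v 0) * total_weight (Suc n) t" "w 1 = w 0 * (step ^^ Suc n) t"
      using Suc by (simp_all add: w_def cone_ext_def t_def mult.assoc)
    have "w 0 \<ge> 0" using w total_weight_nonneg[of "Suc n" t] by simp
    then have g: "cone_ext g w = w 0 * g ((step ^^ Suc n) t)" for g
      using w(2) by (cases "w 0 = 0") (auto simp: cone_ext_def)
    have tw: "total_weight (Suc (Suc n)) t = total_weight (Suc n) t * weight ((step ^^ Suc n) t)"
      by (simp add: total_weight_def)
    have "tower_map 0 w 0 = cone_ext weight w" "tower_map 0 w 1 = cone_ext (\<lambda>t. weight t * step t) w"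
      by (simp_all add: tower_map_def)
    moreover have "(tower_map 0 ^^ Suc (Suc n)) v = tower_map 0 w" by (simp add: w_def)
    moreover have "cone_ext h v = max 0 (v 0) * h t" for h by (simp add: cone_ext_def t_def)
    moreover have "(step ^^ Suc (Suc n)) t = step ((step ^^ Suc n) t)" by simp
    ultimately show ?case by (simp only: w(1) tw g mult.assoc)
  qed
  then show "(tower_map 0 ^^ Suc n) v 0 = cone_ext (total_weight (Suc n)) v"
    "(tower_map 0 ^^ Suc n) v 1 = cone_ext (\<lambda>t. total_weight (Suc n) t * (step ^^ Suc n) t) v" by auto
  show "i \<ge> 3 \<Longrightarrow> (tower_map 0 ^^ Suc n) v i = 0" by (simp add: tower_map_def)
qed

lemma tower_map_0_iterate_axis:
  assumes "v 0 = 0"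
  shows "(tower_map 0 ^^ Suc n) v = (\<lambda>_. 0)"
proof -
  have 0: "tower_map 0 u = (\<lambda>_. 0)" if "u 0 = 0" for u
    using that by (simp add: tower_map_def cone_ext_def fun_eq_iff)
  show ?thesis by (induction n) (simp_all add: 0 assms)
qed

text \<open>For \<open>s > 0\<close> this is the displacement of the iterate of
  \<open>tower_map 1\<close> at the point \<open>s * u\<close>, divided by \<open>s\<close>;
  \<open>s = 0\<close> is the homogeneous limit.\<close>

definition defect :: "nat \<Rightarrow> real \<Rightarrow> (nat \<Rightarrow> real) \<Rightarrow> nat \<Rightarrow> real" where
  "defect n s u = (\<lambda>i. u i - (tower_map s ^^ n) u i)"

lemma continuous_on_defect: "continuous_on A (\<lambda>z. defect n (fst z) (snd z))"
proof (rule continuous_on_coordinatewise_then_product)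
  show "continuous_on A (\<lambda>z. defect n (fst z) (snd z) i)" for i
    unfolding defect_def
    by (intro continuous_on_diff continuous_on_snd_coord
        continuous_on_product_then_coordinatewise[OF continuous_on_tower_map_iterate])
qed

text \<open>Coordinates 0 and 1 alone lead to a ray of fixed slope and weight 1, or else to
  \<open>u = 0\<close>. The arbitrary factors \<open>k\<close> leave room for a homotopy in the
  remaining coordinates.\<close>

lemma no_homogeneous_fixed_point:
  assumes m: "m \<ge> 3" and n: "n \<ge> 1" and u: "u \<in> sphere_pts m"
    and 0: "u 0 = (tower_map 0 ^^ n) u 0" and 1: "u 1 = (tower_map 0 ^^ n) u 1"
    and i: "\<And>i. i \<ge> 2 \<Longrightarrow> u i = k i * (tower_map 0 ^^ n) u i"
  shows False
proof -
  obtain n' where n': "n = Suc n'" using n by (cases n) auto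
  note F = tower_map_0_iterate[where n = n' and v = u, folded n']
  show False
  proof (cases "u 0 > 0")
    case True
    define t where "t = u 1 / u 0"
    have "u 0 = u 0 * total_weight n t" "u 1 = u 0 * (total_weight n t * (step ^^ n) t)"
      using 0 1 F True by (simp_all add: cone_ext_def t_def)
    then have "total_weight n t = 1" "total_weight n t * (step ^^ n) t = t"
      using True by (simp_all add: t_def field_simps)
    then show False
      using regular_pairD(5)[OF plane_degree_towers(1)[OF _ n, of m]] m by fastforce
  next
    case False
    then have "cone_ext (total_weight n) u = 0" by (simp add: cone_ext_def max_def)
    then have "u 0 = 0" using 0 F(1) by simp
    then have z: "(tower_map 0 ^^ n) u = (\<lambda>_. 0)" using tower_map_0_iterate_axis n' by blast
    have "u i = 0" for i
      using 1 i[of i] \<open>u 0 = 0\<close> z by (cases "i = 0"; cases "i = 1") auto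
    then show False using sphere_pts_nonzero[OF _ u] m by auto
  qed
qed

text \<open>The coordinates of the iterate from 2 on are scaled away by \<open>1 - s\<close>; no
  zero appears, since coordinates 0 and 1 already prevent it.\<close>

lemma field_degree_defect_0:
  assumes m: "m \<ge> 3" and n: "n \<ge> 1"
  shows "field_degree m (defect n 0) = plane_degree m (total_weight n) (\<lambda>t. total_weight n t * (step ^^ n) t)"
proof -
  obtain n' where n': "n = Suc n'" using n by (cases n) auto
  define k :: "real \<Rightarrow> nat \<Rightarrow> real" where "k s i = (if i < 2 then 1 else 1 - s)" for s i
  define H where "H s u = (\<lambda>i. u i - k s i * (tower_map 0 ^^ n) u i)" for s u
  have "field_degree m (H 0) = field_degree m (H 1)"
  proof (rule field_degree_homotopy)
    have c: "continuous_on A (\<lambda>z. (tower_map 0 ^^ n) (snd z) i)" for A :: "(real \<times> (nat \<Rightarrow> real)) set" and i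
    proof (rule continuous_on_product_then_coordinatewise)
      have "continuous_on A (\<lambda>z. (\<lambda>z. (tower_map (fst z) ^^ n) (snd z)) (0, snd z))"
        by (rule continuous_on_compose2[OF continuous_on_tower_map_iterate[of UNIV n]])
          (auto intro!: continuous_on_Pair continuous_on_snd continuous_on_id)
      then show "continuous_on A (\<lambda>z. (tower_map 0 ^^ n) (snd z))" by simp
    qed
    show "continuous_on ({0..1} \<times> sphere_pts m) (\<lambda>z. H (fst z) (snd z))"
    proof (rule continuous_on_coordinatewise_then_product)
      show "continuous_on ({0..1} \<times> sphere_pts m) (\<lambda>z. H (fst z) (snd z) i)" for i
        unfolding H_def k_def by (cases "i < 2"; simp; intro continuous_intros continuous_on_snd_coord c)
    qed
    show "H s u \<in> topspace (Euclidean_space m)" if "u \<in> sphere_pts m" for s u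
    proof -
      have "u \<in> topspace (Euclidean_space m)"
        using that m by (auto simp: topspace_Euclidean_space sphere_pts_iff)
      with tower_map_iterate_Euclidean_space[OF m this, where s = 0 and n = n] show ?thesis
        by (auto simp: H_def topspace_Euclidean_space)
    qed
    show "H s u \<noteq> (\<lambda>_. 0)" if u: "u \<in> sphere_pts m" for s u
    proof
      assume "H s u = (\<lambda>_. 0)"
      then have ui: "u i = k s i * (tower_map 0 ^^ n) u i" for i by (simp add: H_def fun_eq_iff)
      have "u 0 = (tower_map 0 ^^ n) u 0" "u 1 = (tower_map 0 ^^ n) u 1"
        using ui[of 0] ui[of 1] by (simp_all only: k_def) simp_all
      then show False
        using no_homogeneous_fixed_point[OF m n u, of "k s"] ui by blast
    qed
  qed (use m in auto)
  moreover have "H 0 = defect n 0" by (auto simp: H_def k_def defect_def fun_eq_iff)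
  moreover have "H 1 = plane_field (cone_ext (total_weight n)) (cone_ext (\<lambda>t. total_weight n t * (step ^^ n) t))"
  proof (intro ext)
    fix u and i :: nat
    consider "i = 0" | "i = 1" | "i \<ge> 2" by linarith
    then show "H 1 u i = plane_field (cone_ext (total_weight n)) (cone_ext (\<lambda>t. total_weight n t * (step ^^ n) t)) u i"
    proof cases
      case 1
      then show ?thesis
        using tower_map_0_iterate(1)[of n' u] by (simp only: H_def k_def plane_field_def n') simp
    next
      case 2
      then show ?thesis
        using tower_map_0_iterate(2)[of n' u] by (simp only: H_def k_def plane_field_def n') simp
    next
      case 3
      then show ?thesis by (simp add: H_def k_def plane_field_def)
    qed
  qed
  ultimately show ?thesis by (simp add: plane_degree_def)
qed

text \<open>Compactness of the sphere: the homogeneous limit has no fixed points on it, so neither do the nearby scales.\<close>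

lemma defect_nonzero_small:
  assumes m: "m \<ge> 3" and n: "n \<ge> 1"
  obtains e where "e > 0" "\<And>s u. 0 \<le> s \<Longrightarrow> s < e \<Longrightarrow> u \<in> sphere_pts m \<Longrightarrow> defect n s u \<noteq> (\<lambda>_. 0)"
proof -
  define Z where "Z = ({0..1::real} \<times> sphere_pts m) \<inter> {z. \<forall>i. defect n (fst z) (snd z) i = 0}"
  have comp: "compact ({0..1::real} \<times> sphere_pts m)"
    using compact_sphere_pts[of m] m by (intro compact_Times) auto
  have "closed {z :: real \<times> (nat \<Rightarrow> real). \<forall>i. defect n (fst z) (snd z) i = 0}"
    by (intro closed_Collect_all closed_Collect_eq continuous_on_const
        continuous_on_product_then_coordinatewise[OF continuous_on_defect])
  then have "compact Z"
    unfolding Z_def by (rule compact_Int_closed[OF comp])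
  then have "compact (fst ` Z)" by (intro compact_continuous_image continuous_intros)
  then have "open (- (fst ` Z))" using compact_imp_closed by blast
  moreover have "0 \<notin> fst ` Z"
  proof
    assume "0 \<in> fst ` Z"
    then obtain u where u: "u \<in> sphere_pts m" "\<And>i. defect n 0 u i = 0" by (auto simp: Z_def)
    then have "u i = (tower_map 0 ^^ n) u i" for i by (simp add: defect_def)
    then show False using no_homogeneous_fixed_point[OF m n u(1), of "\<lambda>_. 1"] by simp
  qed
  ultimately obtain e where "e > 0" "ball 0 e \<subseteq> - (fst ` Z)"
    by (metis ComplI open_contains_ball)
  then have e: "e > 0" "\<And>s. \<bar>s\<bar> < e \<Longrightarrow> s \<notin> fst ` Z"
    by (auto simp: subset_iff)
  show thesis
  proof (rule that[of "min e 1"])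
    show "defect n s u \<noteq> (\<lambda>_. 0)" if "0 \<le> s" "s < min e 1" "u \<in> sphere_pts m" for s u
    proof
      assume "defect n s u = (\<lambda>_. 0)"
      then have "(s, u) \<in> Z" using that by (simp add: Z_def)
      then have "s \<in> fst ` Z" by (rule image_eqI[rotated]) simp
      moreover have "\<bar>s\<bar> < e" using that by simp
      ultimately show False using e(2) by blast
    qed
  qed (use e in simp)
qed

end

section \<open>Isolation and index at the origin\<close>

lemma openin_L2_ball:
  "openin (Euclidean_space m) {v \<in> topspace (Euclidean_space m). L2_set v {..<m} < e}"
proof -
  have "open {v::nat \<Rightarrow> real. sqrt (\<Sum>i<m. (v i)\<^sup>2) < e}"
    by (intro open_Collect_less continuous_on_real_sqrt continuous_on_sum continuous_on_power
        continuous_on_const continuous_on_coord)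
  then have "openin (top_of_set (topspace (Euclidean_space m)))
      (topspace (Euclidean_space m) \<inter> {v. sqrt (\<Sum>i<m. (v i)\<^sup>2) < e})"
    by (rule openin_open_Int)
  then show ?thesis
    by (subst Euclidean_space_eq) (simp add: L2_set_def Int_def)
qed

lemma polar_decomposition:
  assumes v: "v \<in> topspace (Euclidean_space m)" "v \<noteq> (\<lambda>_. 0)" and m: "m \<ge> 1"
  obtains s u where "s = L2_set v {..<m}" "s > 0" "u \<in> sphere_pts m" "v = (\<lambda>i. s * u i)"
proof -
  define s where "s = L2_set v {..<m}"
  have s: "s > 0"
    using L2_set_eq_0_Euclidean[OF v(1)] v(2) L2_set_nonneg[of v "{..<m}"] by (simp add: s_def less_le)
  have s2: "s\<^sup>2 = (\<Sum>i<m. (v i)\<^sup>2)"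
    by (simp add: s_def L2_set_def sum_nonneg)
  have "(\<lambda>i. v i / s) \<in> sphere_pts m"
    using v(1) s m by (simp add: sphere_pts_iff topspace_Euclidean_space power_divide s2[symmetric] flip: sum_divide_distrib)
  moreover have "v = (\<lambda>i. s * (v i / s))" using s by simp
  ultimately show thesis by (rule that[OF s_def s])
qed

lemma continuous_map_Euclidean_space_iff_on:
  "continuous_map (Euclidean_space m) (Euclidean_space k) f \<longleftrightarrow>
    continuous_on (topspace (Euclidean_space m)) f \<and> (\<forall>v\<in>topspace (Euclidean_space m). f v \<in> topspace (Euclidean_space k))"
  by (subst (1 2) Euclidean_space_eq) (auto simp: continuous_map_iff_continuous)

context towers
begin

abbreviation "tower_homeo \<equiv> tower_map 1"

lemma continuous_on_tower_map_iterate_at: "continuous_on A (tower_map s ^^ n)"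
proof -
  have "continuous_on A (\<lambda>v. (\<lambda>z. (tower_map (fst z) ^^ n) (snd z)) (s, v))"
    by (rule continuous_on_compose2[OF continuous_on_tower_map_iterate[of UNIV n]])
      (auto intro!: continuous_on_Pair continuous_on_const continuous_on_id)
  then show ?thesis by simp
qed

lemma continuous_map_tower_homeo_iterate:
  "m \<ge> 3 \<Longrightarrow> continuous_map (Euclidean_space m) (Euclidean_space m) (tower_homeo ^^ n)"
  by (auto simp: continuous_map_Euclidean_space_iff_on
      intro: continuous_on_tower_map_iterate_at tower_map_iterate_Euclidean_space)

lemma tower_homeo_0: "tower_homeo (\<lambda>_. 0) = (\<lambda>_. 0)"
  by (simp add: tower_map_def cone_ext_def pnorm_def fun_eq_iff)

lemma tower_homeo_iterate_0: "(tower_homeo ^^ n) (\<lambda>_. 0) = (\<lambda>_. 0)"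
  by (induction n) (simp_all add: tower_homeo_0)

lemma isolated_fixed_point_tower_homeo:
  assumes m: "m \<ge> 3" and n: "n \<ge> 1"
  shows "isolated_fixed_point m (tower_homeo ^^ n) (\<lambda>_. 0)"
proof -
  obtain e where e: "e > 0" "\<And>s u. 0 \<le> s \<Longrightarrow> s < e \<Longrightarrow> u \<in> sphere_pts m \<Longrightarrow> defect n s u \<noteq> (\<lambda>_. 0)"
    using defect_nonzero_small[OF m n] by blast
  let ?U = "{v \<in> topspace (Euclidean_space m). L2_set v {..<m} < e}"
  have "v = (\<lambda>_. 0)" if v: "v \<in> ?U" "(tower_homeo ^^ n) v = v" for v
  proof (rule ccontr)
    assume nz: "v \<noteq> (\<lambda>_. 0)"
    obtain s u where su: "s = L2_set v {..<m}" "s > 0" "u \<in> sphere_pts m" "v = (\<lambda>i. s * u i)"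
      using polar_decomposition[of v m] v(1) nz m by auto
    have "(\<lambda>i. s * (tower_map s ^^ n) u i) = (\<lambda>i. s * u i)"
      using v(2) tower_map_iterate_rescale[OF su(2), of n u] by (simp only: su(4))
    then have "defect n s u = (\<lambda>_. 0)"
      using su(2) by (simp add: defect_def fun_eq_iff)
    moreover have "s < e" using su(1) v(1) by simp
    ultimately show False using e(2)[of s u] su(2,3) by simp
  qed
  moreover have "(\<lambda>_. 0) \<in> ?U" using e(1) by (simp add: topspace_Euclidean_space L2_set_def)
  ultimately show ?thesis
    unfolding isolated_fixed_point_def using openin_L2_ball tower_homeo_iterate_0 by blast
qed

text \<open>The sphere of radius r, seen at scale r, is the unit sphere with the field
  \<open>defect n r\<close>. For \<open>r < e\<close> the scale can be lowered to 0 without meeting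
  a zero.\<close>

lemma fixed_point_index_tower_homeo:
  assumes m: "m \<ge> 3" and n: "n \<ge> 1"
  shows "fixed_point_index m (tower_homeo ^^ n) (\<lambda>_. 0)
    = 2 + (\<Sum>i | i \<in> I \<and> per i dvd n. int (per i) * (if slope i = 2 then 1 else - 1))" (is "?ind = ?sum")
proof -
  obtain e where e: "e > 0" "\<And>s u. 0 \<le> s \<Longrightarrow> s < e \<Longrightarrow> u \<in> sphere_pts m \<Longrightarrow> defect n s u \<noteq> (\<lambda>_. 0)"
    using defect_nonzero_small[OF m n] by blast
  have small: "sphere_degree m (\<lambda>x i. x i - (tower_homeo ^^ n) x i) (\<lambda>_. 0) r = ?sum" if r: "0 < r" "r < e" for r
  proof -
    have "sphere_degree m (\<lambda>x i. x i - (tower_homeo ^^ n) x i) (\<lambda>_. 0) r = field_degree m (defect n r)"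
    proof (rule sphere_degree_eq_field_degree[OF r(1)])
      show "0 + r * u i - (tower_homeo ^^ n) (\<lambda>i. 0 + r * u i) i = r * defect n r u i" for u i
        using tower_map_iterate_rescale[OF r(1), of n u] by (simp add: defect_def algebra_simps)
    qed
    also have "\<dots> = field_degree m (defect n 0)"
    proof -
      have "field_degree m (defect n (0 * r)) = field_degree m (defect n (1 * r))"
      proof (rule field_degree_homotopy[where H = "\<lambda>s. defect n (s * r)"])
        have "continuous_on ({0..1} \<times> sphere_pts m) (\<lambda>z. (\<lambda>z. defect n (fst z) (snd z)) (fst z * r, snd z))"
          by (rule continuous_on_compose2[OF continuous_on_defect[of UNIV n]])
            (auto intro!: continuous_on_Pair continuous_on_mult continuous_on_fst continuous_on_snd
              continuous_on_const continuous_on_id)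
        then show "continuous_on ({0..1} \<times> sphere_pts m) (\<lambda>z. defect n (fst z * r) (snd z))" by simp
        show "defect n (s * r) u \<in> topspace (Euclidean_space m)" if "u \<in> sphere_pts m" for s u
        proof -
          have "u \<in> topspace (Euclidean_space m)"
            using that m by (auto simp: topspace_Euclidean_space sphere_pts_iff)
          with tower_map_iterate_Euclidean_space[OF m this, where s = "s * r" and n = n] show ?thesis
            by (auto simp: defect_def topspace_Euclidean_space)
        qed
        show "defect n (s * r) u \<noteq> (\<lambda>_. 0)" if "s \<in> {0..1}" "u \<in> sphere_pts m" for s u
        proof (rule e(2)[OF _ _ that(2)])
          show "0 \<le> s * r" using that(1) r by simp
          have "s * r \<le> r" using that(1) r by (intro mult_left_le_one_le) auto
          then show "s * r < e" using r(2) by linarith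
        qed
      qed (use m in auto)
      then show ?thesis by simp
    qed
    also have "\<dots> = ?sum"
      using field_degree_defect_0[OF m n] plane_degree_towers(2)[OF _ n, of m] m by simp
    finally show ?thesis .
  qed
  have "\<forall>\<^sub>F r in at_right 0. sphere_degree m (\<lambda>x i. x i - (tower_homeo ^^ n) x i) (\<lambda>_. 0) r = ?ind"
    using m n by (intro fixed_point_index_eq continuous_map_tower_homeo_iterate isolated_fixed_point_tower_homeo) auto
  moreover have "\<forall>\<^sub>F r in at_right 0. sphere_degree m (\<lambda>x i. x i - (tower_homeo ^^ n) x i) (\<lambda>_. 0) r = ?sum"
    unfolding eventually_at_right_field using small e(1) by blast
  ultimately have "\<forall>\<^sub>F r in at_right (0::real). ?ind = ?sum" by eventually_elim simp
  then show ?thesis by (simp add: eventually_const_iff)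
qed

section \<open>An injective isotopy to the swap\<close>

definition isotopy :: "real \<Rightarrow> (nat \<Rightarrow> real) \<Rightarrow> nat \<Rightarrow> real" where
  "isotopy s v = (\<lambda>i. (1 - s) * tower_homeo v i + s * swap12 v i)"

definition polar_weight :: "(nat \<Rightarrow> real) \<Rightarrow> real" where
  "polar_weight v = (if v 0 > 0 then weight (v 1 / v 0) else 0)"

definition radial_factor :: "real \<Rightarrow> (nat \<Rightarrow> real) \<Rightarrow> real" where
  "radial_factor s v = (1 - s) * (pnorm v + polar_weight v) + s"

lemma cone_ext_polar:
  "cone_ext weight v = polar_weight v * v 0" "cone_ext (\<lambda>t. weight t * t) v = polar_weight v * v 1"
  by (auto simp: cone_ext_def polar_weight_def)

text \<open>Coordinates 0 and 2 of the image form a multiple of the vector (v 0, v 1), throughout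
  the isotopy since the swap also moves \<open>v 1\<close> to place 2. Injectivity in the plane
  thereby becomes a question on single rays.\<close>

lemma isotopy_radial: "isotopy s v 0 = radial_factor s v * v 0" "isotopy s v 2 = radial_factor s v * v 1"
  by (simp_all add: isotopy_def radial_factor_def tower_map_def cone_ext_polar swap12_def)
    (simp_all add: algebra_simps)

text \<open>The factor is positive off the origin, so equal images lie over one ray. Outwards along
  it \<open>polar_weight\<close> is constant and \<open>pnorm\<close> grows, so the factor does not
  decrease, whereas equal images of different points would need it to decrease.\<close>

lemma radial_factor_inj:
  assumes s: "s \<in> {0..1}"
    and 0: "radial_factor s v * v 0 = radial_factor s w * w 0"
    and 1: "radial_factor s v * v 1 = radial_factor s w * w 1"
  shows "v 0 = w 0 \<and> v 1 = w 1"
proof -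
  have pos: "radial_factor s v > 0" if "v 0 \<noteq> 0 \<or> v 1 \<noteq> 0" for v
  proof -
    have "pnorm v + polar_weight v > 0"
      using that weight_nonneg by (auto simp: pnorm_def polar_weight_def intro!: add_pos_nonneg)
    then show ?thesis
      using s by (cases "s = 0") (auto simp: radial_factor_def intro!: add_nonneg_pos)
  qed
  have zero: "v 0 = w 0 \<and> v 1 = w 1"
    if "radial_factor s v * v 0 = radial_factor s w * w 0" "radial_factor s v * v 1 = radial_factor s w * w 1"
      and "v 0 = 0 \<and> v 1 = 0" for v w
  proof -
    have "radial_factor s w * w 0 = 0" "radial_factor s w * w 1 = 0"
      unfolding that(1,2)[symmetric] using that(3) by simp_all
    note eq = this
    have "w 0 = 0 \<and> w 1 = 0"
    proof (rule ccontr)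
      assume n: "\<not> (w 0 = 0 \<and> w 1 = 0)"
      then have "radial_factor s w > 0" using pos[of w] by blast
      then show False using eq n by simp
    qed
    then show ?thesis using that(3) by simp
  qed
  show ?thesis
  proof (cases "(v 0 = 0 \<and> v 1 = 0) \<or> (w 0 = 0 \<and> w 1 = 0)")
    case True
    then show ?thesis
    proof
      assume "v 0 = 0 \<and> v 1 = 0"
      then show ?thesis by (rule zero[of v w, OF 0 1])
    next
      assume "w 0 = 0 \<and> w 1 = 0"
      then have "w 0 = v 0 \<and> w 1 = v 1" by (rule zero[of w v, OF 0[symmetric] 1[symmetric]])
      then show ?thesis by (metis)
    qed
  next
    case False
    then have pv: "radial_factor s v > 0" and pw: "radial_factor s w > 0" using pos[of v] pos[of w] by blast+
    define \<kappa> where "\<kappa> = radial_factor s v / radial_factor s w"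
    have \<kappa>: "\<kappa> > 0" and rv: "radial_factor s v = \<kappa> * radial_factor s w"
      using pv pw by (simp_all add: \<kappa>_def)
    have "radial_factor s v * v 0 / radial_factor s w = w 0" "radial_factor s v * v 1 / radial_factor s w = w 1"
      unfolding 0 1 using pw by simp_all
    then have w: "w 0 = \<kappa> * v 0" "w 1 = \<kappa> * v 1" by (simp_all add: \<kappa>_def)
    have pww: "polar_weight w = polar_weight v"
      using \<kappa> w by (simp add: polar_weight_def zero_less_mult_iff)
    have pnw: "pnorm w = \<kappa> * pnorm v"
      using \<kappa> w by (simp add: pnorm_def abs_mult algebra_simps)
    have pn: "pnorm v \<ge> 0" "pnorm w \<ge> 0" by (simp_all add: pnorm_def)
    have d: "radial_factor s w - radial_factor s v = (1 - s) * ((\<kappa> - 1) * pnorm v)"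
      by (simp add: radial_factor_def pww pnw algebra_simps)
    have "\<kappa> = 1"
    proof (rule ccontr)
      assume "\<kappa> \<noteq> 1"
      then consider "\<kappa> > 1" | "\<kappa> < 1" by linarith
      then show False
      proof cases
        case 1
        then have "radial_factor s w - radial_factor s v \<ge> 0" unfolding d using s pn by simp
        moreover have "radial_factor s v > radial_factor s w"
          using rv pw 1 by simp
        ultimately show False by simp
      next
        case 2
        then have "(1 - s) * ((\<kappa> - 1) * pnorm v) \<le> 0"
          using s pn by (intro mult_nonneg_nonpos mult_nonpos_nonneg) auto
        moreover have "radial_factor s v < radial_factor s w" using rv pw 2 by simp
        ultimately show False using d by simp
      qed
    qed
    then show ?thesis using w by simp
  qed
qed

text \<open>Once \<open>v 0\<close> and \<open>v 1\<close> are known, so are all terms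
  \<open>cone_ext g v\<close>. Each other coordinate enters through the strictly increasing function
  \<open>(1 - s) * sq x + s * x\<close> and can be recovered.\<close>

lemma isotopy_inj:
  assumes s: "s \<in> {0..1}" and eq: "isotopy s v = isotopy s w"
  shows "v = w"
proof -
  have 01: "v 0 = w 0 \<and> v 1 = w 1"
    using radial_factor_inj[OF s, of v w] fun_cong[OF eq, of 0] fun_cong[OF eq, of 2] by (simp add: isotopy_radial)
  have mono: "x = y" if "(1 - s) * sq x + s * x = (1 - s) * sq y + s * y" for x y
  proof (rule ccontr)
    have less: "(1 - s) * sq x + s * x < (1 - s) * sq y + s * y" if "x < y" for x y
    proof (cases "s = 1")
      case False
      then have "(1 - s) * sq x < (1 - s) * sq y"
        using s strict_monoD[OF sq_strict_mono that] by (intro mult_strict_left_mono) auto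
      moreover have "s * x \<le> s * y" using s that by (intro mult_left_mono) auto
      ultimately show ?thesis by linarith
    qed (use that in simp)
    assume "x \<noteq> y"
    then show False using less[of x y] less[of y x] that by (cases "x < y") auto
  qed
  have c: "cone_ext g v = cone_ext g w" for g using 01 by (simp add: cone_ext_def)
  have 2: "v 2 = w 2"
    by (rule mono) (use fun_cong[OF eq, of 1] in \<open>simp add: isotopy_def tower_map_def swap12_def c algebra_simps\<close>)
  have "v i = w i" if i: "i \<ge> 3" for i
  proof (rule mono)
    have "isotopy s u i = (1 - s) * sq (u i) + s * u i" for u
      using i by (simp add: isotopy_def tower_map_def swap12_def)
    then show "(1 - s) * sq (v i) + s * v i = (1 - s) * sq (w i) + s * w i"
      using fun_cong[OF eq, of i] by simp
  qed
  note 3 = this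
  show ?thesis
  proof
    fix i :: nat
    consider "i = 0" | "i = 1" | "i = 2" | "i \<ge> 3" by linarith
    then show "v i = w i"
    proof cases
      case 4
      then show ?thesis by (rule 3)
    qed (use 01 2 in simp_all)
  qed
qed

lemma isotopy_0: "isotopy 0 = tower_homeo" and isotopy_1: "isotopy 1 = swap12"
  by (simp_all add: isotopy_def fun_eq_iff)

lemma tower_homeo_surj:
  assumes m: "m \<ge> 3" and y: "y \<in> topspace (Euclidean_space m)"
  shows "\<exists>v \<in> topspace (Euclidean_space m). tower_homeo v = y"
proof -
  have "\<exists>x q. \<forall>v. v 0 = x \<longrightarrow> v 1 = q \<longrightarrow> radial_factor 0 v * v 0 = y 0 \<and> radial_factor 0 v * v 1 = y 2"
  proof (cases "y 0 = 0 \<and> y 2 = 0")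
    case False
    define N where "N = \<bar>y 0\<bar> + \<bar>y 2\<bar>"
    define B where "B = (if y 0 > 0 then weight (y 2 / y 0) else 0)"
    define D where "D = sqrt (B\<^sup>2 + 4 * N)"
    \<comment> \<open>On the ray of (y 0, y 2) the equation to solve is
      \<open>(\<kappa> * N + B) * \<kappa> = 1\<close>; this is its positive root, with the square
      root moved into the denominator.\<close>
    define \<kappa> where "\<kappa> = 2 / (B + D)"
    have N: "N > 0" using False by (auto simp: N_def intro: add_pos_nonneg add_nonneg_pos)
    have B: "B \<ge> 0" by (simp add: B_def weight_nonneg)
    have D: "D > 0" "D\<^sup>2 = B\<^sup>2 + 4 * N" using N by (simp_all add: D_def add_nonneg_pos)
    have \<kappa>: "\<kappa> > 0" using B D by (simp add: \<kappa>_def add_nonneg_pos)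
    have "B + D \<noteq> 0" using B D(1) by linarith
    then have BD: "\<kappa> * (B + D) = 2" by (simp add: \<kappa>_def del: distrib_left_numeral)
    have N4: "4 * N = D\<^sup>2 - B\<^sup>2" using D(2) by simp
    have "(\<kappa> * N + B) * (4 * \<kappa>) = \<kappa>\<^sup>2 * (4 * N) + 4 * B * \<kappa>"
      by (simp add: power2_eq_square algebra_simps)
    also have "\<dots> = (\<kappa> * (B + D)) * (\<kappa> * (B + D) - 2 * \<kappa> * B) + 4 * B * \<kappa>"
      unfolding N4 by (simp add: power2_eq_square algebra_simps)
    also have "\<dots> = 4" by (simp add: BD)
    finally have key: "(\<kappa> * N + B) * \<kappa> = 1" by linarith
    show ?thesis
    proof (rule exI[of _ "\<kappa> * y 0"], rule exI[of _ "\<kappa> * y 2"], intro allI impI)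
      fix v :: "nat \<Rightarrow> real" assume v: "v 0 = \<kappa> * y 0" "v 1 = \<kappa> * y 2"
      have "v 1 / v 0 = y 2 / y 0" "0 < v 0 \<longleftrightarrow> 0 < y 0"
        unfolding v using \<kappa> by (simp_all add: zero_less_mult_iff)
      then have "polar_weight v = B" by (simp only: polar_weight_def B_def)
      moreover have "pnorm v = \<kappa> * N"
        unfolding pnorm_def v N_def abs_mult using \<kappa> by (simp add: distrib_left)
      ultimately have "radial_factor 0 v = \<kappa> * N + B" by (simp add: radial_factor_def)
      then have "radial_factor 0 v * v 0 = ((\<kappa> * N + B) * \<kappa>) * y 0"
        "radial_factor 0 v * v 1 = ((\<kappa> * N + B) * \<kappa>) * y 2"
        by (simp_all only: v mult.assoc)
      then show "radial_factor 0 v * v 0 = y 0 \<and> radial_factor 0 v * v 1 = y 2"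
        by (simp only: key mult_1_left simp_thms)
    qed
  next
    case True
    then show ?thesis by (intro exI[of _ "0 :: real"] allI impI) simp
  qed
  then obtain x q where xq: "\<forall>v. v 0 = x \<longrightarrow> v 1 = q \<longrightarrow> radial_factor 0 v * v 0 = y 0 \<and> radial_factor 0 v * v 1 = y 2"
    by (elim exE) (rule that)
  obtain r where r: "\<And>z. sq (r z) = z" using sq_surj by metis
  \<comment> \<open>Keeps the coordinates of the preimage from \<open>m\<close> on equal to
    0.\<close>
  have r0: "r 0 = 0" using r[of 0] by (simp add: sq_def)
  define C where "C = cone_ext (\<lambda>t. weight t * step t) (\<lambda>i. if i = 0 then x else q)"
  define v where "v = (\<lambda>i. if i = 0 then x else if i = 1 then q else if i = 2 then r (y 1 - C) else r (y i))"
  have v: "v 0 = x" "v 1 = q" "v 2 = r (y 1 - C)" "\<And>i. i \<ge> 3 \<Longrightarrow> v i = r (y i)" by (auto simp: v_def)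
  have C: "cone_ext (\<lambda>t. weight t * step t) v = C" by (simp add: C_def cone_ext_def v[unfolded One_nat_def])
  have vE: "v \<in> topspace (Euclidean_space m)"
    using m y r0 by (auto simp: topspace_Euclidean_space v)
  have xq': "radial_factor 0 v * v 0 = y 0" "radial_factor 0 v * v 1 = y 2"
    using xq[THEN spec, of v] v(1,2) by auto
  have "tower_homeo v = y"
  proof (rule ext)
    fix i :: nat
    consider "i = 0" | "i = 1" | "i = 2" | "i \<ge> 3" by linarith
    then show "tower_homeo v i = y i"
    proof cases
      case 1
      have "tower_homeo v 0 = radial_factor 0 v * v 0" unfolding isotopy_0[symmetric] by (rule isotopy_radial)
      then show ?thesis unfolding 1 xq' .
    next
      case 2
      have "tower_homeo v 1 = cone_ext (\<lambda>t. weight t * step t) v + sq (v 2)" by (simp add: tower_map_def)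
      also have "\<dots> = y 1" unfolding C v(3) r by simp
      finally show ?thesis using 2 by simp
    next
      case 3
      have "tower_homeo v 2 = radial_factor 0 v * v 1" unfolding isotopy_0[symmetric] by (rule isotopy_radial)
      then show ?thesis unfolding 3 xq' .
    next
      case 4
      have "tower_homeo v i = sq (v i)" using 4 by (simp add: tower_map_def)
      then show ?thesis unfolding v(4)[OF 4] r .
    qed
  qed
  then show ?thesis using vE by blast
qed

text \<open>Continuity of the inverse comes from invariance of domain.\<close>

lemma homeomorphic_map_tower_homeo:
  assumes m: "m \<ge> 3"
  shows "homeomorphic_map (Euclidean_space m) (Euclidean_space m) tower_homeo"
proof -
  let ?E = "Euclidean_space m"
  have inj: "inj_on tower_homeo (topspace ?E)"
    using isotopy_inj[of 0] by (auto simp: inj_on_def isotopy_0)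
  have cont: "continuous_map ?E ?E tower_homeo"
    using continuous_map_tower_homeo_iterate[OF m, of 1] by simp
  have im: "tower_homeo ` topspace ?E = topspace ?E"
    using tower_map_Euclidean_space[OF m] tower_homeo_surj[OF m] by (force simp: image_iff)
  have "embedding_map (subtopology ?E (topspace ?E)) ?E tower_homeo"
    by (rule invariance_of_domain_Euclidean_space_embedding_map) (use inj cont in auto)
  then show ?thesis by (simp add: embedding_map_def im)
qed

lemma continuous_on_tower_homeo: "continuous_on A tower_homeo"
  using continuous_on_tower_map_iterate_at[of A 1 1] by simp

text \<open>Injectivity of the isotopy keeps the difference to the value at \<open>p\<close> away
  from 0 on every sphere about \<open>p\<close>, and the swap at its end is linear, so the degree is
  that of \<open>swap12\<close> for each radius and each \<open>p\<close>.\<close>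

lemma local_degree_tower_homeo:
  assumes m: "m \<ge> 3" and p: "p \<in> topspace (Euclidean_space m)"
  shows "local_degree m (\<lambda>x i. tower_homeo x i - tower_homeo p i) p = - 1"
proof -
  have deg: "sphere_degree m (\<lambda>x i. tower_homeo x i - tower_homeo p i) p r = - 1" if r: "r > 0" for r
  proof -
    define H where "H s u = (\<lambda>i. isotopy s (\<lambda>j. p j + r * u j) i - isotopy s p i)" for s u
    have "sphere_degree m (\<lambda>x i. tower_homeo x i - tower_homeo p i) p r = field_degree m (H 0)"
      by (simp add: sphere_degree_def field_degree_def H_def isotopy_0)
    also have "\<dots> = field_degree m (H 1)"
    proof (rule field_degree_homotopy)
      let ?A = "{0..1::real} \<times> sphere_pts m"
      have q: "continuous_on ?A (\<lambda>z. (\<lambda>j. p j + r * snd z j))"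
        by (intro continuous_on_coordinatewise_then_product continuous_on_add continuous_on_mult
            continuous_on_const continuous_on_snd_coord)
      have "continuous_on ?A (\<lambda>z. tower_homeo (\<lambda>j. p j + r * snd z j))"
        by (rule continuous_on_compose2[OF continuous_on_tower_homeo[of UNIV] q]) auto
      then have c1: "continuous_on ?A (\<lambda>z. tower_homeo (\<lambda>j. p j + r * snd z j) i)" for i
        by (rule continuous_on_product_then_coordinatewise)
      have c2: "continuous_on ?A (\<lambda>z. swap12 (\<lambda>j. p j + r * snd z j) i)" for i
        unfolding swap12_def
        by (cases "i = 1"; cases "i = 2"; simp; intro continuous_on_add continuous_on_mult
            continuous_on_const continuous_on_snd_coord)
      show "continuous_on ?A (\<lambda>z. H (fst z) (snd z))"
        unfolding H_def isotopy_def
        by (rule continuous_on_coordinatewise_then_product)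
          (intro continuous_on_add continuous_on_mult continuous_on_diff continuous_on_const
            continuous_on_fst continuous_on_id c1 c2)
      have E: "isotopy s v \<in> topspace (Euclidean_space m)" if "v \<in> topspace (Euclidean_space m)" for s v
        using tower_map_Euclidean_space[OF m that, of 1] that m
        by (auto simp: isotopy_def topspace_Euclidean_space swap12_def)
      show "H s u \<in> topspace (Euclidean_space m)" if "u \<in> sphere_pts m" for s u
      proof -
        have "(\<lambda>j. p j + r * u j) \<in> topspace (Euclidean_space m)"
          using that p m by (auto simp: topspace_Euclidean_space sphere_pts_iff)
        from E[OF this, of s] E[OF p, of s] show ?thesis
          by (auto simp: H_def topspace_Euclidean_space)
      qed
      show "H s u \<noteq> (\<lambda>_. 0)" if "s \<in> {0..1}" "u \<in> sphere_pts m" for s u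
      proof
        assume "H s u = (\<lambda>_. 0)"
        then have "isotopy s (\<lambda>j. p j + r * u j) = isotopy s p" by (simp add: H_def fun_eq_iff)
        then have "(\<lambda>j. p j + r * u j) = p" by (rule isotopy_inj[OF that(1)])
        then have "r * u j = 0" for j by (auto simp: fun_eq_iff)
        then show False using r sphere_pts_nonzero[OF _ that(2)] m by auto
      qed
    qed (use m in auto)
    also have "H 1 = (\<lambda>u i. r * swap12 u i)"
      by (auto simp: H_def isotopy_1 swap12_def fun_eq_iff)
    also have "field_degree m \<dots> = - 1"
      using r m by (simp add: field_degree_scale field_degree_swap12)
    finally show ?thesis .
  qed
  have ev: "\<forall>\<^sub>F r in at_right 0. sphere_degree m (\<lambda>x i. tower_homeo x i - tower_homeo p i) p r = - 1"
    unfolding eventually_at_right_field using deg by (intro exI[of _ 1]) auto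
  show ?thesis
    unfolding local_degree_def
  proof (rule the_equality, rule ev)
    fix d assume "\<forall>\<^sub>F r in at_right 0. sphere_degree m (\<lambda>x i. tower_homeo x i - tower_homeo p i) p r = d"
    with ev have "\<forall>\<^sub>F r in at_right (0::real). d = - 1" by eventually_elim auto
    then show "d = - 1" by (simp add: eventually_const_iff)
  qed
qed

end

theorem theorem4p8:
  fixes m :: nat and a :: "nat \<Rightarrow> int"
  assumes "m \<ge> 3"
  shows "\<exists>f :: (nat \<Rightarrow> real) \<Rightarrow> nat \<Rightarrow> real.
           homeomorphic_map (Euclidean_space m) (Euclidean_space m) f \<and>
           orientation_reversing m f \<and>
           f (\<lambda>_. 0) = (\<lambda>_. 0) \<and>
           (\<forall>n\<ge>1. isolated_fixed_point m (f ^^ n) (\<lambda>_. 0)) \<and>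
           (\<forall>n\<ge>1. fixed_point_index m (f ^^ n) (\<lambda>_. 0) = (\<Sum>\<^sub>\<infinity>k\<in>{1..}. a k * reg k n))"
proof -
  \<comment> \<open>The doubling alone gives index 2 for every iterate, which is 2 reg_1; the towers
    supply the rest.\<close>
  define b where "b k = a k - (if k = 1 then 2 else 0)" for k
  \<comment> \<open>One tower of period k for each unit of \<open>\<bar>b k\<bar>\<close>, all of
    the kind given by the sign of \<open>b k\<close>. The encoding merely numbers them, as the place
    of a window depends on its number.\<close>
  define J where "J = (SIGMA k:{1..}. {..<nat \<bar>b k\<bar>})"
  define I where "I = prod_encode ` J"
  define per where "per = fst \<circ> prod_decode"
  define slope :: "nat \<Rightarrow> real" where "slope i = (if b (per i) > 0 then 2 else 0)" for i
  interpret towers I per slope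
  proof
    show "per i \<ge> 1" if "i \<in> I" for i using that by (auto simp: I_def J_def per_def)
    show "slope i \<in> {0, 2}" for i by (simp add: slope_def)
    have "{i \<in> I. per i = k} \<subseteq> prod_encode ` ({k} \<times> {..<nat \<bar>b k\<bar>})" for k
      by (auto simp: I_def J_def per_def)
    then show "finite {i \<in> I. per i = k}" for k
      by (rule finite_subset) auto
  qed
  have count: "2 + (\<Sum>i | i \<in> I \<and> per i dvd n. int (per i) * (if slope i = 2 then 1 else - 1))
      = (\<Sum>\<^sub>\<infinity>k\<in>{1..}. a k * reg k n)" if n: "n \<ge> 1" for n
  proof -
    have dvd: "k \<ge> 1" if "k dvd n" for k using that n by (cases k) auto
    have fin: "finite {k. k dvd n}" using n by simp
    have "{i. i \<in> I \<and> per i dvd n} = prod_encode ` (SIGMA k:{k. k dvd n}. {..<nat \<bar>b k\<bar>})"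
      using dvd by (auto simp: I_def J_def per_def)
    then have "(\<Sum>i | i \<in> I \<and> per i dvd n. int (per i) * (if slope i = 2 then 1 else - 1))
      = (\<Sum>z\<in>(SIGMA k:{k. k dvd n}. {..<nat \<bar>b k\<bar>}). int (fst z) * (if b (fst z) > 0 then 1 else - 1))"
      by (simp add: sum.reindex inj_prod_encode per_def slope_def) (rule sum.cong, auto)
    also have "\<dots> = (\<Sum>k | k dvd n. \<Sum>j<nat \<bar>b k\<bar>. int k * (if b k > 0 then 1 else - 1))"
      using fin by (subst sum.Sigma) (auto intro!: sum.cong)
    also have "\<dots> = (\<Sum>k | k dvd n. b k * int k)"
      by (intro sum.cong) auto
    also have "\<dots> = (\<Sum>k | k dvd n. a k * int k) - (\<Sum>k | k dvd n. if k = 1 then 2 else 0)"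
      unfolding sum_subtractf[symmetric] by (intro sum.cong) (auto simp: b_def algebra_simps)
    also have "(\<Sum>k | k dvd n. if k = 1 then 2 else 0 :: int) = 2"
      using fin by (simp add: sum.delta)
    finally show ?thesis using infsum_reg[OF n, of a] by simp
  qed
  show ?thesis
  proof (intro exI[of _ tower_homeo] conjI allI impI)
    show "orientation_reversing m tower_homeo"
      unfolding orientation_reversing_def
      using homeomorphic_map_tower_homeo[OF assms] local_degree_tower_homeo[OF assms] by blast
    show "fixed_point_index m (tower_homeo ^^ n) (\<lambda>_. 0) = (\<Sum>\<^sub>\<infinity>k\<in>{1..}. a k * reg k n)" if "n \<ge> 1" for n
      using fixed_point_index_tower_homeo[OF assms that] count[OF that] by simp
  qed (use assms in \<open>auto intro: homeomorphic_map_tower_homeo tower_homeo_0 isolated_fixed_point_tower_homeo\<close>)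
qed

end
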